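(* Assume the standing hypotheses, with $2<p<m$ (no upper bound on $p$ relative to $2^*$ is needed). Define \[ \underline{\lambda}_1:=\inf_{\psi\in H^1_0(\Omega)\cap L^\infty(\Omega),\ \psi\not\equiv 0}\ \frac{p\beta}{2}\,\frac{\|\psi\|^2\,\|\psi\|_\infty^{p-2}}{\|\psi\|_p^p}. \] Then $\underline{\lambda}_1>0$, and for every $\lambda>\underline{\lambda}_1$ there exist $m_0>2^*$ and $\delta>0$ (independent of $m$) such that for every $m\ge m_0$ the functional $J_m$ has a global minimum point $u_m\in X_m$, $u_m\ge 0$, $u_m\not\equiv 0$, which is a solution of problem (P$_m$) and satisfies $J_m(u_m)\le-\delta<0$.
   Context: Let $\Omega\subset\mathbb{R}^N$ be a bounded domain and $M(x)=(m_{ij}(x))$ a symmetric matrix with bounded measurable entries such that $\alpha|\xi|^2\le M(x)\xi\cdot\xi\le\beta|\xi|^2$ for all $\xi\in\mathbb{R}^N$, a.e. $x\in\Omega$, where $0<\alpha<\beta$. Let $L(v)=-\mathrm{div}(M(x)\nabla v)$. Here $2^*=2N/(N-2)$ if $N>2$ and $2^*=+\infty$ if $N=1,2$. $\|\cdot\|_r$ is the $L^r(\Omega)$ norm, $\|v\|=\|\nabla v\|_2$ is the $H^1_0(\Omega)$ norm, $X_m=H^1_0(\Omega)\cap L^m(\Omega)$ with norm $\|\cdot\|+\|\cdot\|_m$, and $\lambda>0$. Problem (P$_m$) is: $L(u)+u^{m-1}=\lambda u^{p-1}$ in $\Omega$, $u=0$ on $\partial\Omega$; a solution is $w\in X_m$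 satisfying $\int_\Omega M\nabla w\cdot\nabla v+\int_\Omega|w|^{m-2}wv-\lambda\int_\Omega|w|^{p-2}wv=0$ for all $v\in X_m$. The functional is $J_m(v)=\frac12\int_\Omega M(x)\nabla v\cdot\nabla v+\frac1m\|v\|_m^m-\frac{\lambda}{p}\|v^+\|_p^p$ on $X_m$.
   Formalization: The requirement m_0 > 2^* is imposed only for N > 2; for N = 1, 2, where 2^* = +∞ makes it unsatisfiable by any finite m_0, it is dropped and only m_0 > p is required. *)

theory Defs
  imports "HOL-Analysis.Analysis" "HOL-Probability.Essential_Supremum"
begin

type_synonym 'n pt = "real ^ 'n"

definition Cc1_grad :: "('n::finite) pt set \<Rightarrow> ('n pt \<Rightarrow> real) \<Rightarrow> ('n pt \<Rightarrow> 'n pt) \<Rightarrow> bool" where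
  "Cc1_grad \<Omega> \<phi> g \<longleftrightarrow>
     (\<forall>x. (\<phi> has_derivative (\<lambda>h. g x \<bullet> h)) (at x)) \<and> continuous_on UNIV g \<and>
     compact (closure {x. \<phi> x \<noteq> 0}) \<and> closure {x. \<phi> x \<noteq> 0} \<subseteq> \<Omega>"

definition H10_grad :: "('n::finite) pt set \<Rightarrow> ('n pt \<Rightarrow> real) \<Rightarrow> ('n pt \<Rightarrow> 'n pt) \<Rightarrow> bool" where
  "H10_grad \<Omega> u G \<longleftrightarrow>
     set_integrable lebesgue \<Omega> (\<lambda>x. (u x)\<^sup>2) \<and> u \<in> borel_measurable lebesgue \<and>
     set_integrable lebesgue \<Omega> (\<lambda>x. (norm (G x))\<^sup>2) \<and> G \<in> borel_measurable lebesgue \<and>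
     (\<exists>\<phi> g. (\<forall>k. Cc1_grad \<Omega> (\<phi> k) (g k)) \<and>
        (\<lambda>k. LINT x:\<Omega>|lebesgue. (\<phi> k x - u x)\<^sup>2) \<longlonglongrightarrow> 0 \<and>
        (\<lambda>k. LINT x:\<Omega>|lebesgue. (norm (g k x - G x))\<^sup>2) \<longlonglongrightarrow> 0)"

definition H10 :: "('n::finite) pt set \<Rightarrow> ('n pt \<Rightarrow> real) set" where
  "H10 \<Omega> = {u. \<exists>G. H10_grad \<Omega> u G}"

text \<open>weak gradient (unique up to null sets)\<close>
definition wgrad :: "('n::finite) pt set \<Rightarrow> ('n pt \<Rightarrow> real) \<Rightarrow> ('n pt \<Rightarrow> 'n pt)" where
  "wgrad \<Omega> u = (SOME G. H10_grad \<Omega> u G)"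

definition H10_norm :: "('n::finite) pt set \<Rightarrow> ('n pt \<Rightarrow> real) \<Rightarrow> real" where
  "H10_norm \<Omega> v = sqrt (LINT x:\<Omega>|lebesgue. (norm (wgrad \<Omega> v x))\<^sup>2)"

definition Lnorm :: "('n::finite) pt set \<Rightarrow> real \<Rightarrow> ('n pt \<Rightarrow> real) \<Rightarrow> real" where
  "Lnorm \<Omega> r v = (LINT x:\<Omega>|lebesgue. \<bar>v x\<bar> powr r) powr (1 / r)"

definition Lp_space :: "('n::finite) pt set \<Rightarrow> real \<Rightarrow> ('n pt \<Rightarrow> real) set" where
  "Lp_space \<Omega> r = {v. v \<in> borel_measurable lebesgue \<and> set_integrable lebesgue \<Omega> (\<lambda>x. \<bar>v x\<bar> powr r)}"

definition Linf_enorm :: "('n::finite) pt set \<Rightarrow> ('n pt \<Rightarrow> real) \<Rightarrow> ereal" where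
  "Linf_enorm \<Omega> v = esssup (restrict_space lebesgue \<Omega>) (\<lambda>x. ereal \<bar>v x\<bar>)"

definition Linf_space :: "('n::finite) pt set \<Rightarrow> ('n pt \<Rightarrow> real) set" where
  "Linf_space \<Omega> = {v. v \<in> borel_measurable lebesgue \<and> Linf_enorm \<Omega> v < \<infinity>}"

definition Linf_norm :: "('n::finite) pt set \<Rightarrow> ('n pt \<Rightarrow> real) \<Rightarrow> real" where
  "Linf_norm \<Omega> v = real_of_ereal (Linf_enorm \<Omega> v)"

definition Xm :: "('n::finite) pt set \<Rightarrow> real \<Rightarrow> ('n pt \<Rightarrow> real) set" where
  "Xm \<Omega> m = H10 \<Omega> \<inter> Lp_space \<Omega> m"

definition Jm :: "('n::finite) pt set \<Rightarrow> ('n pt \<Rightarrow> real ^ 'n ^ 'n) \<Rightarrow> real \<Rightarrow> real \<Rightarrow> real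
                  \<Rightarrow> ('n pt \<Rightarrow> real) \<Rightarrow> real" where
  "Jm \<Omega> M p lam m v =
     1/2 * (LINT x:\<Omega>|lebesgue. (M x *v wgrad \<Omega> v x) \<bullet> wgrad \<Omega> v x)
     + 1/m * (Lnorm \<Omega> m v) powr m
     - lam/p * (Lnorm \<Omega> p (\<lambda>x. max (v x) 0)) powr p"

definition is_solution_Pm :: "('n::finite) pt set \<Rightarrow> ('n pt \<Rightarrow> real ^ 'n ^ 'n) \<Rightarrow> real \<Rightarrow> real \<Rightarrow> real
                  \<Rightarrow> ('n pt \<Rightarrow> real) \<Rightarrow> bool" where
  "is_solution_Pm \<Omega> M p lam m w \<longleftrightarrow> w \<in> Xm \<Omega> m \<and>
     (\<forall>v \<in> Xm \<Omega> m.
        (LINT x:\<Omega>|lebesgue. (M x *v wgrad \<Omega> w x) \<bullet> wgrad \<Omega> v x)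
        + (LINT x:\<Omega>|lebesgue. \<bar>w x\<bar> powr (m - 2) * w x * v x)
        - lam * (LINT x:\<Omega>|lebesgue. \<bar>w x\<bar> powr (p - 2) * w x * v x) = 0)"

definition lambda1_low :: "('n::finite) pt set \<Rightarrow> real \<Rightarrow> real \<Rightarrow> real" where
  "lambda1_low \<Omega> p \<beta> = Inf {p * \<beta> / 2 * (H10_norm \<Omega> \<psi>)\<^sup>2 * (Linf_norm \<Omega> \<psi>) powr (p - 2)
                            / (Lnorm \<Omega> p \<psi>) powr p
                          | \<psi>. \<psi> \<in> H10 \<Omega> \<inter> Linf_space \<Omega> \<and>
                               \<not> (AE x in lebesgue. x \<in> \<Omega> \<longrightarrow> \<psi> x = 0)}"

end

theory Submission
  imports Defs "HOL-Complex_Analysis.Great_Picard"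
begin

text \<open>
  The potential \<open>F s = \<bar>s\<bar>\<^sup>m / m - lam (s\<^sup>+)\<^sup>p / p\<close> dominates \<open>\<bar>s\<bar>\<^sup>m / (2m) - K\<close> and becomes convex after
  adding a multiple of \<open>s\<^sup>2\<close>, because \<open>m > p > 2\<close>. Hence minimizing sequences of \<open>J\<^sub>m\<close> are bounded in
  \<open>H\<^sup>1\<^sub>0\<close>, a subsequence converges in \<open>L\<^sup>2\<close> by Rellich's theorem, and the midpoint inequality upgrades this to
  strong convergence in \<open>H\<^sup>1\<^sub>0\<close>; Fatou's lemma makes the limit a minimizer. No growth restriction on \<open>p\<close>
  is needed since the term of order \<open>m\<close> controls the one of order \<open>p\<close>. Passing to \<open>\<bar>u\<bar>\<close> does not
  increase the energy, and differentiating along lines gives the equation. If \<open>lam\<close> exceeds the quotient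
  of some \<open>\<psi>\<close>, then \<open>J\<^sub>m\<close> at \<open>\<bar>\<psi>\<bar>\<close> divided by its sup norm is at most \<open>- \<eta> + measure \<Omega> / m\<close> with
  \<open>\<eta> > 0\<close>, which is negative uniformly in large \<open>m\<close>. The threshold is positive by
  \<open>\<integral> \<bar>\<psi>\<bar>\<^sup>p \<le> (sup \<bar>\<psi>\<bar>)\<^sup>p\<^sup>-\<^sup>2 \<integral> \<bar>\<psi>\<bar>\<^sup>2\<close> and Poincare's inequality.
\<close>

section \<open>Square-integrable functions\<close>

text \<open>The gradient \<open>wgrad\<close> is picked by Hilbert choice, so no formula gives it
  for a sum, an absolute value or a limit. Energies are therefore studied on pairs of a function and
  one of its gradients; uniqueness of the gradient up to null sets, a closability statement, carries
  the results for pairs over to \<open>Jm\<close>. Rellich's theorem rests on averages over the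
  balls of finite nets: these are countably many bounded sequences of numbers, so a diagonal
  argument makes them all converge, and a translation estimate bounds what the averages miss. The
  factor p \<beta> / 2 of the threshold is read off from the test function |\<psi>| / s, with s the
  sup norm of \<psi>: its quadratic part is at most \<beta> / (2 s^2) times the squared gradient
  norm, and its gain, lam / (p s^p) times the integral of |\<psi>|^p, exceeds that bound exactly
  when lam exceeds the quotient.\<close>

definition l2 :: "'a measure \<Rightarrow> ('a \<Rightarrow> 'b::euclidean_space) \<Rightarrow> bool" where
  "l2 M f \<longleftrightarrow> f \<in> borel_measurable M \<and> integrable M (\<lambda>x. (norm (f x))\<^sup>2)"

text \<open>A seminorm on functions rather than on classes. It is 0 whenever the squared norm is not
  integrable, so a bound on \<open>n2\<close> says little without \<open>l2\<close>.\<close>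

definition n2 :: "'a measure \<Rightarrow> ('a \<Rightarrow> 'b::euclidean_space) \<Rightarrow> real" where
  "n2 M f = sqrt (\<integral>x. (norm (f x))\<^sup>2 \<partial>M)"

lemma l2_measurable: "l2 M f \<Longrightarrow> f \<in> borel_measurable M"
  and l2_integrable_sq: "l2 M f \<Longrightarrow> integrable M (\<lambda>x. (norm (f x))\<^sup>2)"
  by (auto simp: l2_def)

lemma n2_nonneg [simp]: "0 \<le> n2 M f"
  by (simp add: n2_def)

lemma n2_sq: "(n2 M f)\<^sup>2 = (\<integral>x. (norm (f x))\<^sup>2 \<partial>M)"
  by (simp add: n2_def)

lemma l2_dominated:
  assumes "f \<in> borel_measurable M" "l2 M g" "AE x in M. norm (f x) \<le> C * norm (g x)"
  shows "l2 M f"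
  unfolding l2_def
proof (intro conjI)
  show "integrable M (\<lambda>x. (norm (f x))\<^sup>2)"
  proof (rule Bochner_Integration.integrable_bound[where f = "\<lambda>x. C\<^sup>2 * (norm (g x))\<^sup>2"])
    show "AE x in M. norm ((norm (f x))\<^sup>2) \<le> norm (C\<^sup>2 * (norm (g x))\<^sup>2)"
      using assms(3)
    proof eventually_elim
      case (elim x)
      then have "(norm (f x))\<^sup>2 \<le> (C * norm (g x))\<^sup>2"
        by (intro power_mono) auto
      then show ?case
        by (simp add: power_mult_distrib abs_mult)
    qed
  qed (use assms in \<open>auto simp: l2_def\<close>)
qed (use assms in auto)

lemma n2_le:
  assumes "l2 M g" "AE x in M. norm (f x) \<le> C * norm (g x)" "0 \<le> C"
  shows "n2 M f \<le> C * n2 M g"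
proof -
  have "(\<integral>x. (norm (f x))\<^sup>2 \<partial>M) \<le> (\<integral>x. C\<^sup>2 * (norm (g x))\<^sup>2 \<partial>M)"
  proof (rule integral_mono_AE')
    show "AE x in M. (norm (f x))\<^sup>2 \<le> C\<^sup>2 * (norm (g x))\<^sup>2"
      using assms(2) by eventually_elim (metis norm_ge_zero power_mono power_mult_distrib)
  qed (use assms in \<open>auto simp: l2_def\<close>)
  also have "\<dots> = (C * n2 M g)\<^sup>2"
    by (simp add: power_mult_distrib n2_sq)
  finally show ?thesis
    unfolding n2_def[of M f] using assms(3) real_le_lsqrt by (simp add: real_le_lsqrt)
qed

lemma n2_cong_AE:
  assumes "AE x in M. norm (f x) = norm (g x)" "f \<in> borel_measurable M" "g \<in> borel_measurable M"
  shows "n2 M f = n2 M g"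
proof -
  have "(\<integral>x. (norm (f x))\<^sup>2 \<partial>M) = (\<integral>x. (norm (g x))\<^sup>2 \<partial>M)"
    by (rule integral_cong_AE) (use assms in auto)
  then show ?thesis by (simp add: n2_def)
qed

lemma l2_inner_integrable:
  assumes "l2 M f" "l2 M g"
  shows "integrable M (\<lambda>x. f x \<bullet> g x)"
proof (rule Bochner_Integration.integrable_bound)
  show "integrable M (\<lambda>x. (norm (f x))\<^sup>2 + (norm (g x))\<^sup>2)"
    using assms by (auto simp: l2_def)
  have "\<bar>f x \<bullet> g x\<bar> \<le> (norm (f x))\<^sup>2 + (norm (g x))\<^sup>2" for x
  proof -
    have "\<bar>f x \<bullet> g x\<bar> \<le> norm (f x) * norm (g x)"
      by (rule Cauchy_Schwarz_ineq2)
    also have "\<dots> \<le> (norm (f x))\<^sup>2 + (norm (g x))\<^sup>2"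
      using sum_squares_bound[of "norm (f x)" "norm (g x)"]
        mult_nonneg_nonneg[OF norm_ge_zero[of "f x"] norm_ge_zero[of "g x"]] by linarith
    finally show ?thesis .
  qed
  then show "AE x in M. norm (f x \<bullet> g x) \<le> norm ((norm (f x))\<^sup>2 + (norm (g x))\<^sup>2)"
    by auto
qed (use assms in \<open>auto simp: l2_def\<close>)

lemma l2_scaleR: "l2 M f \<Longrightarrow> l2 M (\<lambda>x. c *\<^sub>R f x)"
  by (auto simp: l2_def power_mult_distrib)

lemma l2_norm: "l2 M f \<Longrightarrow> l2 M (\<lambda>x. norm (f x))"
  by (auto simp: l2_def)

lemma l2_uminus: "l2 M f \<Longrightarrow> l2 M (\<lambda>x. - f x)"
  by (auto simp: l2_def)

lemma norm_add_sq: "(norm (a + b))\<^sup>2 = (norm a)\<^sup>2 + 2 * (a \<bullet> b) + (norm (b::'a::real_inner))\<^sup>2"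
  by (simp add: power2_norm_eq_inner inner_add inner_commute)

lemma l2_add:
  assumes "l2 M f" "l2 M g"
  shows "l2 M (\<lambda>x. f x + g x)"
  using l2_inner_integrable[OF assms] assms by (auto simp: l2_def norm_add_sq)

lemma l2_diff:
  assumes "l2 M f" "l2 M g"
  shows "l2 M (\<lambda>x. f x - g x)"
  using l2_add[OF assms(1) l2_uminus[OF assms(2)]] by simp

text \<open>Discriminant argument: the integral of |f + t g|^2 is a nonnegative quadratic polynomial
  in \<open>t\<close>.\<close>

lemma l2_cauchy_schwarz:
  assumes "l2 M f" "l2 M g"
  shows "\<bar>\<integral>x. f x \<bullet> g x \<partial>M\<bar> \<le> n2 M f * n2 M g"
proof -
  define a b c where "a = (n2 M f)\<^sup>2" and "b = (\<integral>x. f x \<bullet> g x \<partial>M)" and "c = (n2 M g)\<^sup>2"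
  have I: "integrable M (\<lambda>x. f x \<bullet> g x)" "integrable M (\<lambda>x. (norm (f x))\<^sup>2)"
      "integrable M (\<lambda>x. (norm (g x))\<^sup>2)"
    using l2_inner_integrable[OF assms] assms by (auto simp: l2_def)
  have q: "0 \<le> a + 2 * t * b + t\<^sup>2 * c" for t
  proof -
    have "0 \<le> (\<integral>x. (norm (f x + t *\<^sub>R g x))\<^sup>2 \<partial>M)" by simp
    also have "\<dots> = (\<integral>x. (norm (f x))\<^sup>2 + 2 * t * (f x \<bullet> g x) + t\<^sup>2 * (norm (g x))\<^sup>2 \<partial>M)"
      by (simp add: norm_add_sq power_mult_distrib mult.assoc)
    also have "\<dots> = a + 2 * t * b + t\<^sup>2 * c"
      using I by (simp add: a_def b_def c_def n2_sq)
    finally show ?thesis .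
  qed
  have c0: "0 \<le> c" by (simp add: c_def)
  have "b\<^sup>2 \<le> a * c"
  proof (cases "c = 0")
    case True
    have "b = 0"
    proof (rule ccontr)
      assume "b \<noteq> 0"
      \<comment> \<open>With \<open>c = 0\<close> the polynomial is affine in \<open>t\<close>, and
        this \<open>t\<close> gives it the value -1.\<close>
      then show False
        using q[of "- (a + 1) / (2 * b)"] True by (simp add: field_simps)
    qed
    then show ?thesis using True by simp
  next
    case False
    then have "0 < c" using c0 by simp
    \<comment> \<open>The quadratic polynomial attains its minimum at t = - b / c.\<close>
    have "0 \<le> a + 2 * (- b / c) * b + (- b / c)\<^sup>2 * c" by (rule q)
    also have "\<dots> = a - b\<^sup>2 / c"
      using \<open>0 < c\<close> by (simp add: field_simps power2_eq_square)
    finally show ?thesis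
      using \<open>0 < c\<close> by (simp add: field_simps)
  qed
  also have "\<dots> = (n2 M f * n2 M g)\<^sup>2"
    by (simp add: a_def c_def power_mult_distrib)
  finally have "\<bar>b\<bar> \<le> \<bar>n2 M f * n2 M g\<bar>"
    by (simp only: abs_le_square_iff)
  then show ?thesis
    by (simp add: b_def)
qed

lemma l2_cauchy_schwarz_norm:
  assumes "l2 M f" "l2 M g"
  shows "(\<integral>x. norm (f x) * norm (g x) \<partial>M) \<le> n2 M f * n2 M g"
  using l2_cauchy_schwarz[OF l2_norm[OF assms(1)] l2_norm[OF assms(2)]]
  by (auto simp: n2_def)

lemma l2_norm_mult_integrable:
  assumes "l2 M f" "l2 M g"
  shows "integrable M (\<lambda>x. norm (f x) * norm (g x))"
  using l2_inner_integrable[OF l2_norm[OF assms(1)] l2_norm[OF assms(2)]] by simp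

lemma n2_triangle:
  assumes "l2 M f" "l2 M g"
  shows "n2 M (\<lambda>x. f x + g x) \<le> n2 M f + n2 M g"
proof -
  have "(n2 M (\<lambda>x. f x + g x))\<^sup>2 = (n2 M f)\<^sup>2 + 2 * (\<integral>x. f x \<bullet> g x \<partial>M) + (n2 M g)\<^sup>2"
    using l2_inner_integrable[OF assms] assms by (simp add: n2_sq norm_add_sq l2_def)
  also have "\<dots> \<le> (n2 M f + n2 M g)\<^sup>2"
    using l2_cauchy_schwarz[OF assms] by (simp add: power2_sum)
  finally show ?thesis
    by (rule power2_le_imp_le) simp
qed

lemma n2_scaleR: "n2 M (\<lambda>x. c *\<^sub>R f x) = \<bar>c\<bar> * n2 M f"
  by (simp add: n2_def power_mult_distrib real_sqrt_mult)

lemma n2_uminus [simp]: "n2 M (\<lambda>x. - f x) = n2 M f"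
  by (simp add: n2_def)

lemma n2_minus_commute: "n2 M (\<lambda>x. f x - g x) = n2 M (\<lambda>x. g x - f x)"
  by (simp add: n2_def norm_minus_commute)

lemma n2_triangle_sub:
  assumes "l2 M f" "l2 M g" "l2 M h"
  shows "n2 M (\<lambda>x. f x - h x) \<le> n2 M (\<lambda>x. f x - g x) + n2 M (\<lambda>x. g x - h x)"
  using n2_triangle[OF l2_diff[OF assms(1,2)] l2_diff[OF assms(2,3)]] by simp

lemma n2_le_add:
  assumes "l2 M f" "l2 M g"
  shows "n2 M f \<le> n2 M g + n2 M (\<lambda>x. f x - g x)"
  using n2_triangle[OF assms(2) l2_diff[OF assms]] by simp

lemma n2_tendsto:
  assumes "\<forall>k. l2 M (f k)" "l2 M F" "(\<lambda>k. n2 M (\<lambda>x. f k x - F x)) \<longlonglongrightarrow> 0"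
  shows "(\<lambda>k. n2 M (f k)) \<longlonglongrightarrow> n2 M F"
proof -
  have "\<bar>n2 M (f k) - n2 M F\<bar> \<le> n2 M (\<lambda>x. f k x - F x)" for k
    using n2_le_add[of M "f k" F] n2_le_add[of M F "f k"] n2_minus_commute[of M F "f k"] assms(1,2)
    by (auto simp: abs_le_iff)
  then have "(\<lambda>k. n2 M (f k) - n2 M F) \<longlonglongrightarrow> 0"
    by (intro Lim_null_comparison[OF _ assms(3)]) auto
  then show ?thesis by (rule LIM_zero_cancel)
qed

lemma n2_eq_0_AE:
  assumes "l2 M f" "n2 M f = 0"
  shows "AE x in M. f x = 0"
proof -
  have "(\<integral>x. (norm (f x))\<^sup>2 \<partial>M) = 0"
    using assms(2) n2_sq[of M f] by simp
  then have "AE x in M. (norm (f x))\<^sup>2 = 0"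
    using integral_nonneg_eq_0_iff_AE[OF l2_integrable_sq[OF assms(1)]] by auto
  then show ?thesis by simp
qed

section \<open>Convergence, almost everywhere subsequences and completeness in L^2\<close>

lemma l2_inner_tendsto:
  assumes f: "\<forall>k. l2 M (f k)" "l2 M F" "(\<lambda>k. n2 M (\<lambda>x. f k x - F x)) \<longlonglongrightarrow> 0"
    and g: "\<forall>k. l2 M (g k)" "l2 M G" "(\<lambda>k. n2 M (\<lambda>x. g k x - G x)) \<longlonglongrightarrow> 0"
  shows "(\<lambda>k. \<integral>x. f k x \<bullet> g k x \<partial>M) \<longlonglongrightarrow> (\<integral>x. F x \<bullet> G x \<partial>M)"
proof -
  have bd: "norm ((\<integral>x. f k x \<bullet> g k x \<partial>M) - (\<integral>x. F x \<bullet> G x \<partial>M))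
      \<le> n2 M (\<lambda>x. f k x - F x) * n2 M (g k) + n2 M F * n2 M (\<lambda>x. g k x - G x)" for k
  proof -
    have d: "l2 M (\<lambda>x. f k x - F x)" "l2 M (\<lambda>x. g k x - G x)"
      using f g by (auto intro!: l2_diff)
    have "(\<integral>x. f k x \<bullet> g k x \<partial>M) - (\<integral>x. F x \<bullet> G x \<partial>M)
        = (\<integral>x. (f k x - F x) \<bullet> g k x \<partial>M) + (\<integral>x. F x \<bullet> (g k x - G x) \<partial>M)"
      using f g by (simp add: inner_diff l2_inner_integrable)
    then show ?thesis
      using l2_cauchy_schwarz[OF d(1), of "g k"] l2_cauchy_schwarz[OF f(2) d(2)] g(1) by simp
  qed
  have "(\<lambda>k. n2 M (\<lambda>x. f k x - F x) * n2 M (g k) + n2 M F * n2 M (\<lambda>x. g k x - G x))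
      \<longlonglongrightarrow> 0 * n2 M G + n2 M F * 0"
    by (intro tendsto_intros f g n2_tendsto)
  then have l: "(\<lambda>k. n2 M (\<lambda>x. f k x - F x) * n2 M (g k) + n2 M F * n2 M (\<lambda>x. g k x - G x))
      \<longlonglongrightarrow> 0" by simp
  have "(\<lambda>k. (\<integral>x. f k x \<bullet> g k x \<partial>M) - (\<integral>x. F x \<bullet> G x \<partial>M)) \<longlonglongrightarrow> 0"
    by (rule Lim_null_comparison[OF always_eventually[OF allI[OF bd]] l])
  then show ?thesis by (rule LIM_zero_cancel)
qed

text \<open>Convergence in L^2 is L^1 convergence of the squared distances to 0, and an L^1
  convergent sequence has a subsequence converging a.e.\<close>

lemma l2_AE_subseq:
  assumes "\<forall>k. l2 M (f k)" "l2 M F" "(\<lambda>k. n2 M (\<lambda>x. f k x - F x)) \<longlonglongrightarrow> 0"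
  obtains r :: "nat \<Rightarrow> nat" where "strict_mono r" "AE x in M. (\<lambda>k. f (r k) x) \<longlonglongrightarrow> F x"
proof -
  have "(\<lambda>k. (n2 M (\<lambda>x. f k x - F x))\<^sup>2) \<longlonglongrightarrow> 0\<^sup>2"
    by (intro tendsto_intros assms)
  then have t: "(\<lambda>k. \<integral>x. norm ((norm (f k x - F x))\<^sup>2) \<partial>M) \<longlonglongrightarrow> 0"
    by (simp add: n2_sq)
  obtain r :: "nat \<Rightarrow> nat" where r: "strict_mono r"
      "AE x in M. (\<lambda>k. (norm (f (r k) x - F x))\<^sup>2) \<longlonglongrightarrow> 0"
    using tendsto_L1_AE_subseq[OF _ t] l2_diff[of M _ F] assms(1,2) by (auto simp: l2_def)
  have "AE x in M. (\<lambda>k. f (r k) x) \<longlonglongrightarrow> F x"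
    using r(2)
  proof eventually_elim
    case (elim x)
    have "(\<lambda>k. sqrt ((norm (f (r k) x - F x))\<^sup>2)) \<longlonglongrightarrow> sqrt 0"
      by (intro tendsto_intros elim)
    then show ?case
      by (simp add: tendsto_norm_zero_iff LIM_zero_iff)
  qed
  with r(1) show ?thesis by (rule that)
qed

text \<open>Integrability of the limit matters as much as the inequality: this is how the limit of a
  minimizing sequence is seen to lie in L^m. The bounds \<open>c k\<close> vary because energies and
  quadratic forms along such a sequence merely converge.\<close>

lemma fatou_integrable:
  fixes f :: "nat \<Rightarrow> 'a \<Rightarrow> real"
  assumes f: "\<forall>k. integrable M (f k)" "\<forall>k. AE x in M. 0 \<le> f k x"
    and lim: "AE x in M. (\<lambda>k. f k x) \<longlonglongrightarrow> F x" and F: "F \<in> borel_measurable M"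
    and C: "\<forall>k. (\<integral>x. f k x \<partial>M) \<le> c k" "c \<longlonglongrightarrow> C"
  shows "integrable M F" "(\<integral>x. F x \<partial>M) \<le> C"
proof -
  have fm[measurable]: "f k \<in> borel_measurable M" for k using f(1) by auto
  have F0: "AE x in M. 0 \<le> F x"
  proof -
    have "AE x in M. \<forall>k. 0 \<le> f k x" using f(2) by (simp add: AE_all_countable)
    with lim show ?thesis
      by eventually_elim (auto intro: LIMSEQ_le_const)
  qed
  have "(\<integral>\<^sup>+x. ennreal (F x) \<partial>M) = (\<integral>\<^sup>+x. liminf (\<lambda>k. ennreal (f k x)) \<partial>M)"
  proof (rule nn_integral_cong_AE)
    show "AE x in M. ennreal (F x) = liminf (\<lambda>k. ennreal (f k x))"
      using lim
    proof eventually_elim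
      case (elim x)
      then have "(\<lambda>k. ennreal (f k x)) \<longlonglongrightarrow> ennreal (F x)"
        by (rule tendsto_ennrealI)
      then show ?case
        by (simp add: lim_imp_Liminf)
    qed
  qed
  also have "\<dots> \<le> liminf (\<lambda>k. \<integral>\<^sup>+x. ennreal (f k x) \<partial>M)"
    by (rule nn_integral_liminf) measurable
  also have "\<dots> = liminf (\<lambda>k. ennreal (\<integral>x. f k x \<partial>M))"
    using f by (simp add: nn_integral_eq_integral)
  also have "\<dots> \<le> liminf (\<lambda>k. ennreal (c k))"
    by (intro Liminf_mono always_eventually allI ennreal_leI) (use C in auto)
  also have "\<dots> = ennreal C"
    by (intro lim_imp_Liminf tendsto_ennrealI C) simp
  finally have le: "(\<integral>\<^sup>+x. ennreal (F x) \<partial>M) \<le> ennreal C" .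
  show I: "integrable M F"
  proof (rule integrableI_nonneg[OF F F0])
    show "(\<integral>\<^sup>+x. ennreal (F x) \<partial>M) < \<infinity>"
      using le ennreal_less_top le_less_trans by (metis infinity_ennreal_def)
  qed
  have "0 \<le> C"
  proof (rule LIMSEQ_le_const[OF C(2)])
    have "0 \<le> c k" for k
    proof -
      have "0 \<le> (\<integral>x. f k x \<partial>M)" using f(2) by (intro integral_nonneg_AE) simp
      also have "\<dots> \<le> c k" using C(1) by simp
      finally show ?thesis .
    qed
    then show "\<exists>N. \<forall>n\<ge>N. 0 \<le> c n" by blast
  qed
  then show "(\<integral>x. F x \<partial>M) \<le> C"
    using le nn_integral_eq_integral[OF I F0] by simp
qed

text \<open>Riesz-Fischer. On a finite measure space, Cauchy-Schwarz against the constant 1 turns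
  geometric L^2 decay of the increments of a fast subsequence into summable L^1 norms, whence
  absolute convergence a.e.; Fatou's lemma returns the L^2 estimates.\<close>

lemma l2_complete:
  fixes f :: "nat \<Rightarrow> 'a \<Rightarrow> 'b::euclidean_space"
  assumes fin: "finite_measure M" and f: "\<forall>k. l2 M (f k)"
    and cau: "\<forall>e>0. \<exists>N. \<forall>k\<ge>N. \<forall>l\<ge>N. n2 M (\<lambda>x. f k x - f l x) < e"
  shows "\<exists>F. l2 M F \<and> (\<lambda>k. n2 M (\<lambda>x. f k x - F x)) \<longlonglongrightarrow> 0"
proof -
  interpret finite_measure M by (rule fin)
  have one: "l2 M (\<lambda>x. 1::real)" by (simp add: l2_def)
  define K where "K = n2 M (\<lambda>x. 1::real)"
  have "\<exists>r::nat \<Rightarrow> nat. strict_mono r \<and> (\<forall>j. \<forall>k\<ge>r j. \<forall>l\<ge>r j. n2 M (\<lambda>x. f k x - f l x) < (1/2)^j)"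
  proof -
    have "\<forall>j. \<exists>N. \<forall>k\<ge>N. \<forall>l\<ge>N. n2 M (\<lambda>x. f k x - f l x) < (1/2)^j"
    proof
      fix j :: nat
      show "\<exists>N. \<forall>k\<ge>N. \<forall>l\<ge>N. n2 M (\<lambda>x. f k x - f l x) < (1/2)^j"
        using cau[rule_format, of "(1/2)^j"] by simp
    qed
    then obtain N where N: "\<forall>j. \<forall>k\<ge>N j. \<forall>l\<ge>N j. n2 M (\<lambda>x. f k x - f l x) < (1/2)^j"
      using choice[of "\<lambda>j N. \<forall>k\<ge>N. \<forall>l\<ge>N. n2 M (\<lambda>x. f k x - f l x) < (1/2)^j"] by blast
    \<comment> \<open>Summing the \<open>Suc (N i)\<close> forces strict growth and keeps
      \<open>r j\<close> above \<open>N j\<close>.\<close>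
    define r where "r j = (\<Sum>i\<le>j. Suc (N i))" for j :: nat
    have "strict_mono r" by (rule strict_monoI_Suc) (simp add: r_def)
    moreover have "N j \<le> r j" for j
      using member_le_sum[of j "{..j}" "\<lambda>i. Suc (N i)"] by (simp add: r_def)
    ultimately show ?thesis using N by (meson order_trans)
  qed
  then obtain r :: "nat \<Rightarrow> nat" where r: "strict_mono r"
      and rc: "\<forall>j. \<forall>k\<ge>r j. \<forall>l\<ge>r j. n2 M (\<lambda>x. f k x - f l x) < (1/2)^j" by blast
  define d where "d j x = f (r (Suc j)) x - f (r j) x" for j x
  have d2: "l2 M (d j)" for j unfolding d_def using f by (intro l2_diff) auto
  have dm[measurable]: "d j \<in> borel_measurable M" for j using l2_measurable[OF d2] .
  have dn: "n2 M (d j) < (1/2)^j" for j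
    unfolding d_def using rc r by (simp add: strict_mono_less_eq)
  have di: "integrable M (\<lambda>x. norm (d j x))" for j
    using l2_norm_mult_integrable[OF d2[of j] one] by simp
  have d1: "(\<integral>x. norm (d j x) \<partial>M) \<le> (1/2)^j * K" for j
  proof -
    have "(\<integral>x. norm (d j x) \<partial>M) \<le> n2 M (d j) * K"
      using l2_cauchy_schwarz_norm[OF d2[of j] one] by (simp add: K_def)
    also have "\<dots> \<le> (1/2)^j * K"
      using dn[of j] by (intro mult_right_mono) (auto simp: K_def)
    finally show ?thesis .
  qed
  have "AE x in M. summable (\<lambda>j. norm (d j x))"
  proof -
    have "(\<integral>\<^sup>+x. (\<Sum>j. ennreal (norm (d j x))) \<partial>M) = (\<Sum>j. \<integral>\<^sup>+x. ennreal (norm (d j x)) \<partial>M)"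
      by (rule nn_integral_suminf) measurable
    also have "\<dots> = (\<Sum>j. ennreal (\<integral>x. norm (d j x) \<partial>M))"
      using di by (simp add: nn_integral_eq_integral)
    also have "\<dots> \<le> (\<Sum>j. ennreal ((1/2)^j * K))"
      by (intro suminf_le ennreal_leI d1) auto
    also have "\<dots> = ennreal (\<Sum>j. (1/2)^j * K)"
      by (intro suminf_ennreal2) (auto simp: K_def intro!: summable_mult2)
    also have "\<dots> < \<infinity>" by simp
    finally have "(\<integral>\<^sup>+x. (\<Sum>j. ennreal (norm (d j x))) \<partial>M) < \<infinity>" .
    then have "AE x in M. (\<Sum>j. ennreal (norm (d j x))) \<noteq> \<infinity>"
      by (intro nn_integral_noteq_infinite) auto
    then show ?thesis
      by eventually_elim (auto intro: summable_suminf_not_top)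
  qed
  then have cv: "AE x in M. convergent (\<lambda>j. f (r j) x)"
  proof eventually_elim
    case (elim x)
    then have "summable (\<lambda>j. d j x)" by (rule summable_norm_cancel)
    then have "convergent (\<lambda>n. \<Sum>j<n. d j x)" by (simp add: summable_iff_convergent)
    moreover have "(\<Sum>j<n. d j x) = f (r n) x - f (r 0) x" for n
      unfolding d_def by (rule sum_lessThan_telescope)
    ultimately have "convergent (\<lambda>n. f (r n) x - f (r 0) x)" by simp
    then have "convergent (\<lambda>n. (f (r n) x - f (r 0) x) + f (r 0) x)"
      by (intro convergent_add convergent_const)
    then show ?case by simp
  qed
  \<comment> \<open>Where the subsequence diverges, \<open>lim\<close> is an arbitrary value; this
    happens only on a null set.\<close>
  define F where "F x = lim (\<lambda>j. f (r j) x)" for x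
  have Fm: "F \<in> borel_measurable M"
    unfolding F_def by (rule borel_measurable_lim_metric) (use f in \<open>auto simp: l2_def\<close>)
  note Fm[measurable]
  have fm[measurable]: "f k \<in> borel_measurable M" for k using f l2_measurable by blast
  have Fl: "AE x in M. (\<lambda>j. f (r j) x) \<longlonglongrightarrow> F x"
    using cv by eventually_elim (simp add: F_def convergent_LIMSEQ_iff)
  have est: "l2 M (\<lambda>x. f k x - F x) \<and> n2 M (\<lambda>x. f k x - F x) \<le> (1/2)^j" if "k \<ge> r j" for j k
  proof -
    \<comment> \<open>The index \<open>k\<close> stays fixed while the second one runs to infinity
      through \<open>r (i + j)\<close>, always beyond \<open>r j\<close>, so the bound (1/2)^j
      survives in the limit.\<close>
    define h where "h i x = (norm (f k x - f (r (i + j)) x))\<^sup>2" for i x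
    have hi: "\<forall>i. integrable M (h i)"
      unfolding h_def using f l2_diff l2_integrable_sq by blast
    have "\<forall>i. (\<integral>x. h i x \<partial>M) \<le> ((1/2)^j)\<^sup>2"
    proof
      fix i
      have "n2 M (\<lambda>x. f k x - f (r (i + j)) x) < (1/2)^j"
        using rc that r by (simp add: strict_mono_less_eq)
      then have "(n2 M (\<lambda>x. f k x - f (r (i + j)) x))\<^sup>2 \<le> ((1/2)^j)\<^sup>2"
        by (intro power_mono) auto
      then show "(\<integral>x. h i x \<partial>M) \<le> ((1/2)^j)\<^sup>2" by (simp add: n2_sq h_def)
    qed
    note hb = this
    have hl: "AE x in M. (\<lambda>i. h i x) \<longlonglongrightarrow> (norm (f k x - F x))\<^sup>2"
      using Fl
    proof eventually_elim
      case (elim x)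
      then have "(\<lambda>i. f (r (i + j)) x) \<longlonglongrightarrow> F x" by (rule LIMSEQ_ignore_initial_segment)
      then show ?case unfolding h_def by (intro tendsto_intros)
    qed
    have m: "(\<lambda>x. f k x - F x) \<in> borel_measurable M"
      by measurable
    have "integrable M (\<lambda>x. (norm (f k x - F x))\<^sup>2)" "(\<integral>x. (norm (f k x - F x))\<^sup>2 \<partial>M) \<le> ((1/2)^j)\<^sup>2"
      using fatou_integrable[OF hi _ hl _ hb tendsto_const] m by (auto simp: h_def)
    then show ?thesis
      using m by (auto simp: l2_def n2_def intro!: real_le_lsqrt)
  qed
  have "l2 M F"
  proof -
    have "l2 M (\<lambda>x. f (r 0) x - (f (r 0) x - F x))"
      using est[of 0 "r 0"] f by (intro l2_diff[of M "f (r 0)" "\<lambda>x. f (r 0) x - F x"]) auto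
    then show ?thesis by simp
  qed
  moreover have "(\<lambda>k. n2 M (\<lambda>x. f k x - F x)) \<longlonglongrightarrow> 0"
  proof (rule LIMSEQ_I)
    fix e :: real assume "0 < e"
    then obtain j where "(1/2)^j < e"
      using real_arch_pow_inv[of e "1/2"] by auto
    then show "\<exists>no. \<forall>n\<ge>no. norm (n2 M (\<lambda>x. f n x - F x) - 0) < e"
      using est[of j] by (auto intro!: exI[of _ "r j"] intro: le_less_trans)
  qed
  ultimately show ?thesis by blast
qed

section \<open>Continuously differentiable functions with compact support\<close>

lemma Cc1_grad_derivative: "Cc1_grad \<Omega> \<phi> g \<Longrightarrow> (\<phi> has_derivative (\<lambda>h. g x \<bullet> h)) (at x)"
  and Cc1_grad_continuous_grad: "Cc1_grad \<Omega> \<phi> g \<Longrightarrow> continuous_on UNIV g"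
  by (auto simp: Cc1_grad_def)

lemma Cc1_grad_continuous:
  assumes "Cc1_grad \<Omega> \<phi> g" shows "continuous_on UNIV \<phi>"
  using Cc1_grad_derivative[OF assms]
  by (auto intro!: continuous_at_imp_continuous_on has_derivative_continuous)

lemma Cc1_grad_measurable:
  assumes "Cc1_grad \<Omega> \<phi> g"
  shows "\<phi> \<in> borel_measurable borel" "g \<in> borel_measurable borel"
  using Cc1_grad_continuous[OF assms] Cc1_grad_continuous_grad[OF assms]
  by (auto intro: borel_measurable_continuous_onI)

text \<open>Off its closed support \<phi> vanishes on a neighbourhood, so its derivative there is
  that of the zero function.\<close>

lemma Cc1_grad_zero_off_support:
  assumes "Cc1_grad \<Omega> \<phi> g" "x \<notin> closure {x. \<phi> x \<noteq> 0}"
  shows "\<phi> x = 0" "g x = 0"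
proof -
  define U where "U = - closure {x. \<phi> x \<noteq> 0}"
  have z: "\<phi> y = 0" if "y \<in> U" for y
    using that closure_subset[of "{x. \<phi> x \<noteq> 0}"] by (auto simp: U_def)
  have U: "open U" "x \<in> U" using assms(2) by (auto simp: U_def)
  show "\<phi> x = 0" using z U(2) .
  have "((\<lambda>y. 0) has_derivative (\<lambda>h. g x \<bullet> h)) (at x)"
    by (rule has_derivative_transform_within_open[OF Cc1_grad_derivative[OF assms(1)] U])
      (rule z)
  then have "(\<lambda>h. g x \<bullet> h) = (\<lambda>h. 0)"
    by (rule has_derivative_unique) (rule has_derivative_const)
  then have "g x \<bullet> g x = 0" by metis
  then show "g x = 0" by simp
qed

lemma Cc1_grad_zero_outside:
  assumes "Cc1_grad \<Omega> \<phi> g" "x \<notin> \<Omega>"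
  shows "\<phi> x = 0" "g x = 0"
  by (rule Cc1_grad_zero_off_support[OF assms(1)], use assms in \<open>auto simp: Cc1_grad_def\<close>)+

lemma Cc1_gradI:
  assumes K: "compact K" "K \<subseteq> \<Omega>" "\<forall>x. x \<notin> K \<longrightarrow> \<phi> x = 0"
    and "\<forall>x. (\<phi> has_derivative (\<lambda>h. g x \<bullet> h)) (at x)" "continuous_on UNIV g"
  shows "Cc1_grad \<Omega> \<phi> g"
proof -
  have s: "closure {x. \<phi> x \<noteq> 0} \<subseteq> K"
    using K by (intro closure_minimal) (auto simp: compact_imp_closed)
  moreover have "compact (closure {x. \<phi> x \<noteq> 0})"
    using compact_Int_closed[OF K(1), of "closure {x. \<phi> x \<noteq> 0}"] s
    by (simp add: Int_absorb1)
  ultimately show ?thesis using assms by (auto simp: Cc1_grad_def)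
qed

lemma Cc1_gradE:
  assumes "Cc1_grad \<Omega> \<phi> g"
  obtains K where "compact K" "K \<subseteq> \<Omega>" "\<forall>x. x \<notin> K \<longrightarrow> \<phi> x = 0" "\<forall>x. x \<notin> K \<longrightarrow> g x = 0"
proof (rule that[of "closure {x. \<phi> x \<noteq> 0}"])
  show "\<forall>x. x \<notin> closure {x. \<phi> x \<noteq> 0} \<longrightarrow> \<phi> x = 0"
    by (intro allI impI Cc1_grad_zero_off_support(1)[OF assms])
  show "\<forall>x. x \<notin> closure {x. \<phi> x \<noteq> 0} \<longrightarrow> g x = 0"
    by (intro allI impI Cc1_grad_zero_off_support(2)[OF assms])
qed (use assms in \<open>simp_all add: Cc1_grad_def\<close>)

text \<open>The factor \<open>P\<close> stands for coordinates and polynomials, which lack compact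
  support; the product inherits it from \<phi>.\<close>

lemma Cc1_grad_times:
  assumes \<phi>: "Cc1_grad \<Omega> \<phi> g"
    and P: "\<forall>x. (P has_derivative (\<lambda>h. Q x \<bullet> h)) (at x)" "continuous_on UNIV Q"
  shows "Cc1_grad \<Omega> (\<lambda>x. \<phi> x * P x) (\<lambda>x. P x *\<^sub>R g x + \<phi> x *\<^sub>R Q x)"
proof -
  obtain K where K: "compact K" "K \<subseteq> \<Omega>" "\<forall>x. x \<notin> K \<longrightarrow> \<phi> x = 0"
    using \<phi> by (rule Cc1_gradE)
  have cP: "continuous_on UNIV P"
    using P(1) by (auto intro!: continuous_at_imp_continuous_on has_derivative_continuous)
  show ?thesis
  proof (rule Cc1_gradI[OF K(1,2)])
    show "\<forall>x. ((\<lambda>x. \<phi> x * P x) has_derivative (\<lambda>h. (P x *\<^sub>R g x + \<phi> x *\<^sub>R Q x) \<bullet> h)) (at x)"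
    proof
      fix x
      show "((\<lambda>x. \<phi> x * P x) has_derivative (\<lambda>h. (P x *\<^sub>R g x + \<phi> x *\<^sub>R Q x) \<bullet> h)) (at x)"
        by (rule has_derivative_eq_rhs[OF has_derivative_mult[OF Cc1_grad_derivative[OF \<phi>] P(1)[rule_format]]])
          (auto simp: inner_simps algebra_simps)
    qed
    show "continuous_on UNIV (\<lambda>x. P x *\<^sub>R g x + \<phi> x *\<^sub>R Q x)"
      by (intro continuous_intros cP P(2) Cc1_grad_continuous[OF \<phi>] Cc1_grad_continuous_grad[OF \<phi>])
  qed (use K in auto)
qed

lemma Cc1_grad_compose:
  assumes \<phi>: "Cc1_grad \<Omega> \<phi> g"
    and f: "\<forall>s. (f has_real_derivative f' s) (at s)" "continuous_on UNIV f'" "f 0 = 0"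
  shows "Cc1_grad \<Omega> (\<lambda>x. f (\<phi> x)) (\<lambda>x. f' (\<phi> x) *\<^sub>R g x)"
proof -
  obtain K where K: "compact K" "K \<subseteq> \<Omega>" "\<forall>x. x \<notin> K \<longrightarrow> \<phi> x = 0"
    using \<phi> by (rule Cc1_gradE)
  show ?thesis
  proof (rule Cc1_gradI[OF K(1,2)])
    show "\<forall>x. ((\<lambda>x. f (\<phi> x)) has_derivative (\<lambda>h. (f' (\<phi> x) *\<^sub>R g x) \<bullet> h)) (at x)"
    proof
      fix x
      have "(f has_derivative (\<lambda>h. h * f' (\<phi> x))) (at (\<phi> x))"
        using f(1) by (auto simp: has_field_derivative_def mult.commute[of _ "f' _"])
      from has_derivative_compose[OF Cc1_grad_derivative[OF \<phi>] this]
      show "((\<lambda>x. f (\<phi> x)) has_derivative (\<lambda>h. (f' (\<phi> x) *\<^sub>R g x) \<bullet> h)) (at x)"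
        by (rule has_derivative_eq_rhs) (auto simp: inner_simps)
    qed
    show "continuous_on UNIV (\<lambda>x. f' (\<phi> x) *\<^sub>R g x)"
      by (intro continuous_intros continuous_on_compose2[OF f(2)] Cc1_grad_continuous[OF \<phi>]
          Cc1_grad_continuous_grad[OF \<phi>]) auto
  qed (use K f in auto)
qed

lemma Cc1_grad_lincomb:
  assumes "Cc1_grad \<Omega> \<phi> g" "Cc1_grad \<Omega> \<psi> h"
  shows "Cc1_grad \<Omega> (\<lambda>x. a * \<phi> x + b * \<psi> x) (\<lambda>x. a *\<^sub>R g x + b *\<^sub>R h x)"
proof -
  obtain K where K: "compact K" "K \<subseteq> \<Omega>" "\<forall>x. x \<notin> K \<longrightarrow> \<phi> x = 0"
    using assms(1) by (rule Cc1_gradE)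
  obtain L where L: "compact L" "L \<subseteq> \<Omega>" "\<forall>x. x \<notin> L \<longrightarrow> \<psi> x = 0"
    using assms(2) by (rule Cc1_gradE)
  show ?thesis
  proof (rule Cc1_gradI[of "K \<union> L"])
    show "\<forall>x. ((\<lambda>x. a * \<phi> x + b * \<psi> x) has_derivative (\<lambda>w. (a *\<^sub>R g x + b *\<^sub>R h x) \<bullet> w)) (at x)"
    proof
      fix x
      show "((\<lambda>x. a * \<phi> x + b * \<psi> x) has_derivative (\<lambda>w. (a *\<^sub>R g x + b *\<^sub>R h x) \<bullet> w)) (at x)"
        by (rule has_derivative_eq_rhs[OF has_derivative_add[OF has_derivative_mult_right[OF Cc1_grad_derivative[OF assms(1)]]
           has_derivative_mult_right[OF Cc1_grad_derivative[OF assms(2)]]]])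
          (auto simp: inner_simps algebra_simps)
    qed
    show "continuous_on UNIV (\<lambda>x. a *\<^sub>R g x + b *\<^sub>R h x)"
      by (intro continuous_intros Cc1_grad_continuous_grad[OF assms(1)] Cc1_grad_continuous_grad[OF assms(2)])
  qed (use K L in auto)
qed

lemma continuous_compact_support_integrable:
  fixes f :: "'a::euclidean_space \<Rightarrow> 'b::euclidean_space"
  assumes "continuous_on UNIV f" "compact K" "\<forall>x. x \<notin> K \<longrightarrow> f x = 0"
  shows "integrable lborel f"
proof -
  have "integrable lborel (\<lambda>x. indicator K x *\<^sub>R f x)"
    using borel_integrable_compact[OF assms(2) continuous_on_subset[OF assms(1)]] by simp
  moreover have "(\<lambda>x. indicator K x *\<^sub>R f x) = f"
    using assms(3) by (auto simp: indicator_def)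
  ultimately show ?thesis by simp
qed

lemma Cc1_grad_l2:
  assumes "Cc1_grad \<Omega> \<phi> g"
  shows "l2 lborel \<phi>" "l2 lborel g"
proof -
  obtain K where K: "compact K" "\<forall>x. x \<notin> K \<longrightarrow> \<phi> x = 0" "\<forall>x. x \<notin> K \<longrightarrow> g x = 0"
    using assms by (rule Cc1_gradE)
  show "l2 lborel \<phi>" "l2 lborel g"
    unfolding l2_def using Cc1_grad_measurable[OF assms] K
    by (auto intro!: continuous_compact_support_integrable[of _ K] continuous_intros
        Cc1_grad_continuous[OF assms] Cc1_grad_continuous_grad[OF assms])
qed

lemma Cc1_grad_bounded:
  assumes "Cc1_grad \<Omega> \<phi> g"
  obtains B R where "0 < B" "0 < R" "\<forall>x. \<bar>\<phi> x\<bar> \<le> B" "\<forall>x. norm (g x) \<le> B"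
    "\<forall>x. R < norm x \<longrightarrow> \<phi> x = 0" "\<forall>x. R < norm x \<longrightarrow> g x = 0"
proof -
  obtain K where K: "compact K" "\<forall>x. x \<notin> K \<longrightarrow> \<phi> x = 0" "\<forall>x. x \<notin> K \<longrightarrow> g x = 0"
    using assms by (rule Cc1_gradE)
  have "bounded (\<phi> ` K)" "bounded (g ` K)"
    using K(1) Cc1_grad_continuous[OF assms] Cc1_grad_continuous_grad[OF assms]
    by (auto intro!: compact_imp_bounded compact_continuous_image intro: continuous_on_subset)
  then obtain B1 B2 where B: "0 < B1" "\<forall>x\<in>K. \<bar>\<phi> x\<bar> \<le> B1" "0 < B2" "\<forall>x\<in>K. norm (g x) \<le> B2"
    by (force simp: bounded_pos)
  obtain R where R: "0 < R" "\<forall>x\<in>K. norm x \<le> R"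
    using compact_imp_bounded[OF K(1)] by (auto simp: bounded_pos)
  show ?thesis
  proof (rule that[of "B1 + B2" R])
    show "\<forall>x. \<bar>\<phi> x\<bar> \<le> B1 + B2" "\<forall>x. norm (g x) \<le> B1 + B2"
    proof (safe)
      fix x
      show "\<bar>\<phi> x\<bar> \<le> B1 + B2" using B K by (cases "x \<in> K") force+
      show "norm (g x) \<le> B1 + B2" using B K by (cases "x \<in> K") force+
    qed
    show "\<forall>x. R < norm x \<longrightarrow> \<phi> x = 0" "\<forall>x. R < norm x \<longrightarrow> g x = 0"
      using R K by (meson not_le)+
  qed (use B R in auto)
qed

section \<open>Translations, difference quotients and partial integration\<close>

lemma integral_translate:
  fixes f :: "'a::euclidean_space \<Rightarrow> 'b::{banach, second_countable_topology}"
  assumes "f \<in> borel_measurable borel"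
  shows "(\<integral>x. f (x + c) \<partial>lborel) = (\<integral>x. f x \<partial>lborel)"
proof -
  have "(\<integral>x. f x \<partial>lborel) = (\<integral>x. f x \<partial>(distr lborel borel ((+) c)))"
    by (simp add: lborel_distr_plus)
  also have "\<dots> = (\<integral>x. f (c + x) \<partial>lborel)"
    by (rule integral_distr) (use assms in auto)
  finally show ?thesis by (simp add: add.commute)
qed

lemma integrable_translate:
  fixes f :: "'a::euclidean_space \<Rightarrow> 'b::{banach, second_countable_topology}"
  assumes "integrable lborel f"
  shows "integrable lborel (\<lambda>x. f (x + c))"
proof -
  have "integrable (distr lborel borel ((+) c)) f"
    using assms by (simp add: lborel_distr_plus)
  then have "integrable lborel (\<lambda>x. f (c + x))"
    using borel_measurable_integrable[OF assms] by (subst (asm) integrable_distr_eq) auto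
  then show ?thesis by (simp add: add.commute)
qed

text \<open>The two claims together feed dominated convergence: pointwise convergence to the
  directional derivative, and a bound from the mean value inequality carried by one fixed
  ball.\<close>

lemma Cc1_grad_diffquot:
  fixes \<phi> :: "('n::finite) pt \<Rightarrow> real"
  assumes \<phi>: "Cc1_grad \<Omega> \<phi> g"
  defines "d \<equiv> \<lambda>z k x. (\<phi> (x + (1 / real (Suc k)) *\<^sub>R z) - \<phi> x) * real (Suc k)"
  shows "(\<lambda>k. d z k x) \<longlonglongrightarrow> g x \<bullet> z"
    and "\<exists>C K. compact K \<and> (\<forall>k x. \<bar>d z k x\<bar> \<le> C * indicator K x)"
proof -
  show "(\<lambda>k. d z k x) \<longlonglongrightarrow> g x \<bullet> z"
  proof -
    have a: "((\<lambda>t::real. x + t *\<^sub>R z) has_derivative (\<lambda>t. t *\<^sub>R z)) (at 0)"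
      by (auto intro!: derivative_eq_intros)
    have b: "(\<phi> has_derivative (\<lambda>h. g x \<bullet> h)) (at (x + 0 *\<^sub>R z))"
      using Cc1_grad_derivative[OF \<phi>, of x] by simp
    have "((\<lambda>t. \<phi> (x + t *\<^sub>R z)) has_derivative (\<lambda>t. g x \<bullet> (t *\<^sub>R z))) (at 0)"
      using has_derivative_compose[OF a b] .
    then have "((\<lambda>t. \<phi> (x + t *\<^sub>R z)) has_real_derivative (g x \<bullet> z)) (at 0)"
      by (simp add: has_field_derivative_def mult.commute mult_commute_abs)
    then have "((\<lambda>h. (\<phi> (x + (0 + h) *\<^sub>R z) - \<phi> (x + 0 *\<^sub>R z)) / h) \<longlongrightarrow> g x \<bullet> z) (at 0)"
      by (rule DERIV_D)
    moreover have "filterlim (\<lambda>k. 1 / real (Suc k)) (at 0) sequentially"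
      by (intro filterlim_atI lim_1_over_n[THEN LIMSEQ_Suc]) auto
    ultimately have "(\<lambda>k. (\<phi> (x + (0 + 1 / real (Suc k)) *\<^sub>R z) - \<phi> (x + 0 *\<^sub>R z)) / (1 / real (Suc k)))
        \<longlonglongrightarrow> g x \<bullet> z"
      by (rule filterlim_compose)
    then show ?thesis by (simp add: d_def)
  qed
  obtain B R where B: "0 < B" "0 < R" "\<forall>x. norm (g x) \<le> B" "\<forall>x. R < norm x \<longrightarrow> \<phi> x = 0"
    using \<phi> by (rule Cc1_grad_bounded)
  \<comment> \<open>The step z / (k + 1) is no longer than \<open>z\<close>, so outside the ball of
    radius \<open>R + norm z\<close> both \<open>x\<close> and its translate lie off the
    support.\<close>
  have "\<bar>d z k x\<bar> \<le> (B * norm z) * indicator (cball 0 (R + norm z)) x" for k x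
  proof (cases "norm x \<le> R + norm z")
    case True
    have "norm (\<phi> (x + (1 / real (Suc k)) *\<^sub>R z) - \<phi> x) \<le> B * norm ((x + (1 / real (Suc k)) *\<^sub>R z) - x)"
    proof (rule differentiable_bound[of UNIV \<phi> "\<lambda>x h. g x \<bullet> h"])
      show "onorm ((\<bullet>) (g y)) \<le> B" for y
        using B(1,3) by (intro onorm_bound)
          (auto intro!: order_trans[OF Cauchy_Schwarz_ineq2] mult_right_mono)
    qed (use Cc1_grad_derivative[OF \<phi>] in \<open>auto\<close>)
    then have "\<bar>\<phi> (x + (1 / real (Suc k)) *\<^sub>R z) - \<phi> x\<bar> * real (Suc k) \<le> B * (norm z / real (Suc k)) * real (Suc k)"
      by (intro mult_right_mono) auto
    then show ?thesis using True by (simp add: d_def abs_mult)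
  next
    case False
    have "norm x \<le> norm (x + (1 / real (Suc k)) *\<^sub>R z) + norm ((1 / real (Suc k)) *\<^sub>R z)"
      using norm_triangle_ineq4[of "x + (1 / real (Suc k)) *\<^sub>R z" "(1 / real (Suc k)) *\<^sub>R z"] by simp
    also have "norm ((1 / real (Suc k)) *\<^sub>R z) \<le> norm z"
      by (simp add: divide_le_eq mult_le_cancel_left1)
    finally have "R < norm (x + (1 / real (Suc k)) *\<^sub>R z)" using False by simp
    moreover have "R < norm x" using False norm_ge_zero[of z] by linarith
    ultimately show ?thesis using B(1,4) by (simp add: d_def)
  qed
  then show "\<exists>C K. compact K \<and> (\<forall>k x. \<bar>d z k x\<bar> \<le> C * indicator K x)"
    using compact_cball by blast
qed

text \<open>Difference quotients integrate to 0 by translation invariance, and the integral passes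
  to their limit.\<close>

lemma integral_grad_zero:
  fixes \<phi> :: "('n::finite) pt \<Rightarrow> real"
  assumes \<phi>: "Cc1_grad \<Omega> \<phi> g"
  shows "(\<integral>x. g x \<bullet> z \<partial>lborel) = 0"
proof -
  define d where "d k x = (\<phi> (x + (1 / real (Suc k)) *\<^sub>R z) - \<phi> x) * real (Suc k)" for k x
  obtain C K where K: "compact K" "\<forall>k x. \<bar>d k x\<bar> \<le> C * indicator K x"
    using Cc1_grad_diffquot(2)[OF \<phi>, of z] unfolding d_def by blast
  note [measurable] = Cc1_grad_measurable[OF \<phi>]
  obtain L where L: "compact L" "\<forall>x. x \<notin> L \<longrightarrow> \<phi> x = 0"
    using \<phi> by (rule Cc1_gradE)
  have i: "integrable lborel \<phi>"
    using continuous_compact_support_integrable[OF Cc1_grad_continuous[OF \<phi>] L] .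
  have "(\<lambda>k. \<integral>x. d k x \<partial>lborel) \<longlonglongrightarrow> (\<integral>x. g x \<bullet> z \<partial>lborel)"
  proof (rule integral_dominated_convergence[where w = "\<lambda>x. C * indicator K x"])
    show "integrable lborel (\<lambda>x. C * indicator K x :: real)"
      using K(1) emeasure_bounded_finite[OF compact_imp_bounded[OF K(1)]]
      by (intro integrable_mult_right integrable_real_indicator) (auto simp: compact_imp_closed)
    show "AE x in lborel. (\<lambda>k. d k x) \<longlonglongrightarrow> g x \<bullet> z"
      using Cc1_grad_diffquot(1)[OF \<phi>, of _ z] unfolding d_def by blast
  qed (use K in \<open>auto simp: d_def\<close>)
  moreover have "(\<integral>x. d k x \<partial>lborel) = 0" for k
    unfolding d_def using integrable_translate[OF i] i by (simp add: integral_translate)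
  ultimately have "(\<lambda>k. 0) \<longlonglongrightarrow> (\<integral>x. g x \<bullet> z \<partial>lborel)"
    by simp
  then show ?thesis
    by (simp add: LIMSEQ_const_iff)
qed

text \<open>The product of \<phi> and \<open>P\<close> has compact support, so its gradient
  integrates to 0 in every direction.\<close>

lemma integral_by_parts:
  fixes \<phi> :: "('n::finite) pt \<Rightarrow> real"
  assumes \<phi>: "Cc1_grad \<Omega> \<phi> g"
    and P: "\<forall>x. (P has_derivative (\<lambda>h. Q x \<bullet> h)) (at x)" "continuous_on UNIV Q"
  shows "(\<integral>x. P x * (g x \<bullet> z) \<partial>lborel) = - (\<integral>x. \<phi> x * (Q x \<bullet> z) \<partial>lborel)"
proof -
  have cP: "continuous_on UNIV P"
    using P(1) by (auto intro!: continuous_at_imp_continuous_on has_derivative_continuous)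
  obtain K where K: "compact K" "\<forall>x. x \<notin> K \<longrightarrow> \<phi> x = 0" "\<forall>x. x \<notin> K \<longrightarrow> g x = 0"
    using \<phi> by (rule Cc1_gradE)
  have "integrable lborel (\<lambda>x. P x * (g x \<bullet> z))" "integrable lborel (\<lambda>x. \<phi> x * (Q x \<bullet> z))"
    using K P(2)
    by (auto intro!: continuous_compact_support_integrable[of _ K] continuous_intros cP
        Cc1_grad_continuous[OF \<phi>] Cc1_grad_continuous_grad[OF \<phi>])
  then show ?thesis
    using integral_grad_zero[OF Cc1_grad_times[OF \<phi> P], of z] by (simp add: inner_simps)
qed

text \<open>The translation by \<open>z\<close> is split into \<open>k\<close> equal steps; as \<open>k \<rightarrow> \<infinity>\<close> the difference quotients converge
  in \<open>L\<^sup>2\<close> to the directional derivative.\<close>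

lemma Cc1_translation_estimate:
  fixes \<phi> :: "('n::finite) pt \<Rightarrow> real"
  assumes \<phi>: "Cc1_grad \<Omega> \<phi> g"
  shows "l2 lborel (\<lambda>x. \<phi> (x + z))" "n2 lborel (\<lambda>x. \<phi> (x + z) - \<phi> x) \<le> norm z * n2 lborel g"
proof -
  note [measurable] = Cc1_grad_measurable[OF \<phi>]
  show tr: "l2 lborel (\<lambda>x. \<phi> (x + z))" for z
    using integrable_translate[of "\<lambda>x. (norm (\<phi> x))\<^sup>2"] Cc1_grad_l2(1)[OF \<phi>] by (simp add: l2_def)
  define d where "d k x = (\<phi> (x + (1 / real (Suc k)) *\<^sub>R z) - \<phi> x) * real (Suc k)" for k x
  obtain C K where K: "compact K" "\<forall>k x. \<bar>d k x\<bar> \<le> C * indicator K x"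
    using Cc1_grad_diffquot(2)[OF \<phi>, of z] unfolding d_def by blast
  have [measurable]: "d k \<in> borel_measurable borel" for k unfolding d_def by measurable
  have "(\<lambda>k. \<integral>x. (norm (d k x))\<^sup>2 \<partial>lborel) \<longlonglongrightarrow> (\<integral>x. (norm (g x \<bullet> z))\<^sup>2 \<partial>lborel)"
  proof (rule integral_dominated_convergence[where w = "\<lambda>x. C\<^sup>2 * indicator K x"])
    show "integrable lborel (\<lambda>x. C\<^sup>2 * indicator K x :: real)"
      using K(1) emeasure_bounded_finite[OF compact_imp_bounded[OF K(1)]]
      by (intro integrable_mult_right integrable_real_indicator) (auto simp: compact_imp_closed)
    show "AE x in lborel. (\<lambda>k. (norm (d k x))\<^sup>2) \<longlonglongrightarrow> (norm (g x \<bullet> z))\<^sup>2"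
      using Cc1_grad_diffquot(1)[OF \<phi>, of _ z] unfolding d_def by (auto intro!: tendsto_intros)
    show "AE x in lborel. norm ((norm (d k x))\<^sup>2) \<le> C\<^sup>2 * indicator K x" for k
    proof (rule AE_I2)
      fix x
      have "\<bar>d k x\<bar>\<^sup>2 \<le> (C * indicator K x)\<^sup>2"
        using K(2) by (intro power_mono) auto
      also have "\<dots> = C\<^sup>2 * indicator K x"
        by (simp add: power_mult_distrib indicator_def)
      finally show "norm ((norm (d k x))\<^sup>2) \<le> C\<^sup>2 * indicator K x"
        by simp
    qed
  qed measurable
  then have lim: "(\<lambda>k. n2 lborel (d k)) \<longlonglongrightarrow> n2 lborel (\<lambda>x. g x \<bullet> z)"
    unfolding n2_def by (rule tendsto_real_sqrt)
  \<comment> \<open>Triangle inequality; by translation invariance every step contributes the same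
    norm.\<close>
  have steps: "n2 lborel (\<lambda>x. \<phi> (x + real j *\<^sub>R w) - \<phi> x) \<le> real j * n2 lborel (\<lambda>x. \<phi> (x + w) - \<phi> x)" for j w
  proof (induction j)
    case 0
    show ?case by (simp add: n2_def)
  next
    case (Suc j)
    have "n2 lborel (\<lambda>x. \<phi> (x + real (Suc j) *\<^sub>R w) - \<phi> x)
       \<le> n2 lborel (\<lambda>x. \<phi> (x + real (Suc j) *\<^sub>R w) - \<phi> (x + real j *\<^sub>R w)) + n2 lborel (\<lambda>x. \<phi> (x + real j *\<^sub>R w) - \<phi> x)"
      by (intro n2_triangle_sub tr) (use Cc1_grad_l2[OF \<phi>] in auto)
    also have "n2 lborel (\<lambda>x. \<phi> (x + real (Suc j) *\<^sub>R w) - \<phi> (x + real j *\<^sub>R w)) = n2 lborel (\<lambda>x. \<phi> (x + w) - \<phi> x)"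
      unfolding n2_def
      using integral_translate[of "\<lambda>x. (norm (\<phi> (x + w) - \<phi> x))\<^sup>2" "real j *\<^sub>R w"]
      by (simp add: algebra_simps)
    finally show ?case using Suc by (simp add: algebra_simps)
  qed
  have "n2 lborel (\<lambda>x. \<phi> (x + z) - \<phi> x) \<le> n2 lborel (d k)" for k
  proof -
    have "n2 lborel (d k) = real (Suc k) * n2 lborel (\<lambda>x. \<phi> (x + (1 / real (Suc k)) *\<^sub>R z) - \<phi> x)"
      using n2_scaleR[of lborel "real (Suc k)" "\<lambda>x. \<phi> (x + (1 / real (Suc k)) *\<^sub>R z) - \<phi> x"]
      by (simp add: d_def[abs_def] mult.commute)
    then show ?thesis
      using steps[of "Suc k" "(1 / real (Suc k)) *\<^sub>R z"] by simp
  qed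
  then have "n2 lborel (\<lambda>x. \<phi> (x + z) - \<phi> x) \<le> n2 lborel (\<lambda>x. g x \<bullet> z)"
    by (intro LIMSEQ_le_const[OF lim]) auto
  also have "\<dots> \<le> norm z * n2 lborel g"
    using Cc1_grad_l2(2)[OF \<phi>]
    by (rule n2_le) (auto simp: mult.commute[of "norm z"] Cauchy_Schwarz_ineq2)
  finally show "n2 lborel (\<lambda>x. \<phi> (x + z) - \<phi> x) \<le> norm z * n2 lborel g" .
qed

text \<open>Partial integration of \<open>\<phi>\<^sup>2\<close> against a coordinate function.\<close>

lemma Cc1_poincare:
  fixes \<phi> :: "('n::finite) pt \<Rightarrow> real"
  assumes \<phi>: "Cc1_grad \<Omega> \<phi> g" and R: "0 \<le> R" "\<forall>x\<in>\<Omega>. norm x \<le> R"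
  shows "n2 lborel \<phi> \<le> 2 * R * n2 lborel g"
proof -
  obtain b :: "'n pt" where b: "b \<in> Basis" using nonempty_Basis by blast
  have P: "\<forall>x. ((\<lambda>x. x \<bullet> b) has_derivative (\<lambda>h. b \<bullet> h)) (at x)"
    by (auto intro!: derivative_eq_intros simp: inner_commute)
  have sq: "Cc1_grad \<Omega> (\<lambda>x. (\<phi> x)\<^sup>2) (\<lambda>x. (2 * \<phi> x) *\<^sub>R g x)"
    by (rule Cc1_grad_compose[OF \<phi>]) (auto intro!: derivative_eq_intros continuous_intros)
  note l = Cc1_grad_l2[OF \<phi>]
  have i: "integrable lborel (\<lambda>x. norm (\<phi> x) * norm (g x))"
    using l2_norm_mult_integrable[OF l] .
  \<comment> \<open>The coordinate \<open>x \<bullet> b\<close> has the constant gradient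
    \<open>b\<close>, and \<open>b \<bullet> b = 1\<close>. In the constant 2 R of the lemma, the 2
    comes from the derivative of the square and \<open>R\<close> bounds the coordinate.\<close>
  have "(\<integral>x. (\<phi> x)\<^sup>2 \<partial>lborel) = - (\<integral>x. (x \<bullet> b) * (((2 * \<phi> x) *\<^sub>R g x) \<bullet> b) \<partial>lborel)"
    using integral_by_parts[OF sq P, of b] b by simp
  also have "\<dots> \<le> \<bar>\<integral>x. (x \<bullet> b) * (((2 * \<phi> x) *\<^sub>R g x) \<bullet> b) \<partial>lborel\<bar>" by simp
  also have "\<dots> \<le> (\<integral>x. 2 * R * (norm (\<phi> x) * norm (g x)) \<partial>lborel)"
  proof (rule order_trans[OF integral_abs_bound], rule integral_mono_AE')
    show "AE x in lborel. \<bar>(x \<bullet> b) * (((2 * \<phi> x) *\<^sub>R g x) \<bullet> b)\<bar> \<le> 2 * R * (norm (\<phi> x) * norm (g x))"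
    proof (rule AE_I2)
      fix x
      show "\<bar>(x \<bullet> b) * (((2 * \<phi> x) *\<^sub>R g x) \<bullet> b)\<bar> \<le> 2 * R * (norm (\<phi> x) * norm (g x))"
      proof (cases "x \<in> \<Omega>")
        case True
        have "\<bar>x \<bullet> b\<bar> \<le> R" "\<bar>g x \<bullet> b\<bar> \<le> norm (g x)"
          using Basis_le_norm[OF b, of x] Basis_le_norm[OF b, of "g x"] R(2) True by force+
        then have "\<bar>x \<bullet> b\<bar> * (2 * \<bar>\<phi> x\<bar> * \<bar>g x \<bullet> b\<bar>) \<le> R * (2 * \<bar>\<phi> x\<bar> * norm (g x))"
          using R(1) by (intro mult_mono) auto
        then show ?thesis by (simp add: abs_mult algebra_simps)
      next
        case False
        then show ?thesis using Cc1_grad_zero_outside[OF \<phi>] by simp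
      qed
    qed
  qed (use i R in auto)
  also have "\<dots> \<le> 2 * R * (n2 lborel \<phi> * n2 lborel g)"
    using l2_cauchy_schwarz_norm[OF l] R(1) by (simp add: mult_left_mono)
  finally have le: "(n2 lborel \<phi>)\<^sup>2 \<le> 2 * R * (n2 lborel \<phi> * n2 lborel g)"
    by (simp add: n2_sq)
  show ?thesis
  proof (cases "n2 lborel \<phi> = 0")
    case True then show ?thesis using R by simp
  next
    case False
    then have "0 < n2 lborel \<phi>" using n2_nonneg[of lborel \<phi>] by linarith
    moreover have "n2 lborel \<phi> * n2 lborel \<phi> \<le> n2 lborel \<phi> * (2 * R * n2 lborel g)"
      using le by (simp add: power2_eq_square algebra_simps)
    ultimately show ?thesis by (simp only: mult_le_cancel_left_pos)
  qed
qed

section \<open>Compactness\<close>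

text \<open>With \<open>b\<close> the volume of the ball and \<open>a\<close> the integral of
  \<open>w\<close> over it, b w(x) - a is the integral of w(x) - w(y) over the ball, and
  Cauchy-Schwarz against the indicator bounds its square. Passing to the larger ball of radius 2 h
  centred at \<open>x\<close> leaves an integral over translations whose domain is the same for all
  \<open>x\<close>.\<close>

lemma ball_average_estimate:
  fixes w :: "'a::euclidean_space \<Rightarrow> real"
  assumes w: "continuous_on UNIV w" and h: "0 < h" and xc: "dist x c < h"
  shows "(w x)\<^sup>2 \<le> 2 * ((\<integral>y. indicator (ball c h) y * w y \<partial>lborel) / measure lborel (ball c h))\<^sup>2
      + 2 / measure lborel (ball c h) * (\<integral>z. indicator (ball 0 (2 * h)) z * (w (x + z) - w x)\<^sup>2 \<partial>lborel)"
proof -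
  define b where "b = measure lborel (ball c h)"
  define a where "a = (\<integral>y. indicator (ball c h) y * w y \<partial>lborel)"
  define T where "T = (\<integral>z. indicator (ball 0 (2 * h)) z * (w (x + z) - w x)\<^sup>2 \<partial>lborel)"
  have b: "0 < b" using h by (simp add: b_def)
  have [measurable]: "ball c' r \<in> sets borel" for c' :: 'a and r by simp
  have [measurable]: "w \<in> borel_measurable borel"
    using w by (rule borel_measurable_continuous_onI)
  have cw: "continuous_on UNIV (\<lambda>y. (w x - w y)\<^sup>2)" by (intro continuous_intros w)
  have int: "integrable lborel (\<lambda>y. indicator (ball c' r) y * f y)" if "continuous_on UNIV f" for c' :: 'a and r and f :: "'a \<Rightarrow> real"
  proof -
    have "integrable lborel (\<lambda>y. indicator (cball c' r) y *\<^sub>R f y)"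
      by (rule borel_integrable_compact) (auto intro: continuous_on_subset[OF that])
    then have "set_integrable lborel (cball c' r) f" by (simp add: set_integrable_def)
    then have "set_integrable lborel (ball c' r) f" by (rule set_integrable_subset) auto
    then show ?thesis by (simp add: set_integrable_def)
  qed
  define f where "f y = indicator (ball c h) y * (w x - w y)" for y
  define i where "i y = (indicator (ball c h) y :: real)" for y
  have sq: "(f y)\<^sup>2 = indicator (ball c h) y * (w x - w y)\<^sup>2" for y
    by (simp add: f_def indicator_def)
  have f2: "l2 lborel f"
    unfolding l2_def
  proof
    show "f \<in> borel_measurable lborel" unfolding f_def by measurable
    show "integrable lborel (\<lambda>y. (norm (f y))\<^sup>2)"
      using int[OF cw, of c h] by (simp add: sq)
  qed
  have ib: "integrable lborel i"
    using int[of "\<lambda>y. 1" c h] by (simp add: i_def[abs_def])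
  have i2: "l2 lborel i"
    unfolding l2_def
  proof
    show "i \<in> borel_measurable lborel" unfolding i_def by measurable
    have "(\<lambda>y. (norm (i y))\<^sup>2) = i" by (auto simp: i_def indicator_def)
    then show "integrable lborel (\<lambda>y. (norm (i y))\<^sup>2)" using ib by simp
  qed
  have ni: "(n2 lborel i)\<^sup>2 = b"
  proof -
    have "(\<lambda>y. (norm (i y))\<^sup>2) = i" by (auto simp: i_def indicator_def)
    then show ?thesis by (simp add: n2_sq i_def[abs_def] b_def)
  qed
  have nf: "(n2 lborel f)\<^sup>2 \<le> T"
  proof -
    have "(n2 lborel f)\<^sup>2 = (\<integral>y. indicator (ball c h) y * (w x - w y)\<^sup>2 \<partial>lborel)"
      by (simp add: n2_sq sq)
    also have "\<dots> \<le> (\<integral>y. indicator (ball x (2 * h)) y * (w x - w y)\<^sup>2 \<partial>lborel)"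
    proof (rule integral_mono)
      show "indicator (ball c h) y * (w x - w y)\<^sup>2 \<le> indicator (ball x (2 * h)) y * (w x - w y)\<^sup>2" for y
      proof (cases "y \<in> ball c h")
        case True
        then have "y \<in> ball x (2 * h)"
          using xc dist_triangle[of x y c] by simp
        then show ?thesis using True by (simp add: indicator_def del: mem_ball)
      qed simp
    qed (intro int continuous_intros w)+
    also have "\<dots> = (\<integral>z. indicator (ball x (2 * h)) (z + x) * (w x - w (z + x))\<^sup>2 \<partial>lborel)"
      by (rule integral_translate[symmetric]) measurable
    also have "\<dots> = T"
      unfolding T_def
      by (intro Bochner_Integration.integral_cong)
        (auto simp: indicator_def dist_norm add.commute power2_commute)
    finally show ?thesis .
  qed
  have eq: "b * w x - a = (\<integral>y. f y \<bullet> i y \<partial>lborel)"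
  proof -
    have "(\<integral>y. f y \<bullet> i y \<partial>lborel) = (\<integral>y. w x * indicator (ball c h) y - indicator (ball c h) y * w y \<partial>lborel)"
      by (intro Bochner_Integration.integral_cong) (auto simp: f_def i_def indicator_def)
    also have "\<dots> = w x * b - a"
      using ib int[OF w, of c h] by (simp add: a_def b_def i_def[abs_def])
    finally show ?thesis by (simp add: mult.commute)
  qed
  have "(b * w x - a)\<^sup>2 \<le> (n2 lborel f * n2 lborel i)\<^sup>2"
    using l2_cauchy_schwarz[OF f2 i2] unfolding eq by (metis abs_ge_zero power2_abs power_mono)
  also have "\<dots> \<le> T * b"
    using nf b by (simp add: power_mult_distrib ni)
  finally have 1: "(b * w x - a)\<^sup>2 \<le> T * b" .
  have sq2: "(u + v)\<^sup>2 \<le> 2 * u\<^sup>2 + 2 * v\<^sup>2" for u v :: real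
    using sum_squares_bound[of u v] by (simp add: power2_sum)
  have "(w x)\<^sup>2 = (a / b + (w x - a / b))\<^sup>2" by simp
  also have "\<dots> \<le> 2 * (a / b)\<^sup>2 + 2 * (w x - a / b)\<^sup>2"
    by (rule sq2)
  also have "(w x - a / b)\<^sup>2 = (b * w x - a)\<^sup>2 / b\<^sup>2"
    using b by (simp add: power_divide[symmetric] diff_divide_distrib)
  also have "\<dots> \<le> T * b / b\<^sup>2"
    using 1 by (simp add: divide_right_mono)
  also have "T * b / b\<^sup>2 = T / b" using b by (simp add: power2_eq_square)
  finally show ?thesis by (simp add: a_def b_def T_def)
qed

text \<open>A function with small gradient norm is controlled in \<open>L\<^sup>2\<close> by its averages over the balls of a
  finite net: the deviation from the average is an average of translation differences.\<close>

lemma Cc1_net_estimate: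
  fixes w :: "('n::finite) pt \<Rightarrow> real"
  assumes w: "Cc1_grad \<Omega> w g" and h: "0 < h" and C: "finite C" "\<Omega> \<subseteq> (\<Union>c\<in>C. ball c h)"
    and R: "\<Omega> \<subseteq> ball 0 R"
  shows "(n2 lborel w)\<^sup>2 \<le> 2 * measure lborel (ball 0 R :: 'n pt set) *
      ((\<Sum>c\<in>C. \<bar>\<integral>y. indicator (ball c h) y * w y \<partial>lborel\<bar>) / measure lborel (ball 0 h :: 'n pt set))\<^sup>2
      + 8 * 2 ^ CARD('n) * h\<^sup>2 * (n2 lborel g)\<^sup>2"
proof -
  define b where "b = measure lborel (ball 0 h :: 'n pt set)"
  define S where "S = (\<Sum>c\<in>C. \<bar>\<integral>y. indicator (ball c h) y * w y \<partial>lborel\<bar>)"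
  define D where "D = (n2 lborel g)\<^sup>2"
  define F where "F x z = indicator (ball 0 (2 * h)) z * (w (x + z) - w x)\<^sup>2" for x z
  have b: "0 < b" using h by (simp add: b_def)
  have bc: "measure lborel (ball c h) = b" for c :: "'n pt"
    using h by (simp add: b_def content_ball)
  have b2: "measure lborel (ball 0 (2 * h) :: 'n pt set) = 2 ^ CARD('n) * b"
    using h by (simp add: b_def content_ball power_mult_distrib)
  have [measurable]: "ball c r \<in> sets borel" for c :: "'n pt" and r by simp
  have wc: "continuous_on UNIV w" by (rule Cc1_grad_continuous[OF w])
  have [measurable]: "w \<in> borel_measurable borel" by (rule Cc1_grad_measurable[OF w])
  have Fi: "integrable lborel (F x)" for x
  proof -
    have "integrable lborel (\<lambda>z. indicator (cball 0 (2 * h)) z *\<^sub>R (w (x + z) - w x)\<^sup>2)"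
      by (rule borel_integrable_compact)
        (auto intro!: continuous_intros continuous_on_compose2[OF wc])
    then have "set_integrable lborel (cball 0 (2 * h)) (\<lambda>z. (w (x + z) - w x)\<^sup>2)"
      by (simp add: set_integrable_def)
    then have "set_integrable lborel (ball 0 (2 * h)) (\<lambda>z. (w (x + z) - w x)\<^sup>2)"
      by (rule set_integrable_subset) auto
    then show ?thesis by (simp add: set_integrable_def F_def[abs_def])
  qed
  have F0: "0 \<le> F x z" for x z by (simp add: F_def)
  \<comment> \<open>Off \<Omega> the left side is 0. On \<Omega> some ball of the net contains
    \<open>x\<close>, and the modulus of the integral over it is at most the sum \<open>S\<close>
    over the whole net.\<close>
  have pw: "(w x)\<^sup>2 \<le> 2 * (S / b)\<^sup>2 * indicator (ball 0 R) x + 2 / b * (\<integral>z. F x z \<partial>lborel)" for x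
  proof (cases "x \<in> \<Omega>")
    case True
    then obtain c where c: "c \<in> C" "dist x c < h"
      using C(2) by (auto simp: dist_commute)
    have "\<bar>\<integral>y. indicator (ball c h) y * w y \<partial>lborel\<bar> \<le> S"
      unfolding S_def by (rule member_le_sum) (use c C in auto)
    then have "((\<integral>y. indicator (ball c h) y * w y \<partial>lborel) / b)\<^sup>2 \<le> (S / b)\<^sup>2"
      using b unfolding power_divide
      by (intro divide_right_mono) (auto simp: abs_le_square_iff[symmetric])
    then show ?thesis
      using ball_average_estimate[OF wc h c(2)] R True unfolding bc F_def by auto
  next
    case False
    then have "(w x)\<^sup>2 = 0" using Cc1_grad_zero_outside[OF w] by simp
    moreover have "0 \<le> 2 * (S / b)\<^sup>2 * indicator (ball 0 R) x" by simp
    moreover have "0 \<le> 2 / b * (\<integral>z. F x z \<partial>lborel)"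
      using b F0 by (intro mult_nonneg_nonneg) auto
    ultimately show ?thesis by linarith
  qed
  have inner: "(\<integral>\<^sup>+x. ennreal (F x z) \<partial>lborel) \<le> ennreal ((2 * h)\<^sup>2 * D) * indicator (ball 0 (2 * h)) z" for z
  proof (cases "z \<in> ball 0 (2 * h)")
    case True
    have l: "l2 lborel (\<lambda>x. w (x + z) - w x)"
      by (intro l2_diff Cc1_translation_estimate[OF w] Cc1_grad_l2[OF w])
    have "(\<integral>\<^sup>+x. ennreal (F x z) \<partial>lborel) = ennreal ((n2 lborel (\<lambda>x. w (x + z) - w x))\<^sup>2)"
      using True l2_integrable_sq[OF l] by (simp add: F_def n2_sq nn_integral_eq_integral)
    also have "(n2 lborel (\<lambda>x. w (x + z) - w x))\<^sup>2 \<le> (norm z * n2 lborel g)\<^sup>2"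
      by (intro power_mono Cc1_translation_estimate[OF w]) simp
    also have "\<dots> \<le> (2 * h)\<^sup>2 * D"
      unfolding power_mult_distrib[of "norm z"] D_def
      using True by (intro mult_right_mono power_mono) auto
    finally show ?thesis using True by (simp add: ennreal_leI)
  qed (simp add: F_def)
  have "ennreal ((n2 lborel w)\<^sup>2) = (\<integral>\<^sup>+x. ennreal ((w x)\<^sup>2) \<partial>lborel)"
    using l2_integrable_sq[OF Cc1_grad_l2(1)[OF w]] by (simp add: n2_sq nn_integral_eq_integral)
  also have "\<dots> \<le> (\<integral>\<^sup>+x. ennreal (2 * (S / b)\<^sup>2) * indicator (ball 0 R) x
      + ennreal (2 / b) * (\<integral>\<^sup>+z. ennreal (F x z) \<partial>lborel) \<partial>lborel)"
  proof (rule nn_integral_mono)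
    fix x
    have "ennreal ((w x)\<^sup>2) \<le> ennreal (2 * (S / b)\<^sup>2 * indicator (ball 0 R) x + 2 / b * (\<integral>z. F x z \<partial>lborel))"
      by (rule ennreal_leI) (rule pw)
    also have "\<dots> = ennreal (2 * (S / b)\<^sup>2) * indicator (ball 0 R) x + ennreal (2 / b) * (\<integral>\<^sup>+z. ennreal (F x z) \<partial>lborel)"
    proof -
      have I: "(\<integral>\<^sup>+z. ennreal (F x z) \<partial>lborel) = ennreal (\<integral>z. F x z \<partial>lborel)"
        by (rule nn_integral_eq_integral[OF Fi]) (simp add: F0)
      have e: "ennreal (A * i + B * J) = ennreal A * ennreal i + ennreal B * ennreal J"
        if "0 \<le> A" "0 \<le> B" "0 \<le> i" "0 \<le> J" for A B i J
        using that by (simp add: ennreal_mult)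
      show ?thesis
        unfolding I ennreal_indicator[symmetric]
        by (rule e) (use b F0 in \<open>auto intro: integral_nonneg\<close>)
    qed
    finally show "ennreal ((w x)\<^sup>2) \<le> \<dots>" .
  qed
  also have "\<dots> = ennreal (2 * (S / b)\<^sup>2) * emeasure lborel (ball 0 R :: 'n pt set)
      + ennreal (2 / b) * (\<integral>\<^sup>+x. (\<integral>\<^sup>+z. ennreal (F x z) \<partial>lborel) \<partial>lborel)"
    unfolding F_def by (subst nn_integral_add) (auto simp: nn_integral_cmult)
  \<comment> \<open>After the exchange, the inner integral at fixed \<open>z\<close> is the squared
    L^2 norm of a translation difference, to which the gradient bound applies. Nonnegative integrals
    allow the exchange by Tonelli.\<close>
  also have "(\<integral>\<^sup>+x. (\<integral>\<^sup>+z. ennreal (F x z) \<partial>lborel) \<partial>lborel) = (\<integral>\<^sup>+z. (\<integral>\<^sup>+x. ennreal (F x z) \<partial>lborel) \<partial>lborel)"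
    unfolding F_def by (rule lborel_pair.Fubini'[symmetric]) measurable
  also have "\<dots> \<le> (\<integral>\<^sup>+z. ennreal ((2 * h)\<^sup>2 * D) * indicator (ball 0 (2 * h)) z \<partial>(lborel :: 'n pt measure))"
    by (intro nn_integral_mono inner)
  also have "\<dots> = ennreal ((2 * h)\<^sup>2 * D) * emeasure lborel (ball 0 (2 * h) :: 'n pt set)"
    by (subst nn_integral_cmult) auto
  also have "emeasure lborel (ball 0 (2 * h) :: 'n pt set) = ennreal (2 ^ CARD('n) * b)"
    unfolding b2[symmetric] using emeasure_lborel_ball_finite[of "0::'n pt" "2 * h"]
    by (simp add: emeasure_eq_ennreal_measure)
  also have "emeasure lborel (ball 0 R :: 'n pt set) = ennreal (measure lborel (ball 0 R :: 'n pt set))"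
    using emeasure_lborel_ball_finite[of "0::'n pt" R] by (simp add: emeasure_eq_ennreal_measure)
  finally have "ennreal ((n2 lborel w)\<^sup>2) \<le> ennreal (2 * (S / b)\<^sup>2) * ennreal (measure lborel (ball 0 R :: 'n pt set))
      + ennreal (2 / b) * (ennreal ((2 * h)\<^sup>2 * D) * ennreal (2 ^ CARD('n) * b))"
    by (simp add: add_left_mono mult_left_mono)
  also have "\<dots> = ennreal (2 * (S / b)\<^sup>2 * measure lborel (ball 0 R :: 'n pt set) + 2 / b * ((2 * h)\<^sup>2 * D * (2 ^ CARD('n) * b)))"
  proof -
    have e: "ennreal X * ennreal Y + ennreal U * (ennreal V * ennreal W) = ennreal (X * Y + U * (V * W))"
      if "0 \<le> X" "0 \<le> Y" "0 \<le> U" "0 \<le> V" "0 \<le> W" for X Y U V W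
      using that by (simp add: ennreal_mult)
    show ?thesis by (rule e) (use b in \<open>auto simp: D_def\<close>)
  qed
  finally have "(n2 lborel w)\<^sup>2 \<le> 2 * (S / b)\<^sup>2 * measure lborel (ball 0 R :: 'n pt set) + 2 / b * ((2 * h)\<^sup>2 * D * (2 ^ CARD('n) * b))"
    using b by (subst (asm) ennreal_le_iff) (auto simp: D_def intro!: add_nonneg_nonneg mult_nonneg_nonneg)
  \<comment> \<open>The volume \<open>b\<close> cancels, so the coefficient of the gradient term is
    of order h^2.\<close>
  also have "2 / b * ((2 * h)\<^sup>2 * D * (2 ^ CARD('n) * b)) = 8 * 2 ^ CARD('n) * h\<^sup>2 * D"
    using b by (simp add: field_simps power_mult_distrib)
  finally show ?thesis by (simp add: S_def b_def D_def algebra_simps)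
qed

text \<open>The integrals over the balls of all nets form a countable family of bounded sequences,
  so one diagonal subsequence makes them all converge. Given \<open>e\<close>, a fine net makes the
  gradient part of the net estimate small for all indices at once; on that finite net the averages
  are Cauchy.\<close>

lemma Cc1_rellich:
  fixes \<phi> :: "nat \<Rightarrow> ('n::finite) pt \<Rightarrow> real"
  assumes \<Omega>: "bounded \<Omega>" and \<phi>: "\<forall>k. Cc1_grad \<Omega> (\<phi> k) (g k)" and D: "\<forall>k. n2 lborel (g k) \<le> D"
  obtains r :: "nat \<Rightarrow> nat" where "strict_mono r"
    "\<forall>e>0. \<exists>N. \<forall>k\<ge>N. \<forall>l\<ge>N. n2 lborel (\<lambda>x. \<phi> (r k) x - \<phi> (r l) x) < e"
proof -
  obtain R where R: "0 < R" "\<Omega> \<subseteq> ball 0 R" "\<forall>x\<in>\<Omega>. norm x \<le> R"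
  proof -
    obtain R where R: "0 < R" "\<forall>x\<in>\<Omega>. norm x < R" using \<Omega> by (auto simp: bounded_pos_less)
    show ?thesis by (rule that[of R]) (use R in \<open>auto intro: less_imp_le\<close>)
  qed
  define h where "h j = 1 / real (Suc j)" for j
  have h: "0 < h j" "h j \<le> 1" for j by (auto simp: h_def)
  have "\<exists>C. finite C \<and> \<Omega> \<subseteq> (\<Union>c\<in>C. ball c (h j))" for j
  proof -
    have "compact (closure \<Omega>)" using \<Omega> by simp
    then obtain C where "C \<subseteq> closure \<Omega>" "finite C" "closure \<Omega> \<subseteq> (\<Union>c\<in>C. ball c (h j))"
      by (rule compactE_image[of _ "closure \<Omega>" "\<lambda>c. ball c (h j)"]) (use h in auto)
    then show ?thesis using closure_subset[of \<Omega>] by blast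
  qed
  then obtain C where C: "\<forall>j. finite (C j) \<and> \<Omega> \<subseteq> (\<Union>c\<in>C j. ball c (h j))"
    by metis
  define a where "a k = (\<lambda>(j, c). \<integral>y. indicator (ball c (h j)) y * \<phi> k y \<partial>lborel)" for k
  define V where "V = sqrt (measure lborel (ball 0 1 :: 'n pt set))"
  have D0: "0 \<le> D" using D n2_nonneg order_trans by blast
  \<comment> \<open>Cauchy-Schwarz against the indicator, then Poincare's inequality;
    \<open>V\<close> serves all radii since \<open>h j\<close> is at most 1.\<close>
  have bd: "norm (a k p) \<le> V * (2 * R * D)" for k p
  proof -
    obtain j c where p: "p = (j, c)" by fastforce
    define i where "i y = (indicator (ball c (h j)) y :: real)" for y :: "'n pt"
    have [measurable]: "ball c r \<in> sets borel" for r by simp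
    have [measurable]: "i \<in> borel_measurable lborel" unfolding i_def by measurable
    have isq: "(i y)\<^sup>2 = i y" for y by (auto simp: i_def indicator_def)
    have ib: "integrable lborel i"
      unfolding i_def using emeasure_lborel_ball_finite by (intro integrable_real_indicator) auto
    have i2: "l2 lborel i" by (simp add: l2_def isq ib)
    have "n2 lborel i = sqrt (measure lborel (ball c (h j)))"
      by (simp add: n2_def isq) (simp add: i_def[abs_def])
    also have "\<dots> \<le> V"
      using h[of j] power_le_one[of "h j" "CARD('n)"]
      by (simp add: V_def content_ball less_imp_le mult_left_le)
    finally have ni: "n2 lborel i \<le> V" .
    have "\<bar>a k p\<bar> \<le> n2 lborel i * n2 lborel (\<phi> k)"
      using l2_cauchy_schwarz[OF i2 Cc1_grad_l2(1)[OF \<phi>[rule_format, of k]]]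
      by (simp add: a_def p i_def)
    also have "n2 lborel (\<phi> k) \<le> 2 * R * n2 lborel (g k)"
      using Cc1_poincare[OF \<phi>[rule_format] _ R(3)] R(1) by simp
    also have "\<dots> \<le> 2 * R * D" using D R(1) by simp
    finally have "\<bar>a k p\<bar> \<le> n2 lborel i * (2 * R * D)" by (simp add: mult_left_mono)
    also have "\<dots> \<le> V * (2 * R * D)" using ni R(1) D0 by (intro mult_right_mono) auto
    finally show ?thesis by simp
  qed
  have "countable (SIGMA j:UNIV. C j)" using C by (auto intro: countable_finite)
  then have "\<exists>r::nat \<Rightarrow> nat. strict_mono r \<and> (\<forall>p\<in>(SIGMA j:UNIV. C j). \<exists>l. (\<lambda>k. a (r k) p) \<longlonglongrightarrow> l)"
  proof (rule function_convergent_subsequence[where f = a])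
    show "norm (a k p) \<le> V * (2 * R * D)" for k p by (rule bd)
  qed blast
  then obtain r :: "nat \<Rightarrow> nat" where r: "strict_mono r"
      "\<forall>p\<in>(SIGMA j:UNIV. C j). \<exists>l. (\<lambda>k. a (r k) p) \<longlonglongrightarrow> l"
    by blast
  then obtain L where L: "\<forall>p\<in>(SIGMA j:UNIV. C j). (\<lambda>k. a (r k) p) \<longlonglongrightarrow> L p"
    by metis
  have "\<exists>N. \<forall>k\<ge>N. \<forall>l\<ge>N. n2 lborel (\<lambda>x. \<phi> (r k) x - \<phi> (r l) x) < e" if "0 < e" for e
  proof -
    \<comment> \<open>The gradient of a difference has norm at most 2 D, so the second term of the
      net estimate is at most \<open>K * (h j)\<^sup>2\<close> for every pair of indices.\<close>
    define K where "K = 8 * 2 ^ CARD('n) * (2 * D)\<^sup>2"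
    have "(\<lambda>j. K * (h j)\<^sup>2) \<longlonglongrightarrow> K * 0\<^sup>2"
      unfolding h_def by (intro tendsto_intros lim_1_over_n[THEN LIMSEQ_Suc])
    then have "\<forall>\<^sub>F j in sequentially. K * (h j)\<^sup>2 < e\<^sup>2 / 2"
      using \<open>0 < e\<close> by (intro order_tendstoD) auto
    then obtain j where j: "K * (h j)\<^sup>2 < e\<^sup>2 / 2"
      by (auto simp: eventually_sequentially)
    define s where "s k = (\<Sum>c\<in>C j. \<bar>a (r k) (j, c) - L (j, c)\<bar>)" for k
    define M where "M = 2 * measure lborel (ball 0 R :: 'n pt set)"
    define b where "b = measure lborel (ball 0 (h j) :: 'n pt set)"
    have b: "0 < b" using h by (simp add: b_def)
    have "s \<longlonglongrightarrow> (\<Sum>c\<in>C j. \<bar>L (j, c) - L (j, c)\<bar>)"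
      unfolding s_def using L by (intro tendsto_intros) auto
    then have s0: "s \<longlonglongrightarrow> 0" by simp
    have "(\<lambda>k. M * (2 * s k / b)\<^sup>2) \<longlonglongrightarrow> M * (2 * 0 / b)\<^sup>2"
      using b by (intro tendsto_intros s0) auto
    then have "\<forall>\<^sub>F k in sequentially. M * (2 * s k / b)\<^sup>2 < e\<^sup>2 / 2"
      using \<open>0 < e\<close> by (intro order_tendstoD) auto
    then obtain N where N: "\<forall>k\<ge>N. M * (2 * s k / b)\<^sup>2 < e\<^sup>2 / 2"
      by (auto simp: eventually_sequentially)
    have "n2 lborel (\<lambda>x. \<phi> (r k) x - \<phi> (r l) x) < e" if kl: "k \<ge> N" "l \<ge> N" for k l
    proof -
      note \<phi>k = \<phi>[rule_format, of "r k"] and \<phi>l = \<phi>[rule_format, of "r l"]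
      have w: "Cc1_grad \<Omega> (\<lambda>x. \<phi> (r k) x - \<phi> (r l) x) (\<lambda>x. g (r k) x - g (r l) x)"
        using Cc1_grad_lincomb[OF \<phi>k \<phi>l, of 1 "-1"] by simp
      have "n2 lborel (\<lambda>x. g (r k) x - g (r l) x) \<le> n2 lborel (g (r k)) + n2 lborel (g (r l))"
        using n2_triangle[OF Cc1_grad_l2(2)[OF \<phi>k] l2_uminus[OF Cc1_grad_l2(2)[OF \<phi>l]]] by simp
      also have "\<dots> \<le> 2 * D" using D[rule_format, of "r k"] D[rule_format, of "r l"] by simp
      finally have g2: "(n2 lborel (\<lambda>x. g (r k) x - g (r l) x))\<^sup>2 \<le> (2 * D)\<^sup>2"
        by (intro power_mono) auto
      have ai: "integrable lborel (\<lambda>y. indicator (ball c (h j)) y * \<phi> k y)" for c k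
      proof -
        obtain K where K: "compact K" "\<forall>x. x \<notin> K \<longrightarrow> \<phi> k x = 0"
          using \<phi>[rule_format, of k] by (rule Cc1_gradE)
        have "integrable lborel (\<phi> k)"
          using continuous_compact_support_integrable[OF Cc1_grad_continuous[OF \<phi>[rule_format]] K] .
        then show ?thesis
          using integrable_mult_indicator[of "ball c (h j)" lborel "\<phi> k"] by simp
      qed
      have ad: "(\<integral>y. indicator (ball c (h j)) y * (\<phi> (r k) y - \<phi> (r l) y) \<partial>lborel) = a (r k) (j, c) - a (r l) (j, c)" for c
        using ai by (simp add: a_def right_diff_distrib)
      define S where "S = (\<Sum>c\<in>C j. \<bar>a (r k) (j, c) - a (r l) (j, c)\<bar>)"
      have S0: "0 \<le> S" by (simp add: S_def sum_nonneg)
      have "S \<le> (\<Sum>c\<in>C j. \<bar>a (r k) (j, c) - L (j, c)\<bar> + \<bar>a (r l) (j, c) - L (j, c)\<bar>)"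
        unfolding S_def by (intro sum_mono) linarith
      also have "\<dots> = s k + s l" by (simp add: s_def sum.distrib)
      also have "\<dots> \<le> 2 * max (s k) (s l)" by simp
      finally have Sm: "S \<le> 2 * max (s k) (s l)" .
      have "M * (S / b)\<^sup>2 \<le> M * (2 * max (s k) (s l) / b)\<^sup>2"
        using Sm S0 b by (intro mult_left_mono power_mono divide_right_mono) (auto simp: M_def)
      also have "\<dots> < e\<^sup>2 / 2"
        using N kl by (simp add: max_def)
      finally have MS: "M * (S / b)\<^sup>2 < e\<^sup>2 / 2" .
      have "(n2 lborel (\<lambda>x. \<phi> (r k) x - \<phi> (r l) x))\<^sup>2
          \<le> M * (S / b)\<^sup>2 + 8 * 2 ^ CARD('n) * (h j)\<^sup>2 * (n2 lborel (\<lambda>x. g (r k) x - g (r l) x))\<^sup>2"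
        using Cc1_net_estimate[OF w h(1), of "C j" j R] C R unfolding ad S_def M_def b_def by blast
      also have "\<dots> \<le> M * (S / b)\<^sup>2 + 8 * 2 ^ CARD('n) * (h j)\<^sup>2 * (2 * D)\<^sup>2"
        using g2 by (intro add_left_mono mult_left_mono) auto
      also have "\<dots> < e\<^sup>2"
        using MS j by (simp add: K_def algebra_simps)
      finally show ?thesis
        using \<open>0 < e\<close> by (simp add: power2_less_imp_less)
    qed
    then show ?thesis by blast
  qed
  with r(1) show ?thesis by (intro that[of r]) blast+
qed

section \<open>The space \<open>H\<^sup>1\<^sub>0\<close>\<close>

lemma set_integral_lebesgue_on:
  fixes f :: "'a::euclidean_space \<Rightarrow> 'b::{banach, second_countable_topology}"
  assumes "\<Omega> \<in> sets lebesgue"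
  shows "(LINT x:\<Omega>|lebesgue. f x) = (\<integral>x. f x \<partial>lebesgue_on \<Omega>)"
    and "set_integrable lebesgue \<Omega> f \<longleftrightarrow> integrable (lebesgue_on \<Omega>) f"
  using assms
  by (auto simp: set_lebesgue_integral_def set_integrable_def integral_restrict_space integrable_restrict_space)

text \<open>The set integrals of the definition become norms over
  \<open>lebesgue_on \<Omega>\<close>, to which the L^2 lemmas apply. Measurability on the whole
  space remains a separate demand.\<close>

lemma H10_grad_iff:
  fixes u :: "('n::finite) pt \<Rightarrow> real"
  assumes \<Omega>: "\<Omega> \<in> sets lebesgue"
  shows "H10_grad \<Omega> u G \<longleftrightarrow> u \<in> borel_measurable lebesgue \<and> G \<in> borel_measurable lebesgue \<and>
     l2 (lebesgue_on \<Omega>) u \<and> l2 (lebesgue_on \<Omega>) G \<and>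
     (\<exists>\<phi> g. (\<forall>k. Cc1_grad \<Omega> (\<phi> k) (g k)) \<and>
        (\<lambda>k. n2 (lebesgue_on \<Omega>) (\<lambda>x. \<phi> k x - u x)) \<longlonglongrightarrow> 0 \<and>
        (\<lambda>k. n2 (lebesgue_on \<Omega>) (\<lambda>x. g k x - G x)) \<longlonglongrightarrow> 0)"
proof -
  have m: "f \<in> borel_measurable lebesgue \<Longrightarrow> f \<in> borel_measurable (lebesgue_on \<Omega>)" for f :: "'n pt \<Rightarrow> 'b::euclidean_space"
    by (rule measurable_restrict_space1)
  have z: "((\<lambda>k. (LINT x:\<Omega>|lebesgue. (norm (f k x))\<^sup>2)) \<longlonglongrightarrow> 0)
      \<longleftrightarrow> ((\<lambda>k. n2 (lebesgue_on \<Omega>) (f k)) \<longlonglongrightarrow> 0)" for f :: "nat \<Rightarrow> 'n pt \<Rightarrow> 'b::euclidean_space"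
  proof
    assume "(\<lambda>k. (LINT x:\<Omega>|lebesgue. (norm (f k x))\<^sup>2)) \<longlonglongrightarrow> 0"
    then have "(\<lambda>k. sqrt (LINT x:\<Omega>|lebesgue. (norm (f k x))\<^sup>2)) \<longlonglongrightarrow> sqrt 0"
      by (rule tendsto_real_sqrt)
    then show "(\<lambda>k. n2 (lebesgue_on \<Omega>) (f k)) \<longlonglongrightarrow> 0"
      by (simp add: n2_def set_integral_lebesgue_on[OF \<Omega>])
  next
    assume "(\<lambda>k. n2 (lebesgue_on \<Omega>) (f k)) \<longlonglongrightarrow> 0"
    then have "(\<lambda>k. (n2 (lebesgue_on \<Omega>) (f k))\<^sup>2) \<longlonglongrightarrow> 0\<^sup>2"
      by (rule tendsto_power)
    then show "(\<lambda>k. (LINT x:\<Omega>|lebesgue. (norm (f k x))\<^sup>2)) \<longlonglongrightarrow> 0"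
      by (simp add: n2_sq set_integral_lebesgue_on[OF \<Omega>])
  qed
  have z1: "((\<lambda>k. (LINT x:\<Omega>|lebesgue. (f k x)\<^sup>2)) \<longlonglongrightarrow> 0)
      \<longleftrightarrow> ((\<lambda>k. n2 (lebesgue_on \<Omega>) (f k)) \<longlonglongrightarrow> 0)" for f :: "nat \<Rightarrow> 'n pt \<Rightarrow> real"
    using z[of f] by simp
  have l: "f \<in> borel_measurable lebesgue \<Longrightarrow> l2 (lebesgue_on \<Omega>) f \<longleftrightarrow> integrable (lebesgue_on \<Omega>) (\<lambda>x. (norm (f x))\<^sup>2)"
    for f :: "'n pt \<Rightarrow> 'b::euclidean_space"
    using m by (auto simp: l2_def)
  show ?thesis
    unfolding H10_grad_def z z1 set_integral_lebesgue_on(2)[OF \<Omega>]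
    using l[of u] l[of G] by auto
qed

text \<open>Test functions are integrated over \<open>lborel\<close>, where translations act,
  whereas the Sobolev space lives on the restricted completion. For Borel functions vanishing off
  \<Omega> the two integrals agree.\<close>

lemma lebesgue_on_borel_eq:
  fixes f :: "'a::euclidean_space \<Rightarrow> 'b::euclidean_space"
  assumes "\<Omega> \<in> sets lebesgue" "f \<in> borel_measurable borel" "\<forall>x. x \<notin> \<Omega> \<longrightarrow> f x = 0"
  shows "(\<integral>x. f x \<partial>lebesgue_on \<Omega>) = (\<integral>x. f x \<partial>lborel)"
    and "integrable (lebesgue_on \<Omega>) f \<longleftrightarrow> integrable lborel f"
proof -
  have e: "(\<lambda>x. indicator \<Omega> x *\<^sub>R f x) = f" using assms(3) by (auto simp: indicator_def)
  show "(\<integral>x. f x \<partial>lebesgue_on \<Omega>) = (\<integral>x. f x \<partial>lborel)"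
    using assms by (simp add: integral_restrict_space e integral_completion)
  show "integrable (lebesgue_on \<Omega>) f \<longleftrightarrow> integrable lborel f"
    using assms by (simp add: integrable_restrict_space e integrable_completion)
qed

lemma lebesgue_on_borel_l2:
  fixes f :: "'a::euclidean_space \<Rightarrow> 'b::euclidean_space"
  assumes \<Omega>: "\<Omega> \<in> sets lebesgue" and f: "f \<in> borel_measurable borel" "\<forall>x. x \<notin> \<Omega> \<longrightarrow> f x = 0"
  shows "n2 (lebesgue_on \<Omega>) f = n2 lborel f" "l2 lborel f \<Longrightarrow> l2 (lebesgue_on \<Omega>) f"
proof -
  have s: "(\<lambda>x. (norm (f x))\<^sup>2) \<in> borel_measurable borel" "\<forall>x. x \<notin> \<Omega> \<longrightarrow> (norm (f x))\<^sup>2 = 0"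
    using f by auto
  have m: "f \<in> borel_measurable (lebesgue_on \<Omega>)"
    using f by (intro measurable_restrict_space1) (simp add: measurable_completion)
  show "n2 (lebesgue_on \<Omega>) f = n2 lborel f"
    using lebesgue_on_borel_eq(1)[OF \<Omega> s] by (simp add: n2_def)
  show "l2 (lebesgue_on \<Omega>) f" if "l2 lborel f"
    using lebesgue_on_borel_eq(2)[OF \<Omega> s] that m by (simp add: l2_def)
qed

lemma Cc1_grad_lebesgue_on:
  fixes \<phi> :: "('n::finite) pt \<Rightarrow> real"
  assumes \<Omega>: "\<Omega> \<in> sets lebesgue" and \<phi>: "Cc1_grad \<Omega> \<phi> g"
  shows "l2 (lebesgue_on \<Omega>) \<phi>" "l2 (lebesgue_on \<Omega>) g"
    "n2 (lebesgue_on \<Omega>) \<phi> = n2 lborel \<phi>" "n2 (lebesgue_on \<Omega>) g = n2 lborel g"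
  using lebesgue_on_borel_l2[OF \<Omega>] Cc1_grad_measurable[OF \<phi>] Cc1_grad_zero_outside[OF \<phi>] Cc1_grad_l2[OF \<phi>]
  by blast+

lemma H10_gradD:
  fixes u :: "('n::finite) pt \<Rightarrow> real"
  assumes "\<Omega> \<in> sets lebesgue" "H10_grad \<Omega> u G"
  shows "u \<in> borel_measurable lebesgue" "G \<in> borel_measurable lebesgue"
    "l2 (lebesgue_on \<Omega>) u" "l2 (lebesgue_on \<Omega>) G"
  using assms by (auto simp: H10_grad_iff)

lemma H10_grad_approx:
  fixes u :: "('n::finite) pt \<Rightarrow> real"
  assumes \<Omega>: "\<Omega> \<in> sets lebesgue" and u: "H10_grad \<Omega> u G" and e: "0 < e"
  shows "\<exists>\<phi> g. Cc1_grad \<Omega> \<phi> g \<and> n2 (lebesgue_on \<Omega>) (\<lambda>x. \<phi> x - u x) < e \<and> n2 (lebesgue_on \<Omega>) (\<lambda>x. g x - G x) < e"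
proof -
  obtain \<phi> g where \<phi>: "\<forall>k. Cc1_grad \<Omega> (\<phi> k) (g k)"
      "(\<lambda>k. n2 (lebesgue_on \<Omega>) (\<lambda>x. \<phi> k x - u x)) \<longlonglongrightarrow> 0"
      "(\<lambda>k. n2 (lebesgue_on \<Omega>) (\<lambda>x. g k x - G x)) \<longlonglongrightarrow> 0"
    using u unfolding H10_grad_iff[OF \<Omega>] by blast
  have "\<forall>\<^sub>F k in sequentially. n2 (lebesgue_on \<Omega>) (\<lambda>x. \<phi> k x - u x) < e"
      "\<forall>\<^sub>F k in sequentially. n2 (lebesgue_on \<Omega>) (\<lambda>x. g k x - G x) < e"
    using order_tendstoD(2)[OF \<phi>(2) e] order_tendstoD(2)[OF \<phi>(3) e] by auto
  then have "\<forall>\<^sub>F k in sequentially. n2 (lebesgue_on \<Omega>) (\<lambda>x. \<phi> k x - u x) < e \<and> n2 (lebesgue_on \<Omega>) (\<lambda>x. g k x - G x) < e"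
    by eventually_elim simp
  then obtain k where "n2 (lebesgue_on \<Omega>) (\<lambda>x. \<phi> k x - u x) < e \<and> n2 (lebesgue_on \<Omega>) (\<lambda>x. g k x - G x) < e"
    by (auto simp: eventually_sequentially)
  with \<phi>(1) show ?thesis by blast
qed

text \<open>The graph of the weak gradient is closed: the k-th pair is replaced by a test function
  within 1 / (k + 1) of it. The chain rule, the absolute value and the limit of a minimizing
  sequence all enter the space through this lemma.\<close>

lemma H10_grad_limit:
  fixes u :: "('n::finite) pt \<Rightarrow> real"
  assumes \<Omega>: "\<Omega> \<in> sets lebesgue" and v: "\<forall>k. H10_grad \<Omega> (v k) (H k)"
    and m: "u \<in> borel_measurable lebesgue" "G \<in> borel_measurable lebesgue"
    and l: "l2 (lebesgue_on \<Omega>) u" "l2 (lebesgue_on \<Omega>) G"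
    and lim: "(\<lambda>k. n2 (lebesgue_on \<Omega>) (\<lambda>x. v k x - u x)) \<longlonglongrightarrow> 0"
      "(\<lambda>k. n2 (lebesgue_on \<Omega>) (\<lambda>x. H k x - G x)) \<longlonglongrightarrow> 0"
  shows "H10_grad \<Omega> u G"
proof -
  let ?M = "lebesgue_on \<Omega>"
  have "\<forall>k. \<exists>p. Cc1_grad \<Omega> (fst p) (snd p) \<and> n2 ?M (\<lambda>x. fst p x - v k x) < 1 / real (Suc k)
      \<and> n2 ?M (\<lambda>x. snd p x - H k x) < 1 / real (Suc k)"
  proof
    fix k
    show "\<exists>p. Cc1_grad \<Omega> (fst p) (snd p) \<and> n2 ?M (\<lambda>x. fst p x - v k x) < 1 / real (Suc k)
      \<and> n2 ?M (\<lambda>x. snd p x - H k x) < 1 / real (Suc k)"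
      using H10_grad_approx[OF \<Omega> v[rule_format, of k], of "1 / real (Suc k)"] by auto
  qed
  from choice[OF this] obtain p where p: "\<forall>k. Cc1_grad \<Omega> (fst (p k)) (snd (p k)) \<and> n2 ?M (\<lambda>x. fst (p k) x - v k x) < 1 / real (Suc k)
      \<and> n2 ?M (\<lambda>x. snd (p k) x - H k x) < 1 / real (Suc k)" ..
  have pc: "Cc1_grad \<Omega> (fst (p k)) (snd (p k))" and pu: "n2 ?M (\<lambda>x. fst (p k) x - v k x) < 1 / real (Suc k)"
    and pG: "n2 ?M (\<lambda>x. snd (p k) x - H k x) < 1 / real (Suc k)" for k
    using p by blast+
  note c = Cc1_grad_lebesgue_on[OF \<Omega> pc]
  note dv = H10_gradD[OF \<Omega> v[rule_format]]
  have t: "(\<lambda>k. 1 / real (Suc k)) \<longlonglongrightarrow> 0" by (rule lim_1_over_n[THEN LIMSEQ_Suc])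
  have b1: "n2 ?M (\<lambda>x. fst (p k) x - u x) \<le> 1 / real (Suc k) + n2 ?M (\<lambda>x. v k x - u x)" for k
    using n2_triangle_sub[OF c(1) dv(3) l(1), of k k] pu[of k] by linarith
  have b2: "n2 ?M (\<lambda>x. snd (p k) x - G x) \<le> 1 / real (Suc k) + n2 ?M (\<lambda>x. H k x - G x)" for k
    using n2_triangle_sub[OF c(2) dv(4) l(2), of k k] pG[of k] by linarith
  have t1: "(\<lambda>k. 1 / real (Suc k) + n2 ?M (\<lambda>x. v k x - u x)) \<longlonglongrightarrow> 0"
      "(\<lambda>k. 1 / real (Suc k) + n2 ?M (\<lambda>x. H k x - G x)) \<longlonglongrightarrow> 0"
    using tendsto_add[OF t lim(1)] tendsto_add[OF t lim(2)] by auto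
  have "(\<lambda>k. n2 ?M (\<lambda>x. fst (p k) x - u x)) \<longlonglongrightarrow> 0"
    by (rule tendsto_sandwich[OF _ _ tendsto_const t1(1)]) (use b1 in auto)
  moreover have "(\<lambda>k. n2 ?M (\<lambda>x. snd (p k) x - G x)) \<longlonglongrightarrow> 0"
    by (rule tendsto_sandwich[OF _ _ tendsto_const t1(2)]) (use b2 in auto)
  ultimately show ?thesis
    unfolding H10_grad_iff[OF \<Omega>]
    by (intro conjI exI[of _ "\<lambda>k. fst (p k)"] exI[of _ "\<lambda>k. snd (p k)"] allI m l pc)
qed

lemma Cc1_grad_H10_grad:
  fixes \<phi> :: "('n::finite) pt \<Rightarrow> real"
  assumes \<Omega>: "\<Omega> \<in> sets lebesgue" and \<phi>: "Cc1_grad \<Omega> \<phi> g"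
  shows "H10_grad \<Omega> \<phi> g"
  unfolding H10_grad_iff[OF \<Omega>]
proof (intro conjI exI[of _ "\<lambda>k. \<phi>"] exI[of _ "\<lambda>k. g"])
  show "\<phi> \<in> borel_measurable lebesgue" "g \<in> borel_measurable lebesgue"
    using Cc1_grad_measurable[OF \<phi>] by (auto intro: measurable_completion)
qed (use \<phi> Cc1_grad_lebesgue_on[OF \<Omega> \<phi>] in \<open>auto simp: n2_def\<close>)

lemma n2_lincomb_tendsto:
  assumes "\<forall>k. l2 M (f k)" "l2 M F" "(\<lambda>k. n2 M (\<lambda>x. f k x - F x)) \<longlonglongrightarrow> 0"
    and "\<forall>k. l2 M (g k)" "l2 M G" "(\<lambda>k. n2 M (\<lambda>x. g k x - G x)) \<longlonglongrightarrow> 0"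
  shows "(\<lambda>k. n2 M (\<lambda>x. (a *\<^sub>R f k x + b *\<^sub>R g k x) - (a *\<^sub>R F x + b *\<^sub>R G x))) \<longlonglongrightarrow> 0"
proof -
  have "(\<lambda>k. \<bar>a\<bar> * n2 M (\<lambda>x. f k x - F x) + \<bar>b\<bar> * n2 M (\<lambda>x. g k x - G x)) \<longlonglongrightarrow> \<bar>a\<bar> * 0 + \<bar>b\<bar> * 0"
    by (intro tendsto_intros assms)
  then have t: "(\<lambda>k. \<bar>a\<bar> * n2 M (\<lambda>x. f k x - F x) + \<bar>b\<bar> * n2 M (\<lambda>x. g k x - G x)) \<longlonglongrightarrow> 0"
    by simp
  have "n2 M (\<lambda>x. (a *\<^sub>R f k x + b *\<^sub>R g k x) - (a *\<^sub>R F x + b *\<^sub>R G x))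
      \<le> \<bar>a\<bar> * n2 M (\<lambda>x. f k x - F x) + \<bar>b\<bar> * n2 M (\<lambda>x. g k x - G x)" for k
  proof -
    have e: "(\<lambda>x. (a *\<^sub>R f k x + b *\<^sub>R g k x) - (a *\<^sub>R F x + b *\<^sub>R G x))
      = (\<lambda>x. a *\<^sub>R (f k x - F x) + b *\<^sub>R (g k x - G x))"
      by (simp add: algebra_simps)
    have "n2 M (\<lambda>x. a *\<^sub>R (f k x - F x) + b *\<^sub>R (g k x - G x))
      \<le> n2 M (\<lambda>x. a *\<^sub>R (f k x - F x)) + n2 M (\<lambda>x. b *\<^sub>R (g k x - G x))"
      by (intro n2_triangle l2_scaleR l2_diff) (use assms in auto)
    then show ?thesis unfolding e n2_scaleR .
  qed
  then show ?thesis
    by (intro tendsto_sandwich[OF _ _ tendsto_const t]) auto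
qed

lemma H10_grad_lincomb:
  fixes u v :: "('n::finite) pt \<Rightarrow> real"
  assumes \<Omega>: "\<Omega> \<in> sets lebesgue" and u: "H10_grad \<Omega> u G" and v: "H10_grad \<Omega> v H"
  shows "H10_grad \<Omega> (\<lambda>x. a * u x + b * v x) (\<lambda>x. a *\<^sub>R G x + b *\<^sub>R H x)"
proof -
  let ?M = "lebesgue_on \<Omega>"
  obtain \<phi> g where \<phi>: "\<forall>k. Cc1_grad \<Omega> (\<phi> k) (g k)"
      "(\<lambda>k. n2 ?M (\<lambda>x. \<phi> k x - u x)) \<longlonglongrightarrow> 0" "(\<lambda>k. n2 ?M (\<lambda>x. g k x - G x)) \<longlonglongrightarrow> 0"
    using u unfolding H10_grad_iff[OF \<Omega>] by blast
  obtain \<psi> h where \<psi>: "\<forall>k. Cc1_grad \<Omega> (\<psi> k) (h k)"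
      "(\<lambda>k. n2 ?M (\<lambda>x. \<psi> k x - v x)) \<longlonglongrightarrow> 0" "(\<lambda>k. n2 ?M (\<lambda>x. h k x - H x)) \<longlonglongrightarrow> 0"
    using v unfolding H10_grad_iff[OF \<Omega>] by blast
  note du = H10_gradD[OF \<Omega> u] and dv = H10_gradD[OF \<Omega> v]
  note c = Cc1_grad_lebesgue_on[OF \<Omega>]
  show ?thesis
    unfolding H10_grad_iff[OF \<Omega>]
  proof (intro conjI exI)
    show "\<forall>k. Cc1_grad \<Omega> (\<lambda>x. a * \<phi> k x + b * \<psi> k x) (\<lambda>x. a *\<^sub>R g k x + b *\<^sub>R h k x)"
      using Cc1_grad_lincomb \<phi>(1) \<psi>(1) by blast
    show "(\<lambda>k. n2 ?M (\<lambda>x. (a * \<phi> k x + b * \<psi> k x) - (a * u x + b * v x))) \<longlonglongrightarrow> 0"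
      using n2_lincomb_tendsto[OF _ du(3) \<phi>(2) _ dv(3) \<psi>(2), of a b] c(1) \<phi>(1) \<psi>(1) by auto
    show "(\<lambda>k. n2 ?M (\<lambda>x. (a *\<^sub>R g k x + b *\<^sub>R h k x) - (a *\<^sub>R G x + b *\<^sub>R H x))) \<longlonglongrightarrow> 0"
      using n2_lincomb_tendsto[OF _ du(4) \<phi>(3) _ dv(4) \<psi>(3), of a b] c(2) \<phi>(1) \<psi>(1) by auto
    show "l2 ?M (\<lambda>x. a * u x + b * v x)"
      using l2_add[OF l2_scaleR[OF du(3), of a] l2_scaleR[OF dv(3), of b]] by simp
    show "l2 ?M (\<lambda>x. a *\<^sub>R G x + b *\<^sub>R H x)"
      using l2_add[OF l2_scaleR[OF du(4), of a] l2_scaleR[OF dv(4), of b]] by simp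
  qed (use du dv in auto)
qed

text \<open>The constant sequence \<open>u\<close>, \<open>G\<close> converges in norm to
  \<open>u'\<close>, \<open>G'\<close>, so closedness of the graph applies.\<close>

lemma H10_grad_cong_AE:
  fixes u :: "('n::finite) pt \<Rightarrow> real"
  assumes \<Omega>: "\<Omega> \<in> sets lebesgue" and u: "H10_grad \<Omega> u G"
    and m: "u' \<in> borel_measurable lebesgue" "G' \<in> borel_measurable lebesgue"
    and eq: "AE x in lebesgue_on \<Omega>. u x = u' x" "AE x in lebesgue_on \<Omega>. G x = G' x"
  shows "H10_grad \<Omega> u' G'"
proof -
  let ?M = "lebesgue_on \<Omega>"
  note d = H10_gradD[OF \<Omega> u]
  have m': "u' \<in> borel_measurable ?M" "G' \<in> borel_measurable ?M"
    using m by (auto intro: measurable_restrict_space1)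
  have l: "l2 ?M u'" "l2 ?M G'"
    by (rule l2_dominated[where C = 1, OF m'(1) d(3)], use eq(1) in \<open>eventually_elim, simp\<close>)
      (rule l2_dominated[where C = 1, OF m'(2) d(4)], use eq(2) in \<open>eventually_elim, simp\<close>)
  have "n2 ?M (\<lambda>x. u x - u' x) = n2 ?M (\<lambda>x. 0::real)"
    by (rule n2_cong_AE) (use eq(1) l2_measurable[OF d(3)] m' in auto)
  moreover have "n2 ?M (\<lambda>x. G x - G' x) = n2 ?M (\<lambda>x. 0::real)"
    unfolding n2_def
    by (intro arg_cong[where f = sqrt] integral_cong_AE) (use eq(2) l2_measurable[OF d(4)] m' in auto)
  moreover have "n2 ?M (\<lambda>x. 0::real) = 0" by (simp add: n2_def)
  ultimately show ?thesis
    using H10_grad_limit[OF \<Omega> allI[OF u] m l] by simp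
qed

lemma H10_poincare:
  fixes u :: "('n::finite) pt \<Rightarrow> real"
  assumes \<Omega>: "\<Omega> \<in> sets lebesgue" and u: "H10_grad \<Omega> u G" and R: "0 \<le> R" "\<forall>x\<in>\<Omega>. norm x \<le> R"
  shows "n2 (lebesgue_on \<Omega>) u \<le> 2 * R * n2 (lebesgue_on \<Omega>) G"
proof -
  let ?M = "lebesgue_on \<Omega>"
  obtain \<phi> g where \<phi>: "\<forall>k. Cc1_grad \<Omega> (\<phi> k) (g k)"
      "(\<lambda>k. n2 ?M (\<lambda>x. \<phi> k x - u x)) \<longlonglongrightarrow> 0" "(\<lambda>k. n2 ?M (\<lambda>x. g k x - G x)) \<longlonglongrightarrow> 0"
    using u unfolding H10_grad_iff[OF \<Omega>] by blast
  note c = Cc1_grad_lebesgue_on[OF \<Omega> \<phi>(1)[rule_format]]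
  have "(\<lambda>k. n2 ?M (\<phi> k)) \<longlonglongrightarrow> n2 ?M u"
    by (rule n2_tendsto[OF _ H10_gradD(3)[OF \<Omega> u] \<phi>(2)]) (simp add: c)
  moreover have "(\<lambda>k. n2 ?M (g k)) \<longlonglongrightarrow> n2 ?M G"
    by (rule n2_tendsto[OF _ H10_gradD(4)[OF \<Omega> u] \<phi>(3)]) (simp add: c)
  then have "(\<lambda>k. 2 * R * n2 ?M (g k)) \<longlonglongrightarrow> 2 * R * n2 ?M G"
    by (intro tendsto_intros)
  ultimately show ?thesis
    by (rule LIMSEQ_le) (use Cc1_poincare[OF \<phi>(1)[rule_format] R] in \<open>auto simp: c\<close>)
qed

text \<open>Each function is replaced by a test function within 1 / (k + 1), which raises the
  gradient bound to D + 1. The two replacement errors at late indices and the Cauchy estimate take e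
  / 3 each.\<close>

lemma H10_rellich:
  fixes u :: "nat \<Rightarrow> ('n::finite) pt \<Rightarrow> real"
  assumes \<Omega>: "\<Omega> \<in> sets lebesgue" "bounded \<Omega>" and u: "\<forall>k. H10_grad \<Omega> (u k) (G k)"
    and D: "\<forall>k. n2 (lebesgue_on \<Omega>) (G k) \<le> D"
  shows "\<exists>r::nat \<Rightarrow> nat. strict_mono r \<and>
    (\<forall>e>0. \<exists>N. \<forall>k\<ge>N. \<forall>l\<ge>N. n2 (lebesgue_on \<Omega>) (\<lambda>x. u (r k) x - u (r l) x) < e)"
proof -
  let ?M = "lebesgue_on \<Omega>"
  have "\<forall>k. \<exists>p. Cc1_grad \<Omega> (fst p) (snd p) \<and> n2 ?M (\<lambda>x. fst p x - u k x) < 1 / real (Suc k)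
      \<and> n2 ?M (\<lambda>x. snd p x - G k x) < 1 / real (Suc k)"
  proof
    fix k
    show "\<exists>p. Cc1_grad \<Omega> (fst p) (snd p) \<and> n2 ?M (\<lambda>x. fst p x - u k x) < 1 / real (Suc k)
      \<and> n2 ?M (\<lambda>x. snd p x - G k x) < 1 / real (Suc k)"
      using H10_grad_approx[OF \<Omega>(1) u[rule_format, of k], of "1 / real (Suc k)"] by auto
  qed
  from choice[OF this] obtain p where p: "\<forall>k. Cc1_grad \<Omega> (fst (p k)) (snd (p k)) \<and> n2 ?M (\<lambda>x. fst (p k) x - u k x) < 1 / real (Suc k)
      \<and> n2 ?M (\<lambda>x. snd (p k) x - G k x) < 1 / real (Suc k)" ..
  have pc: "Cc1_grad \<Omega> (fst (p k)) (snd (p k))" for k using p by blast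
  note c = Cc1_grad_lebesgue_on[OF \<Omega>(1) pc]
  have ul: "l2 ?M (u k)" "l2 ?M (G k)" for k using H10_gradD[OF \<Omega>(1) u[rule_format]] by auto
  have bd: "n2 lborel (snd (p k)) \<le> D + 1" for k
  proof -
    have "n2 ?M (snd (p k)) \<le> n2 ?M (G k) + n2 ?M (\<lambda>x. snd (p k) x - G k x)"
      by (rule n2_le_add[OF c(2) ul(2)])
    also have "\<dots> \<le> D + 1"
    proof (rule add_mono)
      have "n2 ?M (\<lambda>x. snd (p k) x - G k x) < 1 / real (Suc k)" using p by blast
      also have "\<dots> \<le> 1" by simp
      finally show "n2 ?M (\<lambda>x. snd (p k) x - G k x) \<le> 1" by simp
    qed (use D in blast)
    finally show ?thesis by (simp add: c)
  qed
  obtain r :: "nat \<Rightarrow> nat" where r: "strict_mono r"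
    "\<forall>e>0. \<exists>N. \<forall>k\<ge>N. \<forall>l\<ge>N. n2 lborel (\<lambda>x. fst (p (r k)) x - fst (p (r l)) x) < e"
    by (rule Cc1_rellich[OF \<Omega>(2), of "\<lambda>k. fst (p k)" "\<lambda>k. snd (p k)" "D + 1"]) (use pc bd in auto)
  have "\<exists>N. \<forall>k\<ge>N. \<forall>l\<ge>N. n2 ?M (\<lambda>x. u (r k) x - u (r l) x) < e" if "0 < e" for e
  proof -
    obtain N1 where N1: "\<forall>k\<ge>N1. \<forall>l\<ge>N1. n2 lborel (\<lambda>x. fst (p (r k)) x - fst (p (r l)) x) < e / 3"
      using r(2) \<open>0 < e\<close> by (metis divide_pos_pos zero_less_numeral)
    obtain N2 where N2: "1 / real (Suc N2) < e / 3"
      using \<open>0 < e\<close> nat_approx_posE[of "e / 3"] by auto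
    have small: "n2 ?M (\<lambda>x. fst (p (r k)) x - u (r k) x) < e / 3" if "k \<ge> N2" for k
    proof -
      have "n2 ?M (\<lambda>x. fst (p (r k)) x - u (r k) x) < 1 / real (Suc (r k))" using p by blast
      also have "\<dots> \<le> 1 / real (Suc N2)"
        using seq_suble[OF r(1), of k] that by (intro divide_left_mono) auto
      finally show ?thesis using N2 by simp
    qed
    have "n2 ?M (\<lambda>x. u (r k) x - u (r l) x) < e" if kl: "k \<ge> max N1 N2" "l \<ge> max N1 N2" for k l
    proof -
      have w: "Cc1_grad \<Omega> (\<lambda>x. fst (p (r k)) x - fst (p (r l)) x) (\<lambda>x. snd (p (r k)) x - snd (p (r l)) x)"
        using Cc1_grad_lincomb[OF pc pc, of 1 "r k" "-1" "r l"] by simp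
      have "n2 ?M (\<lambda>x. u (r k) x - u (r l) x) \<le> n2 ?M (\<lambda>x. u (r k) x - fst (p (r k)) x) + n2 ?M (\<lambda>x. fst (p (r k)) x - u (r l) x)"
        by (intro n2_triangle_sub ul c)
      also have "n2 ?M (\<lambda>x. fst (p (r k)) x - u (r l) x) \<le> n2 ?M (\<lambda>x. fst (p (r k)) x - fst (p (r l)) x) + n2 ?M (\<lambda>x. fst (p (r l)) x - u (r l) x)"
        by (intro n2_triangle_sub ul c)
      also have "n2 ?M (\<lambda>x. fst (p (r k)) x - fst (p (r l)) x) < e / 3"
        using N1 kl Cc1_grad_lebesgue_on(3)[OF \<Omega>(1) w] by simp
      also have "n2 ?M (\<lambda>x. u (r k) x - fst (p (r k)) x) < e / 3"
        using small kl n2_minus_commute[of ?M "u (r k)"] by simp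
      also have "n2 ?M (\<lambda>x. fst (p (r l)) x - u (r l) x) < e / 3"
        using small kl by simp
      finally show ?thesis by simp
    qed
    then show ?thesis by blast
  qed
  with r(1) show ?thesis by blast
qed

section \<open>Uniqueness of the weak gradient and the chain rule\<close>

lemma n2_dominated_tendsto:
  fixes f :: "nat \<Rightarrow> 'a \<Rightarrow> 'b::euclidean_space" and G :: "'a \<Rightarrow> 'c::euclidean_space"
  assumes f: "\<forall>k. f k \<in> borel_measurable M" and G: "l2 M G"
    and b: "\<forall>k. AE x in M. norm (f k x) \<le> C * norm (G x)"
    and lim: "AE x in M. (\<lambda>k. f k x) \<longlonglongrightarrow> 0"
  shows "(\<lambda>k. n2 M (f k)) \<longlonglongrightarrow> 0"
proof -
  have [measurable]: "f k \<in> borel_measurable M" for k using f by blast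
  have "(\<lambda>k. \<integral>x. (norm (f k x))\<^sup>2 \<partial>M) \<longlonglongrightarrow> (\<integral>x. 0 \<partial>M)"
  proof (rule integral_dominated_convergence[where w = "\<lambda>x. C\<^sup>2 * (norm (G x))\<^sup>2"])
    show "integrable M (\<lambda>x. C\<^sup>2 * (norm (G x))\<^sup>2)"
      using l2_integrable_sq[OF G] by simp
    show "AE x in M. (\<lambda>k. (norm (f k x))\<^sup>2) \<longlonglongrightarrow> 0"
      using lim
    proof eventually_elim
      case (elim x)
      have "(\<lambda>k. (norm (f k x))\<^sup>2) \<longlonglongrightarrow> (norm (0::'b))\<^sup>2"
        by (intro tendsto_intros elim)
      then show ?case by simp
    qed
    show "AE x in M. norm ((norm (f k x))\<^sup>2) \<le> C\<^sup>2 * (norm (G x))\<^sup>2" for k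
      using b[rule_format, of k]
    proof eventually_elim
      case (elim x)
      then have "(norm (f k x))\<^sup>2 \<le> (C * norm (G x))\<^sup>2" by (intro power_mono) auto
      then show ?case by (simp add: power_mult_distrib)
    qed
  qed measurable
  then have "(\<lambda>k. \<integral>x. (norm (f k x))\<^sup>2 \<partial>M) \<longlonglongrightarrow> 0" by simp
  then have "(\<lambda>k. n2 M (f k)) \<longlonglongrightarrow> sqrt 0" unfolding n2_def by (rule tendsto_real_sqrt)
  then show ?thesis by simp
qed

lemma n2_squeeze: "(\<And>k. n2 M (f k) \<le> c k) \<Longrightarrow> c \<longlonglongrightarrow> 0 \<Longrightarrow> (\<lambda>k. n2 M (f k)) \<longlonglongrightarrow> 0"
  by (rule tendsto_sandwich[OF _ _ tendsto_const]) auto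

lemma real_polynomial_function_gradient:
  fixes P :: "'a::euclidean_space \<Rightarrow> real"
  assumes "real_polynomial_function P"
  shows "\<exists>Q. continuous_on UNIV Q \<and> (\<forall>x. (P has_derivative (\<lambda>h. Q x \<bullet> h)) (at x))"
  using assms
proof induction
  case (linear f)
  \<comment> \<open>The adjoint of a linear functional, applied to 1, is its Riesz
    representative.\<close>
  have "f h = adjoint f 1 \<bullet> h" for h
    using adjoint_works[OF bounded_linear.linear[OF linear], of h 1] by (simp add: inner_commute)
  then have "f = (\<lambda>h. adjoint f 1 \<bullet> h)" by blast
  then have "\<forall>x. (f has_derivative (\<lambda>h. adjoint f 1 \<bullet> h)) (at x)"
    using bounded_linear_imp_has_derivative[OF linear] by metis
  then show ?case
    by (intro exI[of _ "\<lambda>x. adjoint f 1"] conjI continuous_on_const)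
next
  case (const c)
  show ?case by (intro exI[of _ "\<lambda>x. 0"]) auto
next
  case (add f g)
  then obtain Q R where "continuous_on UNIV Q" "\<forall>x. (f has_derivative (\<lambda>h. Q x \<bullet> h)) (at x)"
    "continuous_on UNIV R" "\<forall>x. (g has_derivative (\<lambda>h. R x \<bullet> h)) (at x)" by blast
  then show ?case
    by (intro exI[of _ "\<lambda>x. Q x + R x"]) (auto intro!: continuous_intros derivative_eq_intros simp: inner_simps)
next
  case (mult f g)
  then obtain Q R where Q: "continuous_on UNIV Q" "\<forall>x. (f has_derivative (\<lambda>h. Q x \<bullet> h)) (at x)"
    and R: "continuous_on UNIV R" "\<forall>x. (g has_derivative (\<lambda>h. R x \<bullet> h)) (at x)" by blast
  have c: "continuous_on UNIV f" "continuous_on UNIV g"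
    using Q(2) R(2) by (auto intro!: continuous_at_imp_continuous_on has_derivative_continuous)
  show ?case
  proof (intro exI[of _ "\<lambda>x. g x *\<^sub>R Q x + f x *\<^sub>R R x"] conjI allI)
    show "continuous_on UNIV (\<lambda>x. g x *\<^sub>R Q x + f x *\<^sub>R R x)"
      by (intro continuous_intros c Q R)
    show "((\<lambda>x. f x * g x) has_derivative (\<lambda>h. (g x *\<^sub>R Q x + f x *\<^sub>R R x) \<bullet> h)) (at x)" for x
      by (rule has_derivative_eq_rhs[OF has_derivative_mult[OF Q(2)[rule_format] R(2)[rule_format]]])
        (auto simp: inner_simps algebra_simps)
  qed
qed

lemma finite_measure_lebesgue_on_bounded:
  fixes \<Omega> :: "'a::euclidean_space set"
  assumes "\<Omega> \<in> sets lebesgue" "bounded \<Omega>"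
  shows "finite_measure (lebesgue_on \<Omega>)"
  by (intro finite_measure_lebesgue_on bounded_set_imp_lmeasurable assms)

lemma continuous_l2_lebesgue_on:
  fixes f :: "'a::euclidean_space \<Rightarrow> 'b::euclidean_space"
  assumes \<Omega>: "\<Omega> \<in> sets lebesgue" "bounded \<Omega>" and f: "continuous_on UNIV f"
  shows "l2 (lebesgue_on \<Omega>) f"
proof -
  interpret finite_measure "lebesgue_on \<Omega>"
    by (rule finite_measure_lebesgue_on_bounded[OF \<Omega>])
  have m: "f \<in> borel_measurable (lebesgue_on \<Omega>)"
    using borel_measurable_continuous_onI[OF f]
    by (intro measurable_restrict_space1) (simp add: measurable_completion)
  have "compact (closure \<Omega>)" using \<Omega> by simp
  then have "bounded (f ` closure \<Omega>)"
    using f by (auto intro!: compact_imp_bounded compact_continuous_image intro: continuous_on_subset)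
  then obtain B where B: "\<forall>x\<in>closure \<Omega>. norm (f x) \<le> B" by (auto simp: bounded_iff)
  have one: "l2 (lebesgue_on \<Omega>) (\<lambda>x. 1::real)" by (simp add: l2_def)
  have "norm (f x) \<le> B * norm (1::real)" if "x \<in> \<Omega>" for x
    using B closure_subset[of \<Omega>] that by auto
  then show ?thesis
    by (intro l2_dominated[OF m one] AE_I2) (use \<Omega> in \<open>auto simp: space_restrict_space\<close>)
qed

lemma l2_inner_const:
  fixes G :: "'a \<Rightarrow> 'b::euclidean_space"
  assumes "l2 M G" shows "l2 M (\<lambda>x. G x \<bullet> b)"
proof (rule l2_dominated[OF _ assms])
  show "(\<lambda>x. G x \<bullet> b) \<in> borel_measurable M" using l2_measurable[OF assms] by measurable
  show "AE x in M. norm (G x \<bullet> b) \<le> norm b * norm (G x)"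
    by (simp add: mult.commute[of "norm b"] Cauchy_Schwarz_ineq2)
qed

text \<open>Closability of the gradient: a limit of gradients of functions tending to zero is orthogonal to all
  polynomials by partial integration, hence to the gradients by Stone--Weierstrass, hence to itself.\<close>

lemma H10_grad_zero_unique:
  fixes G :: "('n::finite) pt \<Rightarrow> 'n pt"
  assumes \<Omega>: "\<Omega> \<in> sets lebesgue" "bounded \<Omega>" and u: "H10_grad \<Omega> (\<lambda>x. 0) G"
  shows "AE x in lebesgue_on \<Omega>. G x = 0"
proof -
  let ?M = "lebesgue_on \<Omega>"
  obtain \<phi> g where \<phi>: "\<forall>k. Cc1_grad \<Omega> (\<phi> k) (g k)"
      "(\<lambda>k. n2 ?M (\<lambda>x. \<phi> k x - 0)) \<longlonglongrightarrow> 0" "(\<lambda>k. n2 ?M (\<lambda>x. g k x - G x)) \<longlonglongrightarrow> 0"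
    using u unfolding H10_grad_iff[OF \<Omega>(1)] by blast
  have l: "l2 ?M G" using H10_gradD[OF \<Omega>(1) u] by auto
  note c = Cc1_grad_lebesgue_on[OF \<Omega>(1) \<phi>(1)[rule_format]]
  have zero2: "l2 ?M (\<lambda>x. 0::real)" by (simp add: l2_def)
  \<comment> \<open>Partial integration moves the derivative onto \<open>P\<close>. Both sides
    converge, and the side with the functions themselves converges to 0 because they do.\<close>
  have orth: "(\<integral>x. P x * (G x \<bullet> z) \<partial>?M) = 0" if "real_polynomial_function P" for P z
  proof -
    obtain Q where Q: "continuous_on UNIV Q" "\<forall>x. (P has_derivative (\<lambda>h. Q x \<bullet> h)) (at x)"
      using real_polynomial_function_gradient[OF \<open>real_polynomial_function P\<close>] by blast
    have P: "continuous_on UNIV P"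
      using Q(2) by (auto intro!: continuous_at_imp_continuous_on has_derivative_continuous)
    have Pz: "l2 ?M (\<lambda>x. P x *\<^sub>R z)" "l2 ?M (\<lambda>x. Q x \<bullet> z)"
      by (intro continuous_l2_lebesgue_on \<Omega> continuous_intros P Q)+
    have "(\<lambda>k. \<integral>x. g k x \<bullet> (P x *\<^sub>R z) \<partial>?M) \<longlonglongrightarrow> (\<integral>x. G x \<bullet> (P x *\<^sub>R z) \<partial>?M)"
      by (rule l2_inner_tendsto) (use c l \<phi>(3) Pz in \<open>auto simp: n2_def\<close>)
    moreover have "(\<integral>x. g k x \<bullet> (P x *\<^sub>R z) \<partial>?M) = - (\<integral>x. \<phi> k x \<bullet> (Q x \<bullet> z) \<partial>?M)" for k
    proof -
      note m = Cc1_grad_measurable[OF \<phi>(1)[rule_format, of k]] borel_measurable_continuous_onI[OF P]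
        borel_measurable_continuous_onI[OF Q(1)]
      have "(\<integral>x. P x * (g k x \<bullet> z) \<partial>?M) = (\<integral>x. P x * (g k x \<bullet> z) \<partial>lborel)"
        using m Cc1_grad_zero_outside[OF \<phi>(1)[rule_format, of k]] by (intro lebesgue_on_borel_eq \<Omega>) auto
      moreover have "(\<integral>x. \<phi> k x * (Q x \<bullet> z) \<partial>?M) = (\<integral>x. \<phi> k x * (Q x \<bullet> z) \<partial>lborel)"
        using m Cc1_grad_zero_outside[OF \<phi>(1)[rule_format, of k]] by (intro lebesgue_on_borel_eq \<Omega>) auto
      ultimately show ?thesis
        using integral_by_parts[OF \<phi>(1)[rule_format, of k] Q(2,1), of z] by simp
    qed
    moreover have "(\<lambda>k. \<integral>x. \<phi> k x \<bullet> (Q x \<bullet> z) \<partial>?M) \<longlonglongrightarrow> (\<integral>x. 0 \<bullet> (Q x \<bullet> z) \<partial>?M)"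
      by (rule l2_inner_tendsto) (use c \<phi>(2) Pz zero2 in \<open>auto simp: n2_def\<close>)
    then have "(\<lambda>k. - (\<integral>x. \<phi> k x \<bullet> (Q x \<bullet> z) \<partial>?M)) \<longlonglongrightarrow> - 0"
      by (intro tendsto_minus) simp
    ultimately have "(\<integral>x. G x \<bullet> (P x *\<^sub>R z) \<partial>?M) = - 0"
      by (simp only: LIMSEQ_unique)
    then show ?thesis by simp
  qed
  \<comment> \<open>Polynomials are uniformly dense on the compact closure of \<Omega>, and
    \<open>G x \<bullet> z\<close> is integrable over \<Omega>.\<close>
  have comp: "(\<integral>x. f x * (G x \<bullet> z) \<partial>?M) = 0" if f: "continuous_on UNIV f" for f z
  proof -
    have Gi: "integrable ?M (\<lambda>x. norm (G x \<bullet> z))"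
      using l2_norm_mult_integrable[OF l2_inner_const[OF l, of z] continuous_l2_lebesgue_on[OF \<Omega>, of "\<lambda>x. 1::real"]]
      by simp
    define I where "I = (\<integral>x. norm (G x \<bullet> z) \<partial>?M)"
    have I0: "0 \<le> I" by (simp add: I_def)
    have small: "\<bar>\<integral>x. f x * (G x \<bullet> z) \<partial>?M\<bar> \<le> e * I" if e: "0 < e" for e
    proof -
      obtain P where P: "real_polynomial_function P" "\<And>x. x \<in> closure \<Omega> \<Longrightarrow> \<bar>f x - P x\<bar> < e"
        using Stone_Weierstrass_real_polynomial_function[of "closure \<Omega>" f e] \<Omega>(2) e
          continuous_on_subset[OF f] by (metis compact_closure subset_UNIV)
      have Pc: "continuous_on UNIV P"
        by (rule continuous_on_polymonial_function) (use P(1) in \<open>simp add: real_polynomial_function_eq\<close>)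
      have i: "integrable ?M (\<lambda>x. f x * (G x \<bullet> z))" "integrable ?M (\<lambda>x. P x * (G x \<bullet> z))"
        using l2_inner_integrable[OF continuous_l2_lebesgue_on[OF \<Omega> f] l2_inner_const[OF l, of z]]
          l2_inner_integrable[OF continuous_l2_lebesgue_on[OF \<Omega> Pc] l2_inner_const[OF l, of z]] by auto
      have "(\<integral>x. f x * (G x \<bullet> z) \<partial>?M) = (\<integral>x. (f x - P x) * (G x \<bullet> z) \<partial>?M)"
        using i orth[OF P(1)] by (simp add: left_diff_distrib)
      also have "\<bar>\<dots>\<bar> \<le> (\<integral>x. e * norm (G x \<bullet> z) \<partial>?M)"
      proof (rule order_trans[OF integral_abs_bound], rule integral_mono)
        show "integrable ?M (\<lambda>x. \<bar>(f x - P x) * (G x \<bullet> z)\<bar>)"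
          using i by (auto simp: left_diff_distrib)
        fix x assume "x \<in> space ?M"
        then have "x \<in> closure \<Omega>" using \<Omega> closure_subset by (auto simp: space_restrict_space)
        then have "\<bar>f x - P x\<bar> \<le> e" using P(2) by (simp add: less_imp_le)
        then show "\<bar>(f x - P x) * (G x \<bullet> z)\<bar> \<le> e * norm (G x \<bullet> z)"
          by (simp add: abs_mult mult_right_mono)
      qed (use Gi in auto)
      finally show ?thesis by (simp add: I_def)
    qed
    show ?thesis
    proof (rule ccontr)
      assume "(\<integral>x. f x * (G x \<bullet> z) \<partial>?M) \<noteq> 0"
      then have p: "0 < \<bar>\<integral>x. f x * (G x \<bullet> z) \<partial>?M\<bar>" by simp
      define A where "A = \<bar>\<integral>x. f x * (G x \<bullet> z) \<partial>?M\<bar>"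
      \<comment> \<open>This choice of the approximation error leaves at most A / 2; the added 1
        guards against I = 0.\<close>
      have "A \<le> (A / (2 * (I + 1))) * I"
        unfolding A_def by (rule small) (use p I0 in \<open>auto intro!: divide_pos_pos\<close>)
      also have "\<dots> \<le> A / 2"
        using I0 p by (simp add: A_def field_simps)
      finally show False using p by (simp add: A_def)
    qed
  qed
  \<comment> \<open>The coordinates of \<open>g k\<close> are continuous, so \<open>comp\<close>
    applies to each of them; letting \<open>k\<close> grow then turns \<open>g k\<close> into
    \<open>G\<close>.\<close>
  have "(\<integral>x. g k x \<bullet> G x \<partial>?M) = 0" for k
  proof -
    have gb: "continuous_on UNIV (\<lambda>x. g k x \<bullet> b)" for b
      by (intro continuous_intros Cc1_grad_continuous_grad[OF \<phi>(1)[rule_format]])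
    have "(\<integral>x. g k x \<bullet> G x \<partial>?M) = (\<integral>x. (\<Sum>b\<in>Basis. (g k x \<bullet> b) * (G x \<bullet> b)) \<partial>?M)"
      by (subst euclidean_inner) simp
    also have "\<dots> = (\<Sum>b\<in>Basis. \<integral>x. (g k x \<bullet> b) * (G x \<bullet> b) \<partial>?M)"
      using l2_inner_integrable[OF continuous_l2_lebesgue_on[OF \<Omega> gb] l2_inner_const[OF l]]
      by (intro Bochner_Integration.integral_sum) auto
    also have "\<dots> = 0" using comp[OF gb] by simp
    finally show ?thesis .
  qed
  moreover have "(\<lambda>k. \<integral>x. g k x \<bullet> G x \<partial>?M) \<longlonglongrightarrow> (\<integral>x. G x \<bullet> G x \<partial>?M)"
    by (rule l2_inner_tendsto) (use c l \<phi>(3) in \<open>auto simp: n2_def\<close>)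
  ultimately have "(\<integral>x. G x \<bullet> G x \<partial>?M) = 0" by (simp add: LIMSEQ_const_iff)
  then have "n2 ?M G = 0" by (simp add: n2_def dot_square_norm)
  with l show ?thesis by (rule n2_eq_0_AE)
qed

lemma H10_grad_unique:
  fixes u :: "('n::finite) pt \<Rightarrow> real"
  assumes \<Omega>: "\<Omega> \<in> sets lebesgue" "bounded \<Omega>" and u: "H10_grad \<Omega> u G" "H10_grad \<Omega> u' G'"
    and eq: "AE x in lebesgue_on \<Omega>. u x = u' x"
  shows "AE x in lebesgue_on \<Omega>. G x = G' x"
proof -
  note l = H10_grad_lincomb[OF \<Omega>(1) u, of 1 "-1"]
  have "H10_grad \<Omega> (\<lambda>x. 0) (\<lambda>x. 1 *\<^sub>R G x + (-1) *\<^sub>R G' x)"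
    by (rule H10_grad_cong_AE[OF \<Omega>(1) l]) (use H10_gradD[OF \<Omega>(1) u(1)] H10_gradD[OF \<Omega>(1) u(2)] eq in auto)
  from H10_grad_zero_unique[OF \<Omega> this] show ?thesis by simp
qed

text \<open>The difference of the gradients splits as f'(\<phi>) (g - G) + (f'(\<phi>) - f'(u)) G.
  The bound \<open>L\<close> controls the first term. As f' is merely continuous, the second tends
  to 0 by dominated convergence with majorant 2 L |G|, along a subsequence that converges
  a.e.\<close>

lemma H10_grad_compose:
  fixes u :: "('n::finite) pt \<Rightarrow> real"
  assumes \<Omega>: "\<Omega> \<in> sets lebesgue" and u: "H10_grad \<Omega> u G"
    and f: "\<forall>s. (f has_real_derivative f' s) (at s)" "continuous_on UNIV f'" "f 0 = 0"
    and L: "\<forall>s. \<bar>f' s\<bar> \<le> L"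
  shows "H10_grad \<Omega> (\<lambda>x. f (u x)) (\<lambda>x. f' (u x) *\<^sub>R G x)"
proof -
  let ?M = "lebesgue_on \<Omega>"
  obtain \<phi> g where \<phi>: "\<forall>k. Cc1_grad \<Omega> (\<phi> k) (g k)"
      "(\<lambda>k. n2 ?M (\<lambda>x. \<phi> k x - u x)) \<longlonglongrightarrow> 0" "(\<lambda>k. n2 ?M (\<lambda>x. g k x - G x)) \<longlonglongrightarrow> 0"
    using u unfolding H10_grad_iff[OF \<Omega>] by blast
  note c = Cc1_grad_lebesgue_on[OF \<Omega> \<phi>(1)[rule_format]]
  note d = H10_gradD[OF \<Omega> u]
  have L0: "0 \<le> L" using L abs_ge_zero order_trans by blast
  obtain r :: "nat \<Rightarrow> nat" where r: "strict_mono r" "AE x in ?M. (\<lambda>k. \<phi> (r k) x) \<longlonglongrightarrow> u x"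
    by (rule l2_AE_subseq[OF _ d(3) \<phi>(2)]) (use c in auto)
  have fc: "continuous_on UNIV f"
    using f(1) by (auto intro!: continuous_at_imp_continuous_on DERIV_isCont)
  have lip: "\<bar>f s - f t\<bar> \<le> L * \<bar>s - t\<bar>" for s t
  proof -
    have "norm (f s - f t) \<le> L * norm (s - t)"
      by (rule field_differentiable_bound[of UNIV f f']) (use f L in auto)
    then show ?thesis by simp
  qed
  have fm: "f \<in> borel_measurable borel" "f' \<in> borel_measurable borel"
    using fc f(2) by (auto intro: borel_measurable_continuous_onI)
  note [measurable] = fm d(1,2)
  have um: "(\<lambda>x. f (u x)) \<in> borel_measurable lebesgue" "(\<lambda>x. f' (u x) *\<^sub>R G x) \<in> borel_measurable lebesgue"
    by measurable
  have um': "(\<lambda>x. f (u x)) \<in> borel_measurable ?M" "(\<lambda>x. f' (u x) *\<^sub>R G x) \<in> borel_measurable ?M"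
    using um by (auto intro: measurable_restrict_space1)
  have ul: "l2 ?M (\<lambda>x. f (u x))" "l2 ?M (\<lambda>x. f' (u x) *\<^sub>R G x)"
    by (rule l2_dominated[OF um'(1) d(3), of L], use lip[of _ 0] f(3) in auto)
      (rule l2_dominated[OF um'(2) d(4), of L], use L in \<open>auto intro!: mult_right_mono\<close>)
  have rl: "LIM k sequentially. r k :> sequentially"
    using r(1) by (rule filterlim_subseq)
  have lim1: "(\<lambda>k. n2 ?M (\<lambda>x. \<phi> (r k) x - u x)) \<longlonglongrightarrow> 0"
    using filterlim_compose[OF \<phi>(2) rl] .
  have lim2: "(\<lambda>k. n2 ?M (\<lambda>x. g (r k) x - G x)) \<longlonglongrightarrow> 0"
    using filterlim_compose[OF \<phi>(3) rl] .
  have \<phi>m: "\<phi> k \<in> borel_measurable ?M" "g k \<in> borel_measurable ?M" for k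
    using c l2_measurable by blast+
  note [measurable] = \<phi>m l2_measurable[OF d(3)] l2_measurable[OF d(4)]
  show ?thesis
  proof (rule H10_grad_limit[OF \<Omega> _ um ul])
    show "\<forall>k. H10_grad \<Omega> (\<lambda>x. f (\<phi> (r k) x)) (\<lambda>x. f' (\<phi> (r k) x) *\<^sub>R g (r k) x)"
      using Cc1_grad_H10_grad[OF \<Omega> Cc1_grad_compose[OF \<phi>(1)[rule_format] f]] by blast
    have "n2 ?M (\<lambda>x. f (\<phi> (r k) x) - f (u x)) \<le> L * n2 ?M (\<lambda>x. \<phi> (r k) x - u x)" for k
      by (rule n2_le[OF l2_diff[OF c(1) d(3)]]) (use lip L0 in auto)
    moreover have "(\<lambda>k. L * n2 ?M (\<lambda>x. \<phi> (r k) x - u x)) \<longlonglongrightarrow> 0"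
      using tendsto_mult[OF tendsto_const lim1, of L] by simp
    ultimately show "(\<lambda>k. n2 ?M (\<lambda>x. f (\<phi> (r k) x) - f (u x))) \<longlonglongrightarrow> 0"
      by (rule n2_squeeze)
    define w where "w k x = (f' (\<phi> (r k) x) - f' (u x)) *\<^sub>R G x" for k x
    have wm: "w k \<in> borel_measurable ?M" for k unfolding w_def by measurable
    have wb: "norm (w k x) \<le> 2 * L * norm (G x)" for k x
    proof -
      have "\<bar>f' (\<phi> (r k) x) - f' (u x)\<bar> \<le> 2 * L"
        using L[rule_format, of "\<phi> (r k) x"] L[rule_format, of "u x"] by linarith
      then show ?thesis by (simp add: w_def mult_right_mono)
    qed
    have wl: "l2 ?M (w k)" for k
      by (rule l2_dominated[OF wm d(4), of _ "2 * L"]) (use wb in auto)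
    have w0: "(\<lambda>k. n2 ?M (w k)) \<longlonglongrightarrow> 0"
    proof (rule n2_dominated_tendsto[OF _ d(4), of w "2 * L"])
      show "AE x in ?M. (\<lambda>k. w k x) \<longlonglongrightarrow> 0"
        using r(2)
      proof eventually_elim
        case (elim x)
        have "isCont f' (u x)" using f(2) by (simp add: continuous_on_eq_continuous_at)
        then have "(\<lambda>k. f' (\<phi> (r k) x)) \<longlonglongrightarrow> f' (u x)" using elim by (rule isCont_tendsto_compose)
        then have "(\<lambda>k. w k x) \<longlonglongrightarrow> (f' (u x) - f' (u x)) *\<^sub>R G x"
          unfolding w_def by (intro tendsto_intros)
        then show ?case by simp
      qed
    qed (use wm wb in auto)
    have "n2 ?M (\<lambda>x. f' (\<phi> (r k) x) *\<^sub>R g (r k) x - f' (u x) *\<^sub>R G x)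
        \<le> L * n2 ?M (\<lambda>x. g (r k) x - G x) + n2 ?M (w k)" for k
    proof -
      have a: "norm (f' (\<phi> (r k) x) *\<^sub>R (g (r k) x - G x)) \<le> L * norm (g (r k) x - G x)" for x
        using L by (auto intro: mult_right_mono)
      have m: "(\<lambda>x. f' (\<phi> (r k) x) *\<^sub>R (g (r k) x - G x)) \<in> borel_measurable ?M" by measurable
      have "n2 ?M (\<lambda>x. f' (\<phi> (r k) x) *\<^sub>R g (r k) x - f' (u x) *\<^sub>R G x)
        = n2 ?M (\<lambda>x. f' (\<phi> (r k) x) *\<^sub>R (g (r k) x - G x) + w k x)"
        by (simp add: w_def algebra_simps)
      also have "\<dots> \<le> n2 ?M (\<lambda>x. f' (\<phi> (r k) x) *\<^sub>R (g (r k) x - G x)) + n2 ?M (w k)"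
        by (intro n2_triangle wl l2_dominated[OF m l2_diff[OF c(2) d(4)], where C = L]) (use a in auto)
      also have "n2 ?M (\<lambda>x. f' (\<phi> (r k) x) *\<^sub>R (g (r k) x - G x)) \<le> L * n2 ?M (\<lambda>x. g (r k) x - G x)"
        by (rule n2_le[OF l2_diff[OF c(2) d(4)]]) (use a L0 in auto)
      finally show ?thesis by simp
    qed
    moreover have "(\<lambda>k. L * n2 ?M (\<lambda>x. g (r k) x - G x) + n2 ?M (w k)) \<longlonglongrightarrow> 0"
      using tendsto_add[OF tendsto_mult[OF tendsto_const lim2, of L] w0] by simp
    ultimately show "(\<lambda>k. n2 ?M (\<lambda>x. f' (\<phi> (r k) x) *\<^sub>R g (r k) x - f' (u x) *\<^sub>R G x)) \<longlonglongrightarrow> 0"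
      by (rule n2_squeeze)
  qed
qed

text \<open>\<open>\<bar>u\<bar>\<close> is approximated by \<open>sqrt (u\<^sup>2 + \<epsilon>\<^sup>2) - \<epsilon>\<close>. Since \<open>sgn 0 = 0\<close>, the gradient may be taken to vanish where
  \<open>u\<close> does.\<close>

lemma H10_grad_abs:
  fixes u :: "('n::finite) pt \<Rightarrow> real"
  assumes \<Omega>: "\<Omega> \<in> sets lebesgue" and u: "H10_grad \<Omega> u G"
  shows "H10_grad \<Omega> (\<lambda>x. \<bar>u x\<bar>) (\<lambda>x. sgn (u x) *\<^sub>R G x)"
proof -
  let ?M = "lebesgue_on \<Omega>"
  note d = H10_gradD[OF \<Omega> u]
  define e where "e k = 1 / real (Suc k)" for k
  have e: "0 < e k" for k by (simp add: e_def)
  have e0: "e \<longlonglongrightarrow> 0" unfolding e_def by (rule lim_1_over_n[THEN LIMSEQ_Suc])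
  \<comment> \<open>Subtracting \<open>e k\<close> gives f(0) = 0, which the chain rule requires.
    The derivatives are bounded by 1 uniformly in \<open>k\<close>, as dominated convergence
    requires.\<close>
  define f where "f k s = sqrt (s\<^sup>2 + (e k)\<^sup>2) - e k" for k s
  define f' where "f' k s = s / sqrt (s\<^sup>2 + (e k)\<^sup>2)" for k s
  have pos: "0 < s\<^sup>2 + (e k)\<^sup>2" for k s using e[of k] by (simp add: add_nonneg_pos)
  have der: "(f k has_real_derivative f' k s) (at s)" for k s
    unfolding f_def f'_def using pos[of s k]
    by (auto intro!: derivative_eq_intros simp: field_simps)
  have f'c: "continuous_on UNIV (f' k)" for k
    unfolding f'_def using pos by (intro continuous_intros) (metis less_irrefl real_sqrt_eq_zero_cancel_iff)
  have f0: "f k 0 = 0" for k using e[of k] by (simp add: f_def)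
  have f'1: "\<bar>f' k s\<bar> \<le> 1" for k s
  proof -
    have "\<bar>s\<bar> \<le> sqrt (s\<^sup>2 + (e k)\<^sup>2)" by (rule real_le_rsqrt) simp
    then show ?thesis using pos[of s k] by (simp add: f'_def)
  qed
  have fb: "0 \<le> f k s" "f k s \<le> \<bar>s\<bar>" for k s
  proof -
    show "0 \<le> f k s" using e[of k] by (simp add: f_def real_le_rsqrt)
    show "f k s \<le> \<bar>s\<bar>"
    proof -
      have "sqrt (s\<^sup>2 + (e k)\<^sup>2) \<le> \<bar>s\<bar> + e k"
        using e[of k] by (intro real_le_lsqrt) (auto simp: power2_sum)
      then show ?thesis by (simp add: f_def)
    qed
  qed
  have [measurable]: "(sgn :: real \<Rightarrow> real) \<in> borel_measurable borel"
    unfolding sgn_if by measurable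
  have [measurable]: "f k \<in> borel_measurable borel" "f' k \<in> borel_measurable borel" for k
    unfolding f_def f'_def by measurable
  note [measurable] = d(1,2) l2_measurable[OF d(3)] l2_measurable[OF d(4)]
  have m: "(\<lambda>x. \<bar>u x\<bar>) \<in> borel_measurable lebesgue" "(\<lambda>x. sgn (u x) *\<^sub>R G x) \<in> borel_measurable lebesgue"
    by measurable
  have l: "l2 ?M (\<lambda>x. \<bar>u x\<bar>)" "l2 ?M (\<lambda>x. sgn (u x) *\<^sub>R G x)"
    by (rule l2_dominated[OF measurable_restrict_space1[OF m(1)] d(3), of 1], simp)
      (rule l2_dominated[OF measurable_restrict_space1[OF m(2)] d(4), of 1], simp add: sgn_if)
  show ?thesis
  proof (rule H10_grad_limit[OF \<Omega> _ m l])
    show "\<forall>k. H10_grad \<Omega> (\<lambda>x. f k (u x)) (\<lambda>x. f' k (u x) *\<^sub>R G x)"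
      using H10_grad_compose[OF \<Omega> u, of "f _" "f' _" 1] der f'c f0 f'1 by blast
    show "(\<lambda>k. n2 ?M (\<lambda>x. f k (u x) - \<bar>u x\<bar>)) \<longlonglongrightarrow> 0"
    proof (rule n2_dominated_tendsto[OF _ d(3), of _ 1])
      show "\<forall>k. AE x in ?M. norm (f k (u x) - \<bar>u x\<bar>) \<le> 1 * norm (u x)"
      proof (intro allI AE_I2)
        show "norm (f k (u x) - \<bar>u x\<bar>) \<le> 1 * norm (u x)" for k x
          using fb[of k "u x"] by simp
      qed
      show "AE x in ?M. (\<lambda>k. f k (u x) - \<bar>u x\<bar>) \<longlonglongrightarrow> 0"
      proof (rule AE_I2)
        fix x
        have "(\<lambda>k. f k (u x) - \<bar>u x\<bar>) \<longlonglongrightarrow> sqrt ((u x)\<^sup>2 + 0\<^sup>2) - 0 - \<bar>u x\<bar>"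
          unfolding f_def by (intro tendsto_intros e0)
        then show "(\<lambda>k. f k (u x) - \<bar>u x\<bar>) \<longlonglongrightarrow> 0" by simp
      qed
    qed measurable
    show "(\<lambda>k. n2 ?M (\<lambda>x. f' k (u x) *\<^sub>R G x - sgn (u x) *\<^sub>R G x)) \<longlonglongrightarrow> 0"
    proof (rule n2_dominated_tendsto[OF _ d(4), of _ 2])
      have "norm (f' k (u x) *\<^sub>R G x - sgn (u x) *\<^sub>R G x) \<le> 2 * norm (G x)" for k x
      proof -
        have "\<bar>f' k (u x) - sgn (u x)\<bar> \<le> 2"
          using f'1[of k "u x"] by (auto simp: sgn_if)
        then show ?thesis
          unfolding scaleR_diff_left[symmetric] by (simp add: mult_right_mono)
      qed
      then show "\<forall>k. AE x in ?M. norm (f' k (u x) *\<^sub>R G x - sgn (u x) *\<^sub>R G x) \<le> 2 * norm (G x)"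
        by simp
      show "AE x in ?M. (\<lambda>k. f' k (u x) *\<^sub>R G x - sgn (u x) *\<^sub>R G x) \<longlonglongrightarrow> 0"
      proof (rule AE_I2)
        fix x
        have "(\<lambda>k. f' k (u x)) \<longlonglongrightarrow> sgn (u x)"
        proof (cases "u x = 0")
          case True then show ?thesis by (simp add: f'_def)
        next
          case False
          have "(\<lambda>k. f' k (u x)) \<longlonglongrightarrow> u x / sqrt ((u x)\<^sup>2 + 0\<^sup>2)"
            unfolding f'_def using False by (intro tendsto_intros e0) auto
          then show ?thesis using False by (simp add: real_sgn_eq)
        qed
        then have "(\<lambda>k. f' k (u x) *\<^sub>R G x - sgn (u x) *\<^sub>R G x) \<longlonglongrightarrow> sgn (u x) *\<^sub>R G x - sgn (u x) *\<^sub>R G x"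
          by (intro tendsto_intros)
        then show "(\<lambda>k. f' k (u x) *\<^sub>R G x - sgn (u x) *\<^sub>R G x) \<longlonglongrightarrow> 0" by simp
      qed
    qed measurable
  qed
qed

section \<open>The nonlinearity\<close>

text \<open>The positive part raised to the power \<open>r\<close>. Since |s|^r is its value at
  \<open>s\<close> plus its value at \<open>- s\<close>, one differentiation lemma covers both terms
  of the potential.\<close>

definition pospow :: "real \<Rightarrow> real \<Rightarrow> real" where
  "pospow r s = (max s 0) powr r"

lemma pospow_nonneg [simp]: "0 \<le> pospow r s"
  by (simp add: pospow_def)

lemma pospow_pos: "0 \<le> s \<Longrightarrow> pospow r s = s powr r"
  by (simp add: pospow_def)

lemma pospow_neg: "s \<le> 0 \<Longrightarrow> pospow r s = 0"
  by (simp add: pospow_def)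

lemma abs_powr_eq_pospow: "\<bar>s\<bar> powr r = pospow r s + pospow r (- s)"
  by (cases "0 \<le> s") (auto simp: pospow_def max_def)

lemma pospow_le_abs_powr: "pospow r s \<le> \<bar>s\<bar> powr r"
  by (simp add: abs_powr_eq_pospow)

lemma continuous_on_pospow: "0 < r \<Longrightarrow> continuous_on UNIV (pospow r)"
  unfolding pospow_def by (intro continuous_on_powr' continuous_intros) auto

lemma pospow_measurable [measurable]: "pospow r \<in> borel_measurable borel"
  unfolding pospow_def by measurable

text \<open>Away from 0 the claim is local; at 0 the difference quotient is at most |h|^(r-1), which
  vanishes in the limit because r > 1.\<close>

lemma pospow_has_derivative:
  assumes r: "1 < r"
  shows "(pospow r has_real_derivative r * pospow (r - 1) s) (at s)"
proof -
  consider "0 < s" | "s < 0" | "s = 0" by linarith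
  then show ?thesis
  proof cases
    case 1
    have "((\<lambda>s. s powr r) has_real_derivative r * s powr (r - 1)) (at s)"
      using 1 by (auto intro!: derivative_eq_intros)
    then have "((\<lambda>s. s powr r) has_real_derivative r * pospow (r - 1) s) (at s)"
      using 1 by (simp add: pospow_pos)
    then show ?thesis
      by (rule has_field_derivative_transform_within_open[of _ _ _ "{0<..}"])
        (use 1 in \<open>auto simp: pospow_pos\<close>)
  next
    case 2
    have "((\<lambda>s. 0) has_real_derivative 0) (at s)" by simp
    then have "(pospow r has_real_derivative 0) (at s)"
      by (rule has_field_derivative_transform_within_open[of _ _ _ "{..<0}"])
        (use 2 in \<open>auto simp: pospow_neg\<close>)
    then show ?thesis using 2 by (simp add: pospow_neg)
  next
    case 3
    have "((\<lambda>h. \<bar>h\<bar> powr (r - 1)) \<longlongrightarrow> \<bar>0\<bar> powr (r - 1)) (at 0)"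
      using r by (intro tendsto_powr' tendsto_intros) auto
    then have t: "((\<lambda>h::real. \<bar>h\<bar> powr (r - 1)) \<longlongrightarrow> 0) (at 0)" by simp
    have "((\<lambda>h. (pospow r (0 + h) - pospow r 0) / h) \<longlongrightarrow> 0) (at 0)"
    proof (rule Lim_null_comparison[OF _ t])
      have "norm ((pospow r (0 + h) - pospow r 0) / h) \<le> \<bar>h\<bar> powr (r - 1)" for h
      proof (cases "0 < h")
        case True
        then show ?thesis by (simp add: pospow_pos powr_diff)
      qed (simp add: pospow_neg)
      then show "\<forall>\<^sub>F h in at 0. norm ((pospow r (0 + h) - pospow r 0) / h) \<le> \<bar>h\<bar> powr (r - 1)"
        by simp
    qed
    then have "(pospow r has_real_derivative 0) (at 0)" by (simp add: DERIV_def)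
    then show ?thesis using 3 by (simp add: pospow_neg)
  qed
qed

lemma pospow_uminus_has_derivative:
  assumes r: "1 < r"
  shows "((\<lambda>s. pospow r (- s)) has_real_derivative - (r * pospow (r - 1) (- s))) (at s)"
proof -
  have "((\<lambda>s. pospow r (- s)) has_real_derivative (r * pospow (r - 1) (- s)) * (-1)) (at s)"
    by (rule DERIV_chain2[where f = "pospow r" and g = uminus], rule pospow_has_derivative[OF r])
      (auto intro!: derivative_eq_intros)
  then show ?thesis by simp
qed

text \<open>Serves twice: for the lower bound on the potential and for the lower bound on its second
  derivative.\<close>

lemma powr_absorb:
  fixes A B a b :: real
  assumes "0 < a" "a < b" "0 \<le> A" "0 < B"
  obtains K where "0 \<le> K" "\<forall>s\<ge>0. A * s powr a \<le> B * s powr b + K"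
proof -
  \<comment> \<open>\<open>S\<close> is where the two powers meet: beyond it the higher one wins,
    and up to it the left side is at most its value at \<open>S\<close>.\<close>
  define S where "S = (A / B) powr (1 / (b - a))"
  have S0: "0 \<le> S" by (simp add: S_def)
  have "A * s powr a \<le> B * s powr b + A * S powr a" if "0 \<le> s" for s
  proof (cases "s \<le> S")
    case True
    then have "A * s powr a \<le> A * S powr a"
      using assms that by (intro mult_left_mono powr_mono2) auto
    then show ?thesis using assms by (simp add: add_increasing)
  next
    case False
    then have s: "0 < s" "S \<le> s" using S0 by auto
    have "A / B = S powr (b - a)"
      using assms by (cases "A = 0") (auto simp: S_def powr_powr)
    also have "\<dots> \<le> s powr (b - a)" using s S0 assms by (intro powr_mono2) auto
    finally have "A \<le> B * s powr (b - a)" using assms by (simp add: field_simps)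
    then have "A * s powr a \<le> B * s powr (b - a) * s powr a" by (intro mult_right_mono) auto
    also have "\<dots> = B * s powr b" using s by (simp add: powr_add[symmetric] mult.assoc)
    finally show ?thesis using assms by (simp add: add_increasing2)
  qed
  then show ?thesis using assms by (intro that[of "A * S powr a"]) auto
qed

definition potential :: "real \<Rightarrow> real \<Rightarrow> real \<Rightarrow> real \<Rightarrow> real" where
  "potential p lam m s = \<bar>s\<bar> powr m / m - lam / p * pospow p s"

text \<open>For negative \<open>s\<close> this is -|s|^(m-1), without the term of order p - 1 that
  (P_m) has there, because \<open>Jm\<close> sees only the positive part in that term. The two
  nonlinearities agree for nonnegative \<open>s\<close>.\<close>

definition potential_deriv :: "real \<Rightarrow> real \<Rightarrow> real \<Rightarrow> real \<Rightarrow> real" where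
  "potential_deriv p lam m s = pospow (m - 1) s - pospow (m - 1) (- s) - lam * pospow (p - 1) s"

lemma potential_measurable [measurable]:
  "potential p lam m \<in> borel_measurable borel" "potential_deriv p lam m \<in> borel_measurable borel"
  unfolding potential_def potential_deriv_def by measurable

lemma potential_zero [simp]: "potential p lam m 0 = 0"
  by (simp add: potential_def pospow_def)

lemma potential_has_derivative:
  assumes "1 < p" "1 < m"
  shows "(potential p lam m has_real_derivative potential_deriv p lam m s) (at s)"
proof -
  have "((\<lambda>s. (pospow m s + pospow m (- s)) / m - lam / p * pospow p s) has_real_derivative
     (m * pospow (m - 1) s + - (m * pospow (m - 1) (- s))) / m - lam / p * (p * pospow (p - 1) s)) (at s)"
    by (intro DERIV_diff DERIV_cdivide DERIV_add DERIV_cmult pospow_uminus_has_derivative pospow_has_derivative assms)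
  moreover have "(\<lambda>s. (pospow m s + pospow m (- s)) / m - lam / p * pospow p s) = potential p lam m"
    by (auto simp: potential_def abs_powr_eq_pospow)
  moreover have "(m * pospow (m - 1) s + - (m * pospow (m - 1) (- s))) / m - lam / p * (p * pospow (p - 1) s)
      = potential_deriv p lam m s"
    using assms by (simp add: potential_deriv_def field_simps)
  ultimately show ?thesis by simp
qed

text \<open>Half of |s|^m / m absorbs the subtracted power up to a constant, since p < m.\<close>

lemma potential_coercive:
  assumes "0 < p" "p < m" "0 \<le> lam"
  obtains K where "0 \<le> K" "\<forall>s. \<bar>s\<bar> powr m / (2 * m) \<le> potential p lam m s + K"
proof -
  obtain K where K: "0 \<le> K" "\<forall>s\<ge>0. lam / p * s powr p \<le> 1 / (2 * m) * s powr m + K"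
    by (rule powr_absorb[of p m "lam / p" "1 / (2 * m)"]) (use assms in auto)
  have "\<bar>s\<bar> powr m / (2 * m) \<le> potential p lam m s + K" for s
  proof -
    have "lam / p * pospow p s \<le> lam / p * \<bar>s\<bar> powr p"
      using assms pospow_le_abs_powr[of p s] by (intro mult_left_mono) auto
    also have "\<dots> \<le> 1 / (2 * m) * \<bar>s\<bar> powr m + K" using K(2) by simp
    finally show ?thesis using assms by (simp add: potential_def field_simps)
  qed
  with K(1) show ?thesis by (intro that) auto
qed

text \<open>Adding c s^2 / 2 raises the second derivative by \<open>c\<close>, and such a constant
  suffices because |s|^(m-2) absorbs the power p - 2. That p > 2 makes the first derivative
  differentiable at 0 as well.\<close>

lemma potential_semiconvex:
  assumes "2 < p" "p < m" "0 \<le> lam"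
  obtains c where "0 \<le> c"
    "\<forall>s t. potential p lam m ((s + t) / 2) \<le> potential p lam m s / 2 + potential p lam m t / 2 + c / 8 * (s - t)\<^sup>2"
proof -
  obtain c where c: "0 \<le> c" "\<forall>s\<ge>0. lam * (p - 1) * s powr (p - 2) \<le> (m - 1) * s powr (m - 2) + c"
    by (rule powr_absorb[of "p - 2" "m - 2" "lam * (p - 1)" "m - 1"]) (use assms in auto)
  define F where "F s = potential p lam m s + c / 2 * s\<^sup>2" for s
  define F1 where "F1 s = potential_deriv p lam m s + c * s" for s
  define F2 where "F2 s = (m - 1) * pospow (m - 2) s + (m - 1) * pospow (m - 2) (- s)
      - lam * ((p - 1) * pospow (p - 2) s) + c" for s
  have d1: "(F has_real_derivative F1 s) (at s)" for s
    unfolding F_def F1_def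
    by (rule DERIV_add[OF potential_has_derivative]) (use assms in \<open>auto intro!: derivative_eq_intros\<close>)
  have d2: "(F1 has_real_derivative F2 s) (at s)" for s
  proof -
    have "((\<lambda>s. pospow (m - 1) s - pospow (m - 1) (- s) - lam * pospow (p - 1) s + c * s) has_real_derivative
       ((m - 1) * pospow (m - 1 - 1) s - - ((m - 1) * pospow (m - 1 - 1) (- s)) - lam * ((p - 1) * pospow (p - 1 - 1) s) + c * 1)) (at s)"
      by (intro DERIV_diff DERIV_add DERIV_cmult pospow_uminus_has_derivative pospow_has_derivative DERIV_ident) (use assms in auto)
    then show ?thesis
      unfolding F1_def potential_deriv_def F2_def by (simp add: algebra_simps)
  qed
  have "0 \<le> F2 s" for s
  proof (cases "0 \<le> s")
    case True
    have "0 \<le> (m - 1) * pospow (m - 2) (- s)" using assms by simp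
    moreover have "lam * (p - 1) * pospow (p - 2) s \<le> (m - 1) * pospow (m - 2) s + c"
      using c(2)[rule_format, OF True] True by (simp add: pospow_pos)
    ultimately show ?thesis by (simp add: F2_def mult.assoc)
  next
    case False
    then show ?thesis using c(1) assms by (simp add: F2_def pospow_neg)
  qed
  then have cv: "convex_on UNIV F"
    by (intro f''_ge0_imp_convex[of UNIV F F1 F2]) (use d1 d2 in auto)
  have "potential p lam m ((s + t) / 2) \<le> potential p lam m s / 2 + potential p lam m t / 2 + c / 8 * (s - t)\<^sup>2" for s t
  proof -
    \<comment> \<open>The square function lies (s - t)^2 / 4 below its chord at the midpoint;
      multiplied by c / 2 this is the c / 8 of the claim.\<close>
    have "F ((1 - 1/2) *\<^sub>R s + (1/2) *\<^sub>R t) \<le> (1 - 1/2) * F s + (1/2) * F t"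
      by (rule convex_onD[OF cv]) auto
    then have "F ((s + t) / 2) \<le> F s / 2 + F t / 2" by (simp add: add_divide_distrib)
    then show ?thesis by (simp add: F_def power2_eq_square field_simps)
  qed
  with c(1) show ?thesis by (intro that) auto
qed

text \<open>The term |s|^m is even, and reflecting a negative value cannot decrease the subtracted
  term.\<close>

lemma potential_abs_le: "0 \<le> lam \<Longrightarrow> 0 < p \<Longrightarrow> potential p lam m \<bar>s\<bar> \<le> potential p lam m s"
  using pospow_le_abs_powr[of p s]
  by (simp add: potential_def pospow_pos mult_left_mono divide_right_mono)

section \<open>Bounds for difference quotients of the potential\<close>

lemma powr_le_one_plus:
  fixes s :: real
  assumes "0 \<le> s" "0 < a" "a \<le> b"
  shows "s powr a \<le> 1 + s powr b"
proof (cases "s \<le> 1")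
  case True
  then have "s powr a \<le> 1 powr a" using assms by (intro powr_mono2) auto
  then show ?thesis by (simp add: add_increasing2)
next
  case False
  then have "s powr a \<le> s powr b" using assms by (intro powr_mono) auto
  then show ?thesis by simp
qed

lemma powr_add_le:
  fixes s t :: real
  assumes "0 \<le> s" "0 \<le> t" "0 \<le> r"
  shows "(s + t) powr r \<le> 2 powr r * (s powr r + t powr r)"
proof -
  have "(s + t) powr r \<le> (2 * max s t) powr r" using assms by (intro powr_mono2) auto
  also have "\<dots> = 2 powr r * (max s t) powr r" using assms by (simp add: powr_mult)
  also have "\<dots> \<le> 2 powr r * (s powr r + t powr r)"
    by (intro mult_left_mono) (auto simp: max_def)
  finally show ?thesis .
qed

text \<open>Both factors are bounded by powers of z = |s| + |h|, so the product has the orders m and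
  p, and z^p is at most 1 + z^m.\<close>

lemma potential_deriv_bound:
  assumes "2 < p" "p < m" "0 \<le> lam"
  shows "\<bar>potential_deriv p lam m s\<bar> * \<bar>h\<bar> \<le> (1 + lam) * (\<bar>s\<bar> + \<bar>h\<bar>) powr m + lam"
proof -
  define z where "z = \<bar>s\<bar> + \<bar>h\<bar>"
  have z: "0 \<le> z" "\<bar>s\<bar> \<le> z" "\<bar>h\<bar> \<le> z" by (auto simp: z_def)
  have zz: "z powr (r - 1) * z = z powr r" for r
    using z(1) by (cases "z = 0") (auto simp: powr_diff)
  have "\<bar>potential_deriv p lam m s\<bar> \<le> \<bar>s\<bar> powr (m - 1) + lam * \<bar>s\<bar> powr (p - 1)"
    using assms(3) by (cases "0 \<le> s") (auto simp: potential_deriv_def pospow_pos pospow_neg abs_le_iff add_increasing add_increasing2)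
  also have "\<dots> \<le> z powr (m - 1) + lam * z powr (p - 1)"
    using assms z by (intro add_mono mult_left_mono powr_mono2) auto
  finally have "\<bar>potential_deriv p lam m s\<bar> * \<bar>h\<bar> \<le> (z powr (m - 1) + lam * z powr (p - 1)) * z"
    using z assms by (intro mult_mono) auto
  also have "\<dots> = z powr m + lam * z powr p"
    using zz[of m] zz[of p] by (simp add: algebra_simps)
  also have "\<dots> \<le> z powr m + lam * (1 + z powr m)"
    using assms z by (intro add_left_mono mult_left_mono powr_le_one_plus) auto
  finally show ?thesis by (simp add: z_def algebra_simps)
qed

text \<open>Mean value theorem. The bound does not contain \<open>t\<close>, as dominated
  convergence in the first variation demands; the 2 pays for moving the base point by at most
  |h|.\<close>

lemma potential_increment_bound:
  assumes "2 < p" "p < m" "0 \<le> lam" and t: "0 < t" "t \<le> 1"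
  shows "\<bar>(potential p lam m (s + t * h) - potential p lam m s) / t\<bar>
     \<le> (1 + lam) * (2 * (\<bar>s\<bar> + \<bar>h\<bar>)) powr m + lam"
proof -
  have d: "((\<lambda>r. potential p lam m (s + r * h)) has_real_derivative potential_deriv p lam m (s + r * h) * h) (at r)" for r
    by (rule DERIV_chain2[OF potential_has_derivative]) (use assms in \<open>auto intro!: derivative_eq_intros\<close>)
  obtain r where r: "0 < r" "r < t"
    "potential p lam m (s + t * h) - potential p lam m (s + 0 * h) = (t - 0) * (potential_deriv p lam m (s + r * h) * h)"
    using MVT2[of 0 t "\<lambda>r. potential p lam m (s + r * h)" "\<lambda>r. potential_deriv p lam m (s + r * h) * h"] d t(1) by blast
  have "\<bar>(potential p lam m (s + t * h) - potential p lam m s) / t\<bar> = \<bar>potential_deriv p lam m (s + r * h)\<bar> * \<bar>h\<bar>"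
    using r(3) t by (simp add: abs_mult)
  also have "\<dots> \<le> (1 + lam) * (\<bar>s + r * h\<bar> + \<bar>h\<bar>) powr m + lam"
    by (rule potential_deriv_bound[OF assms(1-3)])
  also have "\<dots> \<le> (1 + lam) * (2 * (\<bar>s\<bar> + \<bar>h\<bar>)) powr m + lam"
  proof -
    have "\<bar>r * h\<bar> \<le> \<bar>h\<bar>" using r t by (simp add: abs_mult mult_left_le_one_le)
    then have "\<bar>s + r * h\<bar> + \<bar>h\<bar> \<le> 2 * (\<bar>s\<bar> + \<bar>h\<bar>)"
      using abs_triangle_ineq[of s "r * h"] abs_ge_zero[of s] by argo
    then show ?thesis
      using assms by (intro add_right_mono mult_left_mono powr_mono2) auto
  qed
  finally show ?thesis .
qed

section \<open>The energy functional\<close>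

lemma H10_wgrad:
  assumes "v \<in> H10 \<Omega>" shows "H10_grad \<Omega> v (wgrad \<Omega> v)"
proof -
  have "\<exists>G. H10_grad \<Omega> v G" using assms by (simp add: H10_def)
  then show ?thesis unfolding wgrad_def by (rule someI_ex)
qed

locale elliptic_form =
  fixes \<Omega> :: "('n::finite) pt set" and M :: "'n pt \<Rightarrow> real ^ 'n ^ 'n" and \<alpha> \<beta> :: real
  assumes open_domain: "open \<Omega>" and bounded_domain: "bounded \<Omega>"
    and M_meas: "\<And>i j. (\<lambda>x. M x $ i $ j) \<in> borel_measurable lebesgue"
    and M_bdd: "\<exists>C. AE x in lebesgue. x \<in> \<Omega> \<longrightarrow> (\<forall>i j. \<bar>M x $ i $ j\<bar> \<le> C)"
    and M_sym: "AE x in lebesgue. x \<in> \<Omega> \<longrightarrow> transpose (M x) = M x"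
    and M_ell: "AE x in lebesgue. x \<in> \<Omega> \<longrightarrow>
               (\<forall>\<xi>. \<alpha> * (norm \<xi>)\<^sup>2 \<le> (M x *v \<xi>) \<bullet> \<xi> \<and> (M x *v \<xi>) \<bullet> \<xi> \<le> \<beta> * (norm \<xi>)\<^sup>2)"
    and \<alpha>_pos: "0 < \<alpha>"
begin

abbreviation "\<mu> \<equiv> lebesgue_on \<Omega>"

lemma domain_sets [simp]: "\<Omega> \<in> sets lebesgue"
  using open_domain by auto

lemma AE_domain_iff: "(AE x in \<mu>. P x) \<longleftrightarrow> (AE x in lebesgue. x \<in> \<Omega> \<longrightarrow> P x)"
  by (rule AE_restrict_space_iff) simp

lemma finite_domain: "finite_measure \<mu>"
  by (rule finite_measure_lebesgue_on_bounded[OF domain_sets bounded_domain])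

lemma const_integrable: "integrable \<mu> (\<lambda>x. c::real)"
proof -
  interpret finite_measure \<mu> by (rule finite_domain)
  show ?thesis by simp
qed

lemma matrix_vector_norm_bound: "\<exists>C\<ge>0. AE x in \<mu>. \<forall>\<xi>. norm (M x *v \<xi>) \<le> C * norm \<xi>"
proof -
  obtain C where C: "AE x in \<mu>. \<forall>i j. \<bar>M x $ i $ j\<bar> \<le> C"
    using M_bdd unfolding AE_domain_iff by blast
  \<comment> \<open>Over an empty domain \<open>C\<close> could be negative; the maximum keeps
    \<open>B\<close> nonnegative.\<close>
  define B where "B = real CARD('n) * real CARD('n) * max C 0"
  have "AE x in \<mu>. \<forall>\<xi>. norm (M x *v \<xi>) \<le> B * norm \<xi>"
    using C
  proof eventually_elim
    case (elim x)
    then have "onorm ((*v) (M x)) \<le> real CARD('n) * real CARD('n) * max C 0"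
      by (intro onorm_le_matrix_component) (auto simp: le_max_iff_disj)
    then have "onorm ((*v) (M x)) \<le> B" by (simp add: B_def)
    moreover have "norm (M x *v \<xi>) \<le> onorm ((*v) (M x)) * norm \<xi>" for \<xi>
      by (rule onorm) (rule matrix_vector_mul_bounded_linear)
    ultimately show ?case by (meson mult_right_mono norm_ge_zero order_trans)
  qed
  moreover have "0 \<le> B" by (simp add: B_def)
  ultimately show ?thesis by blast
qed

lemma matrix_vector_measurable:
  assumes "G \<in> borel_measurable \<mu>"
  shows "(\<lambda>x. M x *v G x) \<in> borel_measurable \<mu>"
proof -
  have [measurable]: "(\<lambda>x. x $ j) \<in> borel_measurable borel" for j :: 'n
    by (intro borel_measurable_continuous_onI continuous_intros)
  have [measurable]: "(\<lambda>x. M x $ i $ j) \<in> borel_measurable \<mu>" for i j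
    by (rule measurable_restrict_space1[OF M_meas])
  note [measurable] = assms
  have "(\<lambda>x. (M x *v G x) \<bullet> b) \<in> borel_measurable \<mu>" if b: "b \<in> Basis" for b
  proof -
    obtain i where i: "b = axis i 1" using b by (auto simp: Basis_vec_def)
    have "(\<lambda>x. \<Sum>j\<in>UNIV. M x $ i $ j * (G x $ j)) \<in> borel_measurable \<mu>"
      by measurable
    then show ?thesis by (simp add: i inner_axis matrix_vector_mult_def)
  qed
  then show ?thesis by (subst borel_measurable_euclidean_space) auto
qed

lemma matrix_vector_l2:
  assumes "l2 \<mu> G" shows "l2 \<mu> (\<lambda>x. M x *v G x)"
proof -
  obtain C where "AE x in \<mu>. \<forall>\<xi>. norm (M x *v \<xi>) \<le> C * norm \<xi>"
    using matrix_vector_norm_bound by blast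
  then have "AE x in \<mu>. norm (M x *v G x) \<le> C * norm (G x)" by eventually_elim blast
  then show ?thesis by (rule l2_dominated[OF matrix_vector_measurable[OF l2_measurable[OF assms]] assms])
qed

definition form :: "('n pt \<Rightarrow> 'n pt) \<Rightarrow> ('n pt \<Rightarrow> 'n pt) \<Rightarrow> real" where
  "form G H = (\<integral>x. (M x *v G x) \<bullet> H x \<partial>\<mu>)"

lemma form_integrable: "l2 \<mu> G \<Longrightarrow> l2 \<mu> H \<Longrightarrow> integrable \<mu> (\<lambda>x. (M x *v G x) \<bullet> H x)"
  by (intro l2_inner_integrable matrix_vector_l2)

lemma form_cong_AE:
  assumes "l2 \<mu> G" "l2 \<mu> G'" "l2 \<mu> H" "l2 \<mu> H'"
    and "AE x in \<mu>. G x = G' x" "AE x in \<mu>. H x = H' x"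
  shows "form G H = form G' H'"
  unfolding form_def
proof (rule integral_cong_AE)
  show "AE x in \<mu>. (M x *v G x) \<bullet> H x = (M x *v G' x) \<bullet> H' x"
    using assms(5,6) by eventually_elim simp
qed (use form_integrable assms in auto)

lemma form_commute:
  assumes "l2 \<mu> G" "l2 \<mu> H"
  shows "form G H = form H G"
  unfolding form_def
proof (rule integral_cong_AE)
  have "AE x in \<mu>. transpose (M x) = M x" using M_sym by (simp add: AE_domain_iff)
  then show "AE x in \<mu>. (M x *v G x) \<bullet> H x = (M x *v H x) \<bullet> G x"
  proof eventually_elim
    case (elim x)
    have "(M x *v G x) \<bullet> H x = (G x v* transpose (M x)) \<bullet> H x"
      by (simp add: vector_transpose_matrix)
    also have "\<dots> = G x \<bullet> (transpose (M x) *v H x)" by (rule dot_lmul_matrix)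
    finally show ?case using elim by (simp add: inner_commute)
  qed
qed (use form_integrable assms in auto)

lemma form_lincomb:
  assumes "l2 \<mu> G" "l2 \<mu> H"
  shows "form (\<lambda>x. a *\<^sub>R G x + b *\<^sub>R H x) (\<lambda>x. a *\<^sub>R G x + b *\<^sub>R H x)
    = a\<^sup>2 * form G G + 2 * (a * b) * form G H + b\<^sup>2 * form H H"
proof -
  have "form (\<lambda>x. a *\<^sub>R G x + b *\<^sub>R H x) (\<lambda>x. a *\<^sub>R G x + b *\<^sub>R H x)
    = (\<integral>x. a\<^sup>2 * ((M x *v G x) \<bullet> G x) + a * b * ((M x *v G x) \<bullet> H x) + a * b * ((M x *v H x) \<bullet> G x) + b\<^sup>2 * ((M x *v H x) \<bullet> H x) \<partial>\<mu>)"
    unfolding form_def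
    by (intro Bochner_Integration.integral_cong)
      (auto simp: matrix_vector_right_distrib matrix_vector_mult_scaleR inner_simps power2_eq_square algebra_simps)
  also have "\<dots> = a\<^sup>2 * form G G + a * b * form G H + a * b * form H G + b\<^sup>2 * form H H"
    using form_integrable assms by (simp add: form_def)
  finally show ?thesis using form_commute[OF assms] by simp
qed

lemma form_bounds:
  assumes G: "l2 \<mu> G"
  shows "\<alpha> * (n2 \<mu> G)\<^sup>2 \<le> form G G" "form G G \<le> \<beta> * (n2 \<mu> G)\<^sup>2"
proof -
  have e: "AE x in \<mu>. \<forall>\<xi>. \<alpha> * (norm \<xi>)\<^sup>2 \<le> (M x *v \<xi>) \<bullet> \<xi> \<and> (M x *v \<xi>) \<bullet> \<xi> \<le> \<beta> * (norm \<xi>)\<^sup>2"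
    using M_ell by (simp add: AE_domain_iff)
  have "(\<integral>x. \<alpha> * (norm (G x))\<^sup>2 \<partial>\<mu>) \<le> form G G"
    unfolding form_def
    by (rule integral_mono_AE) (use e l2_integrable_sq[OF G] form_integrable[OF G G] in auto)
  then show "\<alpha> * (n2 \<mu> G)\<^sup>2 \<le> form G G" by (simp add: n2_sq)
  have "form G G \<le> (\<integral>x. \<beta> * (norm (G x))\<^sup>2 \<partial>\<mu>)"
    unfolding form_def
    by (rule integral_mono_AE) (use e l2_integrable_sq[OF G] form_integrable[OF G G] in auto)
  then show "form G G \<le> \<beta> * (n2 \<mu> G)\<^sup>2" by (simp add: n2_sq)
qed

lemma form_nonneg: "l2 \<mu> G \<Longrightarrow> 0 \<le> form G G"
  using form_bounds(1)[of G] \<alpha>_pos by (meson mult_nonneg_nonneg less_imp_le order_trans zero_le_power2)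

text \<open>The factor sgn^2 is 0 or 1, and the integrand on the right is nonnegative by
  ellipticity.\<close>

lemma form_sgn_le:
  assumes G: "l2 \<mu> G" and l: "l2 \<mu> (\<lambda>x. sgn (u x) *\<^sub>R G x)"
  shows "form (\<lambda>x. sgn (u x :: real) *\<^sub>R G x) (\<lambda>x. sgn (u x) *\<^sub>R G x) \<le> form G G"
  unfolding form_def
proof (rule integral_mono_AE)
  have e: "AE x in \<mu>. \<forall>\<xi>. \<alpha> * (norm \<xi>)\<^sup>2 \<le> (M x *v \<xi>) \<bullet> \<xi>"
    using M_ell by (auto simp: AE_domain_iff elim!: eventually_mono)
  then show "AE x in \<mu>. (M x *v (sgn (u x) *\<^sub>R G x)) \<bullet> (sgn (u x) *\<^sub>R G x) \<le> (M x *v G x) \<bullet> G x"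
  proof eventually_elim
    case (elim x)
    have "0 \<le> \<alpha> * (norm (G x))\<^sup>2" using \<alpha>_pos by simp
    then have "0 \<le> (M x *v G x) \<bullet> G x" using elim order_trans by blast
    then show ?case by (auto simp: sgn_if matrix_vector_mult_scaleR)
  qed
qed (intro form_integrable G l)+

lemma form_tendsto:
  assumes G: "\<forall>k. l2 \<mu> (G k)" "l2 \<mu> H" "(\<lambda>k. n2 \<mu> (\<lambda>x. G k x - H x)) \<longlonglongrightarrow> 0"
  shows "(\<lambda>k. form (G k) (G k)) \<longlonglongrightarrow> form H H"
  unfolding form_def
proof (rule l2_inner_tendsto)
  obtain C where C: "0 \<le> C" "AE x in \<mu>. \<forall>\<xi>. norm (M x *v \<xi>) \<le> C * norm \<xi>"
    using matrix_vector_norm_bound by blast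
  show "(\<lambda>k. n2 \<mu> (\<lambda>x. M x *v G k x - M x *v H x)) \<longlonglongrightarrow> 0"
  proof (rule n2_squeeze)
    show "n2 \<mu> (\<lambda>x. M x *v G k x - M x *v H x) \<le> C * n2 \<mu> (\<lambda>x. G k x - H x)" for k
    proof (rule n2_le[OF l2_diff[OF G(1)[rule_format] G(2)] _ C(1)])
      show "AE x in \<mu>. norm (M x *v G k x - M x *v H x) \<le> C * norm (G k x - H x)"
        using C(2) by eventually_elim (metis matrix_vector_mult_diff_distrib)
    qed
    show "(\<lambda>k. C * n2 \<mu> (\<lambda>x. G k x - H x)) \<longlonglongrightarrow> 0"
      using tendsto_mult[OF tendsto_const G(3), of C] by simp
  qed
qed (use G matrix_vector_l2 in auto)

end

text \<open>The exponent \<open>m\<close> is a parameter, since the theorem instantiates the locale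
  for each m >= m0 with constants chosen beforehand.\<close>

locale elliptic_problem = elliptic_form +
  fixes p lam m :: real
  assumes p_gt: "2 < p" and m_gt: "p < m" and lam_pos: "0 < lam"
begin

text \<open>Membership in X_m with an explicit gradient, so that linear combinations, absolute
  values and limits come with a gradient given by a formula.\<close>

definition admissible :: "('a pt \<Rightarrow> real) \<Rightarrow> ('a pt \<Rightarrow> 'a pt) \<Rightarrow> bool" where
  "admissible v G \<longleftrightarrow> H10_grad \<Omega> v G \<and> integrable \<mu> (\<lambda>x. \<bar>v x\<bar> powr m)"

definition energy :: "('a pt \<Rightarrow> real) \<Rightarrow> ('a pt \<Rightarrow> 'a pt) \<Rightarrow> real" where
  "energy v G = form G G / 2 + (\<integral>x. potential p lam m (v x) \<partial>\<mu>)"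

lemma admissibleD:
  assumes "admissible v G"
  shows "H10_grad \<Omega> v G" "integrable \<mu> (\<lambda>x. \<bar>v x\<bar> powr m)" "l2 \<mu> v" "l2 \<mu> G" "v \<in> borel_measurable \<mu>"
  using assms H10_gradD[OF domain_sets, of v G]
  by (auto simp: admissible_def l2_measurable)

lemma Xm_admissible: "v \<in> Xm \<Omega> m \<Longrightarrow> admissible v (wgrad \<Omega> v)"
  by (auto simp: Xm_def Lp_space_def admissible_def H10_wgrad set_integral_lebesgue_on)

lemma admissible_Xm: "admissible v G \<Longrightarrow> v \<in> Xm \<Omega> m"
  using H10_gradD(1)[OF domain_sets, of v G]
  by (auto simp: Xm_def Lp_space_def admissible_def H10_def set_integral_lebesgue_on)

text \<open>The link between pairs and \<open>Jm\<close>, which is written with the chosen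
  gradient.\<close>

lemma wgrad_AE:
  assumes "admissible v G" shows "AE x in \<mu>. wgrad \<Omega> v x = G x"
  using H10_grad_unique[OF domain_sets bounded_domain _ admissibleD(1)[OF assms], of v "wgrad \<Omega> v"]
    Xm_admissible[OF admissible_Xm[OF assms]]
  by (simp add: admissible_def)

text \<open>The domain has finite measure, so the bound |v|^r <= 1 + |v|^m gives an integrable
  majorant.\<close>

lemma abs_powr_p_integrable:
  assumes "integrable \<mu> (\<lambda>x. \<bar>v x\<bar> powr m)" "v \<in> borel_measurable \<mu>" "0 < r" "r \<le> m"
  shows "integrable \<mu> (\<lambda>x. \<bar>v x\<bar> powr r)"
proof (rule Bochner_Integration.integrable_bound)
  show "integrable \<mu> (\<lambda>x. 1 + \<bar>v x\<bar> powr m)"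
    using assms const_integrable by auto
  show "AE x in \<mu>. norm (\<bar>v x\<bar> powr r) \<le> norm (1 + \<bar>v x\<bar> powr m)"
  proof (rule AE_I2)
    fix x
    have "\<bar>v x\<bar> powr r \<le> 1 + \<bar>v x\<bar> powr m" by (rule powr_le_one_plus[OF _ assms(3,4)]) simp
    then show "norm (\<bar>v x\<bar> powr r) \<le> norm (1 + \<bar>v x\<bar> powr m)"
      using powr_ge_zero[of "\<bar>v x\<bar>" r] unfolding real_norm_def by linarith
  qed
  note [measurable] = assms(2)
  show "(\<lambda>x. \<bar>v x\<bar> powr r) \<in> borel_measurable \<mu>" by measurable
qed

lemma pospow_integrable:
  assumes "admissible v G" shows "integrable \<mu> (\<lambda>x. pospow p (v x))"
proof (rule Bochner_Integration.integrable_bound)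
  note [measurable] = admissibleD(5)[OF assms]
  show "integrable \<mu> (\<lambda>x. \<bar>v x\<bar> powr p)"
    by (rule abs_powr_p_integrable[OF admissibleD(2,5)[OF assms]]) (use p_gt m_gt in auto)
  show "(\<lambda>x. pospow p (v x)) \<in> borel_measurable \<mu>" by measurable
qed (use pospow_le_abs_powr in auto)

lemma potential_integrable:
  assumes "admissible v G" shows "integrable \<mu> (\<lambda>x. potential p lam m (v x))"
  using admissibleD(2)[OF assms] pospow_integrable[OF assms] unfolding potential_def by auto

lemma admissible_zero: "admissible (\<lambda>x. 0) (\<lambda>x. 0)"
proof -
  have "Cc1_grad \<Omega> (\<lambda>x. 0) (\<lambda>x. 0)"
    by (rule Cc1_gradI[of "{}"]) auto
  then show ?thesis
    using p_gt m_gt by (simp add: admissible_def Cc1_grad_H10_grad)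
qed

lemma admissible_lincomb:
  assumes v: "admissible v G" and w: "admissible w H"
  shows "admissible (\<lambda>x. a * v x + b * w x) (\<lambda>x. a *\<^sub>R G x + b *\<^sub>R H x)"
  unfolding admissible_def
proof
  show "H10_grad \<Omega> (\<lambda>x. a * v x + b * w x) (\<lambda>x. a *\<^sub>R G x + b *\<^sub>R H x)"
    by (intro H10_grad_lincomb domain_sets admissibleD v w)
  note [measurable] = admissibleD(5)[OF v] admissibleD(5)[OF w]
  show "integrable \<mu> (\<lambda>x. \<bar>a * v x + b * w x\<bar> powr m)"
  proof (rule Bochner_Integration.integrable_bound)
    show "integrable \<mu> (\<lambda>x. 2 powr m * (\<bar>a\<bar> powr m * \<bar>v x\<bar> powr m + \<bar>b\<bar> powr m * \<bar>w x\<bar> powr m))"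
      using admissibleD(2)[OF v] admissibleD(2)[OF w] by auto
    have "\<bar>a * v x + b * w x\<bar> powr m \<le> 2 powr m * (\<bar>a\<bar> powr m * \<bar>v x\<bar> powr m + \<bar>b\<bar> powr m * \<bar>w x\<bar> powr m)" for x
    proof -
      have "\<bar>a * v x + b * w x\<bar> powr m \<le> (\<bar>a * v x\<bar> + \<bar>b * w x\<bar>) powr m"
        using p_gt m_gt by (intro powr_mono2) auto
      also have "\<dots> \<le> 2 powr m * (\<bar>a * v x\<bar> powr m + \<bar>b * w x\<bar> powr m)"
        using p_gt m_gt by (intro powr_add_le) auto
      finally show ?thesis by (simp add: abs_mult powr_mult)
    qed
    then show "AE x in \<mu>. norm (\<bar>a * v x + b * w x\<bar> powr m)
        \<le> norm (2 powr m * (\<bar>a\<bar> powr m * \<bar>v x\<bar> powr m + \<bar>b\<bar> powr m * \<bar>w x\<bar> powr m))"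
      by (auto intro: order_trans[OF _ abs_ge_self])
  qed measurable
qed

lemma admissible_abs:
  assumes v: "admissible v G"
  shows "admissible (\<lambda>x. \<bar>v x\<bar>) (\<lambda>x. sgn (v x) *\<^sub>R G x)"
  using H10_grad_abs[OF domain_sets admissibleD(1)[OF v]] admissibleD(2)[OF v]
  by (simp add: admissible_def)

lemma energy_abs_le:
  assumes v: "admissible v G"
  shows "energy (\<lambda>x. \<bar>v x\<bar>) (\<lambda>x. sgn (v x) *\<^sub>R G x) \<le> energy v G"
proof -
  note a = admissible_abs[OF v]
  have "(\<integral>x. potential p lam m \<bar>v x\<bar> \<partial>\<mu>) \<le> (\<integral>x. potential p lam m (v x) \<partial>\<mu>)"
    using p_gt lam_pos
    by (intro integral_mono potential_integrable[OF a] potential_integrable[OF v] potential_abs_le) auto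
  then show ?thesis
    using form_sgn_le[OF admissibleD(4)[OF v] admissibleD(4)[OF a]] by (simp add: energy_def)
qed

text \<open>The roots in \<open>Lnorm\<close> are undone by the outer powers, and the form sees
  gradients only up to null sets.\<close>

lemma Jm_eq_energy:
  assumes v: "admissible v G"
  shows "Jm \<Omega> M p lam m v = energy v G"
proof -
  have g: "form (wgrad \<Omega> v) (wgrad \<Omega> v) = form G G"
    using wgrad_AE[OF v] admissibleD(4)[OF v] admissibleD(4)[OF Xm_admissible[OF admissible_Xm[OF v]]]
    by (intro form_cong_AE) auto
  have "Jm \<Omega> M p lam m v = 1 / 2 * form (wgrad \<Omega> v) (wgrad \<Omega> v)
      + 1 / m * (\<integral>x. \<bar>v x\<bar> powr m \<partial>\<mu>) - lam / p * (\<integral>x. pospow p (v x) \<partial>\<mu>)"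
    using p_gt m_gt
    by (simp add: Jm_def Lnorm_def form_def set_integral_lebesgue_on powr_powr pospow_def)
  also have "\<dots> = energy v G"
    using admissibleD(2)[OF v] pospow_integrable[OF v] by (simp add: energy_def g potential_def)
  finally show ?thesis .
qed

end

section \<open>Existence of a minimizer\<close>

context elliptic_problem
begin

text \<open>\<open>K0\<close> is a pointwise constant and \<open>K\<close> its integral: the first
  makes Fatou's lemma applicable to the potential, the second bounds the gradients of minimizing
  sequences.\<close>

lemma energy_coercive:
  obtains K K0 where "0 \<le> K0" "K = (\<integral>x. K0 \<partial>\<mu>)"
    "\<forall>s. \<bar>s\<bar> powr m / (2 * m) \<le> potential p lam m s + K0"
    "\<forall>v G. admissible v G \<longrightarrow> \<alpha> / 2 * (n2 \<mu> G)\<^sup>2 - K \<le> energy v G"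
proof -
  obtain K0 where K0: "0 \<le> K0" "\<forall>s. \<bar>s\<bar> powr m / (2 * m) \<le> potential p lam m s + K0"
    by (rule potential_coercive[of p m lam]) (use p_gt m_gt lam_pos in auto)
  define K where "K = (\<integral>x. K0 \<partial>\<mu>)"
  have "\<alpha> / 2 * (n2 \<mu> G)\<^sup>2 - K \<le> energy v G" if a: "admissible v G" for v G
  proof -
    have "0 \<le> potential p lam m s + K0" for s
    proof -
      have "0 \<le> \<bar>s\<bar> powr m / (2 * m)" using p_gt m_gt by simp
      also have "\<dots> \<le> potential p lam m s + K0" using K0(2) by blast
      finally show ?thesis .
    qed
    then have "0 \<le> (\<integral>x. potential p lam m (v x) + K0 \<partial>\<mu>)" by simp
    also have "\<dots> = (\<integral>x. potential p lam m (v x) \<partial>\<mu>) + K"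
      unfolding K_def by (rule Bochner_Integration.integral_add[OF potential_integrable[OF a] const_integrable])
    finally show ?thesis
      using form_bounds(1)[OF admissibleD(4)[OF a]] by (simp add: energy_def)
  qed
  then show ?thesis using K0 K_def by (intro that[of K0 K]) auto
qed

text \<open>The form contributes its exact parallelogram defect, a quarter of the form of G - H,
  which ellipticity bounds below and the energy halves: hence \<alpha> / 8. The potential loses at
  most c / 8 of the squared L^2 distance.\<close>

lemma energy_midpoint:
  obtains c where "0 \<le> c" "\<forall>v G w H. admissible v G \<longrightarrow> admissible w H \<longrightarrow>
    energy (\<lambda>x. 1/2 * v x + 1/2 * w x) (\<lambda>x. (1/2) *\<^sub>R G x + (1/2) *\<^sub>R H x)
    \<le> energy v G / 2 + energy w H / 2 - \<alpha> / 8 * (n2 \<mu> (\<lambda>x. G x - H x))\<^sup>2 + c / 8 * (n2 \<mu> (\<lambda>x. v x - w x))\<^sup>2"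
proof -
  obtain c where c: "0 \<le> c"
    "\<forall>s t. potential p lam m ((s + t) / 2) \<le> potential p lam m s / 2 + potential p lam m t / 2 + c / 8 * (s - t)\<^sup>2"
    by (rule potential_semiconvex[of p m lam]) (use p_gt m_gt lam_pos in auto)
  have "energy (\<lambda>x. 1/2 * v x + 1/2 * w x) (\<lambda>x. (1/2) *\<^sub>R G x + (1/2) *\<^sub>R H x)
    \<le> energy v G / 2 + energy w H / 2 - \<alpha> / 8 * (n2 \<mu> (\<lambda>x. G x - H x))\<^sup>2 + c / 8 * (n2 \<mu> (\<lambda>x. v x - w x))\<^sup>2"
    if v: "admissible v G" and w: "admissible w H" for v G w H
  proof -
    note dv = admissibleD[OF v] and dw = admissibleD[OF w]
    note mid = admissible_lincomb[OF v w, of "1/2" "1/2"]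
    have d: "l2 \<mu> (\<lambda>x. G x - H x)" "l2 \<mu> (\<lambda>x. v x - w x)"
      by (intro l2_diff dv dw)+
    have "form (\<lambda>x. G x - H x) (\<lambda>x. G x - H x) = form G G - 2 * form G H + form H H"
      using form_lincomb[OF dv(4) dw(4), of 1 "-1"] by simp
    then have f: "form (\<lambda>x. (1/2) *\<^sub>R G x + (1/2) *\<^sub>R H x) (\<lambda>x. (1/2) *\<^sub>R G x + (1/2) *\<^sub>R H x)
      = form G G / 2 + form H H / 2 - form (\<lambda>x. G x - H x) (\<lambda>x. G x - H x) / 4"
      using form_lincomb[OF dv(4) dw(4), of "1/2" "1/2"] by (simp add: power2_eq_square field_simps)
    have sq: "integrable \<mu> (\<lambda>x. (v x - w x)\<^sup>2)" using l2_integrable_sq[OF d(2)] by simp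
    have "(\<integral>x. potential p lam m (1/2 * v x + 1/2 * w x) \<partial>\<mu>)
      \<le> (\<integral>x. potential p lam m (v x) / 2 + potential p lam m (w x) / 2 + c / 8 * (v x - w x)\<^sup>2 \<partial>\<mu>)"
    proof (rule integral_mono)
      show "potential p lam m (1/2 * v x + 1/2 * w x)
        \<le> potential p lam m (v x) / 2 + potential p lam m (w x) / 2 + c / 8 * (v x - w x)\<^sup>2" for x
        using c(2)[rule_format, of "v x" "w x"] by (simp add: add_divide_distrib)
    qed (use potential_integrable[OF mid] potential_integrable[OF v] potential_integrable[OF w] sq in auto)
    also have "\<dots> = (\<integral>x. potential p lam m (v x) \<partial>\<mu>) / 2 + (\<integral>x. potential p lam m (w x) \<partial>\<mu>) / 2
        + c / 8 * (n2 \<mu> (\<lambda>x. v x - w x))\<^sup>2"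
      using potential_integrable[OF v] potential_integrable[OF w] sq by (simp add: n2_sq)
    finally show ?thesis
      using form_bounds(1)[OF d(1)] unfolding energy_def f by (simp add: field_simps)
  qed
  with c(1) show ?thesis by (intro that[of c]) blast+
qed

lemma l2_complete_domain:
  fixes f :: "nat \<Rightarrow> 'a pt \<Rightarrow> 'b::euclidean_space"
  assumes f: "\<forall>k. l2 \<mu> (f k)"
    and cau: "\<forall>e>0. \<exists>N. \<forall>k\<ge>N. \<forall>l\<ge>N. n2 \<mu> (\<lambda>x. f k x - f l x) < e"
  obtains F where "F \<in> borel_measurable lebesgue" "l2 \<mu> F" "(\<lambda>k. n2 \<mu> (\<lambda>x. f k x - F x)) \<longlonglongrightarrow> 0"
proof -
  obtain F where F: "l2 \<mu> F" "(\<lambda>k. n2 \<mu> (\<lambda>x. f k x - F x)) \<longlonglongrightarrow> 0"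
    using l2_complete[OF finite_domain f cau] by blast
  \<comment> \<open>The L^2 limit is known to be measurable only on \<Omega>, while
    \<open>H10_grad\<close> asks for measurability on the whole space; extension by 0 supplies
    it.\<close>
  define F' where "F' x = (if x \<in> \<Omega> then F x else 0)" for x
  have m: "F' \<in> borel_measurable lebesgue"
    unfolding F'_def[abs_def] using l2_measurable[OF F(1)] domain_sets by (simp add: borel_measurable_if)
  have eq: "F' x = F x" if "x \<in> space \<mu>" for x
    using that by (simp add: F'_def space_restrict_space)
  have "l2 \<mu> F'"
    by (rule l2_dominated[OF measurable_restrict_space1[OF m] F(1), of 1]) (use eq in \<open>auto intro!: AE_I2\<close>)
  moreover have "n2 \<mu> (\<lambda>x. f k x - F' x) = n2 \<mu> (\<lambda>x. f k x - F x)" for k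
    unfolding n2_def by (intro arg_cong[where f = sqrt] Bochner_Integration.integral_cong) (auto simp: eq)
  ultimately show ?thesis using F(2) m by (intro that[of F']) auto
qed

lemma isCont_potential: "isCont (potential p lam m) s"
  using potential_has_derivative[of p m lam s] p_gt m_gt by (auto intro: DERIV_isCont)

text \<open>Norm convergence of the gradients makes the quadratic part converge, so the bounds on
  the energies become convergent bounds on the integrals of the potential. Fatou's lemma for the
  potential plus \<open>K0\<close>, along an a.e. convergent subsequence, yields both integrability
  of |u|^m and the inequality.\<close>

lemma energy_limit:
  assumes v: "\<forall>k. admissible (v k) (G k)" and E: "\<forall>k. energy (v k) (G k) \<le> e k" "e \<longlonglongrightarrow> I"
    and u: "u \<in> borel_measurable lebesgue" "l2 \<mu> u" "(\<lambda>k. n2 \<mu> (\<lambda>x. v k x - u x)) \<longlonglongrightarrow> 0"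
    and H: "H \<in> borel_measurable lebesgue" "l2 \<mu> H" "(\<lambda>k. n2 \<mu> (\<lambda>x. G k x - H x)) \<longlonglongrightarrow> 0"
  shows "admissible u H" "energy u H \<le> I"
proof -
  obtain K K0 where K: "0 \<le> K0" "K = (\<integral>x. K0 \<partial>\<mu>)"
    "\<forall>s. \<bar>s\<bar> powr m / (2 * m) \<le> potential p lam m s + K0"
    by (rule energy_coercive) blast
  note dv = admissibleD[OF v[rule_format]]
  have h: "H10_grad \<Omega> u H"
    by (rule H10_grad_limit[OF domain_sets _ u(1) H(1) u(2) H(2) u(3) H(3)]) (use dv in auto)
  obtain s :: "nat \<Rightarrow> nat" where s: "strict_mono s" "AE x in \<mu>. (\<lambda>k. v (s k) x) \<longlonglongrightarrow> u x"
    by (rule l2_AE_subseq[OF _ u(2,3)]) (use dv in auto)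
  have sl: "filterlim s sequentially sequentially" using s(1) by (rule filterlim_subseq)
  define f where "f k x = potential p lam m (v (s k) x) + K0" for k x
  have fi: "\<forall>k. integrable \<mu> (f k)"
    unfolding f_def using potential_integrable[OF v[rule_format]] const_integrable by auto
  have ge: "\<bar>t\<bar> powr m \<le> 2 * m * (potential p lam m t + K0)" for t
    using K(3)[rule_format, of t] p_gt m_gt by (simp add: field_simps)
  have pos: "0 \<le> potential p lam m t + K0" for t
    using ge[of t] powr_ge_zero[of "\<bar>t\<bar>" m] p_gt m_gt
    by (metis order_trans zero_le_mult_iff mult_pos_pos less_trans not_le zero_less_numeral)
  have lim: "AE x in \<mu>. (\<lambda>k. f k x) \<longlonglongrightarrow> potential p lam m (u x) + K0"
    using s(2)
  proof eventually_elim
    case (elim x)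
    show ?case unfolding f_def
      by (intro tendsto_intros isCont_tendsto_compose[OF isCont_potential] elim)
  qed
  define c where "c k = e (s k) - form (G (s k)) (G (s k)) / 2 + K" for k
  have "(\<lambda>k. form (G k) (G k)) \<longlonglongrightarrow> form H H"
    by (rule form_tendsto[OF _ H(2,3)]) (use dv in auto)
  then have "(\<lambda>k. form (G (s k)) (G (s k))) \<longlonglongrightarrow> form H H"
    by (rule filterlim_compose[OF _ sl])
  then have c: "c \<longlonglongrightarrow> I - form H H / 2 + K"
    unfolding c_def by (intro tendsto_intros filterlim_compose[OF E(2) sl]) auto
  have fc: "\<forall>k. (\<integral>x. f k x \<partial>\<mu>) \<le> c k"
  proof
    fix k
    have "(\<integral>x. f k x \<partial>\<mu>) = (\<integral>x. potential p lam m (v (s k) x) \<partial>\<mu>) + K"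
      unfolding f_def K(2) by (rule Bochner_Integration.integral_add[OF potential_integrable[OF v[rule_format]] const_integrable])
    also have "\<dots> \<le> c k"
      using E(1)[rule_format, of "s k"] by (simp add: energy_def c_def)
    finally show "(\<integral>x. f k x \<partial>\<mu>) \<le> c k" .
  qed
  note [measurable] = l2_measurable[OF u(2)]
  have um: "(\<lambda>x. potential p lam m (u x) + K0) \<in> borel_measurable \<mu>" by measurable
  have f0: "\<forall>k. AE x in \<mu>. 0 \<le> f k x" using pos by (simp add: f_def)
  note fat = fatou_integrable[OF fi f0 lim um fc c]
  have "integrable \<mu> (\<lambda>x. \<bar>u x\<bar> powr m)"
  proof (rule Bochner_Integration.integrable_bound)
    show "integrable \<mu> (\<lambda>x. 2 * m * (potential p lam m (u x) + K0))"
      using fat(1) by simp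
    show "AE x in \<mu>. norm (\<bar>u x\<bar> powr m) \<le> norm (2 * m * (potential p lam m (u x) + K0))"
    proof (rule AE_I2)
      fix x
      show "norm (\<bar>u x\<bar> powr m) \<le> norm (2 * m * (potential p lam m (u x) + K0))"
        using ge[of "u x"] powr_ge_zero[of "\<bar>u x\<bar>" m] unfolding real_norm_def by linarith
    qed
  qed measurable
  with h show a: "admissible u H" by (simp add: admissible_def)
  have "(\<integral>x. potential p lam m (u x) + K0 \<partial>\<mu>) = (\<integral>x. potential p lam m (u x) \<partial>\<mu>) + K"
    unfolding K(2) by (rule Bochner_Integration.integral_add[OF potential_integrable[OF a] const_integrable])
  with fat(2) show "energy u H \<le> I" by (simp add: energy_def)
qed

text \<open>Along a minimizing sequence compactness gives convergence in \<open>L\<^sup>2\<close>; since the energy is convex up to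
  a multiple of the squared \<open>L\<^sup>2\<close> norm, testing with midpoints shows that the gradients converge too.\<close>

lemma minimizer_exists:
  obtains u H where "admissible u H" "\<forall>v G. admissible v G \<longrightarrow> energy u H \<le> energy v G"
proof -
  obtain K K0 where K: "\<forall>v G. admissible v G \<longrightarrow> \<alpha> / 2 * (n2 \<mu> G)\<^sup>2 - K \<le> energy v G"
    by (rule energy_coercive) blast
  obtain c where c: "0 \<le> c" "\<forall>v G w H. admissible v G \<longrightarrow> admissible w H \<longrightarrow>
    energy (\<lambda>x. 1/2 * v x + 1/2 * w x) (\<lambda>x. (1/2) *\<^sub>R G x + (1/2) *\<^sub>R H x)
    \<le> energy v G / 2 + energy w H / 2 - \<alpha> / 8 * (n2 \<mu> (\<lambda>x. G x - H x))\<^sup>2 + c / 8 * (n2 \<mu> (\<lambda>x. v x - w x))\<^sup>2"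
    by (rule energy_midpoint)
  define S where "S = {energy v G | v G. admissible v G}"
  define I where "I = Inf S"
  have S0: "S \<noteq> {}" using admissible_zero by (auto simp: S_def)
  have "- K \<le> z" if zS: "z \<in> S" for z
  proof -
    obtain v G where z: "z = energy v G" "admissible v G" using zS by (auto simp: S_def)
    have "0 \<le> \<alpha> / 2 * (n2 \<mu> G)\<^sup>2" using \<alpha>_pos by simp
    then show ?thesis using K[rule_format, OF z(2)] z(1) by linarith
  qed
  then have bd: "bdd_below S" by (rule bdd_belowI)
  have I_le: "I \<le> energy v G" if "admissible v G" for v G
    unfolding I_def by (rule cInf_lower[OF _ bd]) (use that in \<open>auto simp: S_def\<close>)
  have "\<forall>k. \<exists>q. admissible (fst q) (snd q) \<and> energy (fst q) (snd q) < I + 1 / real (Suc k)"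
  proof
    fix k
    have "Inf S < I + 1 / real (Suc k)" by (simp add: I_def)
    then obtain z where "z \<in> S" "z < I + 1 / real (Suc k)"
      using cInf_less_iff[OF S0 bd] by blast
    then show "\<exists>q. admissible (fst q) (snd q) \<and> energy (fst q) (snd q) < I + 1 / real (Suc k)"
      by (auto simp: S_def)
  qed
  from choice[OF this] obtain q where q: "\<forall>k. admissible (fst (q k)) (snd (q k)) \<and> energy (fst (q k)) (snd (q k)) < I + 1 / real (Suc k)" ..
  \<comment> \<open>Coercivity at the energy level I + 1, below which the whole sequence
    stays.\<close>
  define D where "D = sqrt (2 * (I + 1 + K) / \<alpha>)"
  have D: "\<forall>k. n2 \<mu> (snd (q k)) \<le> D"
  proof
    fix k
    have "\<alpha> / 2 * (n2 \<mu> (snd (q k)))\<^sup>2 - K \<le> energy (fst (q k)) (snd (q k))" using K q by blast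
    also have "\<dots> < I + 1 / real (Suc k)" using q by blast
    also have "\<dots> \<le> I + 1" by simp
    finally have "(n2 \<mu> (snd (q k)))\<^sup>2 \<le> 2 * (I + 1 + K) / \<alpha>"
      using \<alpha>_pos by (simp add: field_simps)
    then show "n2 \<mu> (snd (q k)) \<le> D" unfolding D_def by (rule real_le_rsqrt)
  qed
  have "\<exists>r::nat \<Rightarrow> nat. strict_mono r \<and> (\<forall>e>0. \<exists>N. \<forall>k\<ge>N. \<forall>l\<ge>N.
      n2 \<mu> (\<lambda>x. fst (q (r k)) x - fst (q (r l)) x) < e)"
    by (rule H10_rellich[OF domain_sets bounded_domain _ D]) (use q admissibleD(1) in blast)
  then obtain r :: "nat \<Rightarrow> nat" where r: "strict_mono r" and rc: "\<forall>e>0. \<exists>N. \<forall>k\<ge>N. \<forall>l\<ge>N.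
      n2 \<mu> (\<lambda>x. fst (q (r k)) x - fst (q (r l)) x) < e"
    by blast
  define v where "v k = fst (q (r k))" for k
  define G where "G k = snd (q (r k))" for k
  have adm: "admissible (v k) (G k)" for k using q by (simp add: v_def G_def)
  note dv = admissibleD[OF adm]
  have en: "energy (v k) (G k) \<le> I + 1 / real (Suc k)" for k
  proof -
    have "energy (v k) (G k) < I + 1 / real (Suc (r k))" using q by (simp add: v_def G_def)
    also have "\<dots> \<le> I + 1 / real (Suc k)"
      using seq_suble[OF r, of k] by (simp add: frac_le)
    finally show ?thesis by simp
  qed
  have vc: "\<forall>e>0. \<exists>N. \<forall>k\<ge>N. \<forall>l\<ge>N. n2 \<mu> (\<lambda>x. v k x - v l x) < e"
    using rc by (simp add: v_def)
  have Gc: "\<forall>e>0. \<exists>N. \<forall>k\<ge>N. \<forall>l\<ge>N. n2 \<mu> (\<lambda>x. G k x - G l x) < e"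
  proof (intro allI impI)
    fix e :: real assume e: "0 < e"
    \<comment> \<open>Chosen backwards: the midpoint inequality will leave \<alpha> / 8 times the
      squared gradient distance below 2 b, which is \<alpha> e^2 / 8.\<close>
    define b where "b = \<alpha> * e\<^sup>2 / 16"
    have b: "0 < b" using e \<alpha>_pos by (simp add: b_def)
    \<comment> \<open>The denominator is c + 1 because \<open>c\<close> may be 0.\<close>
    define d where "d = sqrt (8 * b / (c + 1))"
    have d: "0 < d" "c / 8 * d\<^sup>2 \<le> b" using b c(1) by (auto simp: d_def field_simps)
    obtain N1 where N1: "\<forall>k\<ge>N1. \<forall>l\<ge>N1. n2 \<mu> (\<lambda>x. v k x - v l x) < d" using vc d(1) by blast
    obtain N2 where N2: "1 / real (Suc N2) < b" using nat_approx_posE[OF b] by blast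
    have "n2 \<mu> (\<lambda>x. G k x - G l x) < e" if kl: "k \<ge> max N1 N2" "l \<ge> max N1 N2" for k l
    proof -
      have s: "1 / real (Suc k) < b" "1 / real (Suc l) < b"
        using kl frac_le[of 1 1 "real (Suc N2)" "real (Suc k)"] frac_le[of 1 1 "real (Suc N2)" "real (Suc l)"] N2 by auto
      have "(n2 \<mu> (\<lambda>x. v k x - v l x))\<^sup>2 \<le> d\<^sup>2"
        using N1 kl by (intro power_mono) (auto intro: less_imp_le)
      then have vs: "c / 8 * (n2 \<mu> (\<lambda>x. v k x - v l x))\<^sup>2 \<le> b"
        using d(2) c(1) by (meson divide_nonneg_nonneg mult_left_mono order_trans zero_le_numeral)
      \<comment> \<open>The midpoint is admissible and cannot go below the infimum, while both
        endpoints have energy within \<open>b\<close> of it.\<close>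
      have "I \<le> energy (\<lambda>x. 1/2 * v k x + 1/2 * v l x) (\<lambda>x. (1/2) *\<^sub>R G k x + (1/2) *\<^sub>R G l x)"
        by (intro I_le admissible_lincomb adm)
      also have "\<dots> \<le> energy (v k) (G k) / 2 + energy (v l) (G l) / 2
         - \<alpha> / 8 * (n2 \<mu> (\<lambda>x. G k x - G l x))\<^sup>2 + c / 8 * (n2 \<mu> (\<lambda>x. v k x - v l x))\<^sup>2"
        using c(2) adm by blast
      finally have "\<alpha> / 8 * (n2 \<mu> (\<lambda>x. G k x - G l x))\<^sup>2 < 2 * b"
        using en[of k] en[of l] s vs by linarith
      then have "(n2 \<mu> (\<lambda>x. G k x - G l x))\<^sup>2 < e\<^sup>2"
        using \<alpha>_pos by (simp add: b_def field_simps)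
      then show ?thesis using e by (simp add: power2_less_imp_less)
    qed
    then show "\<exists>N. \<forall>k\<ge>N. \<forall>l\<ge>N. n2 \<mu> (\<lambda>x. G k x - G l x) < e" by blast
  qed
  obtain u where u: "u \<in> borel_measurable lebesgue" "l2 \<mu> u" "(\<lambda>k. n2 \<mu> (\<lambda>x. v k x - u x)) \<longlonglongrightarrow> 0"
    by (rule l2_complete_domain[OF _ vc]) (use dv in auto)
  obtain H where H: "H \<in> borel_measurable lebesgue" "l2 \<mu> H" "(\<lambda>k. n2 \<mu> (\<lambda>x. G k x - H x)) \<longlonglongrightarrow> 0"
    by (rule l2_complete_domain[OF _ Gc]) (use dv in auto)
  have "(\<lambda>k. I + 1 / real (Suc k)) \<longlonglongrightarrow> I + 0"
    by (intro tendsto_intros lim_1_over_n[THEN LIMSEQ_Suc])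
  then have el: "(\<lambda>k. I + 1 / real (Suc k)) \<longlonglongrightarrow> I" by simp
  note l = energy_limit[OF allI[OF adm] allI[OF en] el u H]
  show ?thesis
  proof (rule that[OF l(1)], intro allI impI)
    fix w F assume "admissible w F"
    then show "energy u H \<le> energy w F" using l(2) I_le by (meson order_trans)
  qed
qed

lemma nonneg_minimizer_exists:
  obtains u H where "admissible u H" "\<forall>v G. admissible v G \<longrightarrow> energy u H \<le> energy v G" "\<forall>x. 0 \<le> u x"
proof -
  obtain u H where u: "admissible u H" "\<forall>v G. admissible v G \<longrightarrow> energy u H \<le> energy v G"
    by (rule minimizer_exists)
  show ?thesis
  proof (rule that[OF admissible_abs[OF u(1)]])
    show "\<forall>v G. admissible v G \<longrightarrow> energy (\<lambda>x. \<bar>u x\<bar>) (\<lambda>x. sgn (u x) *\<^sub>R H x) \<le> energy v G"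
      using energy_abs_le[OF u(1)] u(2) by (meson order_trans)
  qed simp
qed

end

section \<open>The Euler--Lagrange equation\<close>

context elliptic_problem
begin

lemma abs_sum_powr_integrable:
  assumes v: "admissible v G" and w: "admissible w H"
  shows "integrable \<mu> (\<lambda>x. (2 * (\<bar>v x\<bar> + \<bar>w x\<bar>)) powr m)"
proof -
  note z = admissible_lincomb[OF admissible_abs[OF v] admissible_abs[OF w], of 2 2]
  have "\<bar>2 * \<bar>v x\<bar> + 2 * \<bar>w x\<bar>\<bar> = 2 * (\<bar>v x\<bar> + \<bar>w x\<bar>)" for x by simp
  then show ?thesis using admissibleD(2)[OF z] by simp
qed

text \<open>Differentiation along u + t w as t decreases to 0; minimality makes the quotients
  nonnegative. Dominated convergence uses the majorant of \<open>potential_increment_bound\<close>,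
  integrable because \<open>u\<close> and \<open>w\<close> lie in L^m.\<close>

lemma energy_variation_nonneg:
  assumes u: "admissible u G" and min: "\<forall>v F. admissible v F \<longrightarrow> energy u G \<le> energy v F"
    and w: "admissible w H"
  shows "0 \<le> form G H + (\<integral>x. potential_deriv p lam m (u x) * w x \<partial>\<mu>)"
proof -
  note du = admissibleD[OF u] and dw = admissibleD[OF w]
  note [measurable] = du(5) dw(5)
  define t where "t k = 1 / real (Suc k)" for k
  have t: "0 < t k" "t k \<le> 1" for k by (auto simp: t_def)
  have t0: "t \<longlonglongrightarrow> 0" unfolding t_def by (rule lim_1_over_n[THEN LIMSEQ_Suc])
  define Q where "Q k x = (potential p lam m (u x + t k * w x) - potential p lam m (u x)) / t k" for k x
  have adm: "admissible (\<lambda>x. 1 * u x + t k * w x) (\<lambda>x. 1 *\<^sub>R G x + t k *\<^sub>R H x)" for k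
    by (rule admissible_lincomb[OF u w])
  have pi: "integrable \<mu> (\<lambda>x. potential p lam m (u x + t k * w x))" for k
    using potential_integrable[OF adm[of k]] by simp
  \<comment> \<open>The quadratic form is expanded, the energy of \<open>u\<close> cancelled, and
    the factor \<open>t k\<close> divided out.\<close>
  have ge: "0 \<le> form G H + t k / 2 * form H H + (\<integral>x. Q k x \<partial>\<mu>)" for k
  proof -
    have "energy u G \<le> energy (\<lambda>x. 1 * u x + t k * w x) (\<lambda>x. 1 *\<^sub>R G x + t k *\<^sub>R H x)"
      using min adm by blast
    also have "\<dots> = form G G / 2 + t k * form G H + (t k)\<^sup>2 / 2 * form H H
        + (\<integral>x. potential p lam m (u x + t k * w x) \<partial>\<mu>)"
      unfolding energy_def form_lincomb[OF du(4) dw(4)] by (simp add: field_simps)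
    finally have "0 \<le> t k * form G H + (t k)\<^sup>2 / 2 * form H H
        + ((\<integral>x. potential p lam m (u x + t k * w x) \<partial>\<mu>) - (\<integral>x. potential p lam m (u x) \<partial>\<mu>))"
      by (simp add: energy_def)
    also have "(\<integral>x. potential p lam m (u x + t k * w x) \<partial>\<mu>) - (\<integral>x. potential p lam m (u x) \<partial>\<mu>)
        = t k * (\<integral>x. Q k x \<partial>\<mu>)"
      using pi[of k] potential_integrable[OF u] t(1)[of k] by (simp add: Q_def)
    also have "t k * form G H + (t k)\<^sup>2 / 2 * form H H + t k * (\<integral>x. Q k x \<partial>\<mu>)
        = t k * (form G H + t k / 2 * form H H + (\<integral>x. Q k x \<partial>\<mu>))"
      by (simp add: algebra_simps power2_eq_square)
    finally show ?thesis using t(1)[of k] by (simp add: zero_le_mult_iff)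
  qed
  have "(\<lambda>k. \<integral>x. Q k x \<partial>\<mu>) \<longlonglongrightarrow> (\<integral>x. potential_deriv p lam m (u x) * w x \<partial>\<mu>)"
  proof (rule integral_dominated_convergence[where w = "\<lambda>x. (1 + lam) * (2 * (\<bar>u x\<bar> + \<bar>w x\<bar>)) powr m + lam"])
    show "integrable \<mu> (\<lambda>x. (1 + lam) * (2 * (\<bar>u x\<bar> + \<bar>w x\<bar>)) powr m + lam)"
      using abs_sum_powr_integrable[OF u w] const_integrable by auto
    show "AE x in \<mu>. norm (Q k x) \<le> (1 + lam) * (2 * (\<bar>u x\<bar> + \<bar>w x\<bar>)) powr m + lam" for k
      unfolding Q_def real_norm_def
      by (intro AE_I2 potential_increment_bound) (use p_gt m_gt lam_pos t in auto)
    show "AE x in \<mu>. (\<lambda>k. Q k x) \<longlonglongrightarrow> potential_deriv p lam m (u x) * w x"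
    proof (rule AE_I2)
      fix x
      have "((\<lambda>r. u x + r * w x) has_real_derivative w x) (at 0)"
        by (auto intro!: derivative_eq_intros)
      moreover have "(potential p lam m has_real_derivative potential_deriv p lam m (u x)) (at (u x + 0 * w x))"
        using potential_has_derivative[of p m lam "u x"] p_gt m_gt by simp
      ultimately have "((\<lambda>r. potential p lam m (u x + r * w x)) has_real_derivative
          potential_deriv p lam m (u x) * w x) (at 0)"
        by (rule DERIV_chain2[rotated])
      then have "((\<lambda>h. (potential p lam m (u x + (0 + h) * w x) - potential p lam m (u x + 0 * w x)) / h)
          \<longlongrightarrow> potential_deriv p lam m (u x) * w x) (at 0)"
        by (rule DERIV_D)
      moreover have "filterlim t (at 0) sequentially"
        using t by (intro filterlim_atI t0) (simp add: less_imp_neq[THEN not_sym])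
      ultimately have "(\<lambda>k. (potential p lam m (u x + (0 + t k) * w x) - potential p lam m (u x + 0 * w x)) / t k)
          \<longlonglongrightarrow> potential_deriv p lam m (u x) * w x"
        by (rule filterlim_compose)
      then show "(\<lambda>k. Q k x) \<longlonglongrightarrow> potential_deriv p lam m (u x) * w x"
        by (simp add: Q_def)
    qed
    show "(\<lambda>x. potential_deriv p lam m (u x) * w x) \<in> borel_measurable \<mu>" by measurable
    show "Q k \<in> borel_measurable \<mu>" for k unfolding Q_def by measurable
  qed
  then have "(\<lambda>k. form G H + t k / 2 * form H H + (\<integral>x. Q k x \<partial>\<mu>))
      \<longlonglongrightarrow> form G H + 0 / 2 * form H H + (\<integral>x. potential_deriv p lam m (u x) * w x \<partial>\<mu>)"
    by (intro tendsto_intros t0) auto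
  then have "(\<lambda>k. form G H + t k / 2 * form H H + (\<integral>x. Q k x \<partial>\<mu>))
      \<longlonglongrightarrow> form G H + (\<integral>x. potential_deriv p lam m (u x) * w x \<partial>\<mu>)"
    by simp
  then show ?thesis
    by (rule LIMSEQ_le_const) (use ge in blast)
qed

text \<open>The one-sided inequality applied to \<open>w\<close> and to \<open>- w\<close>.\<close>

lemma euler_lagrange:
  assumes u: "admissible u G" and min: "\<forall>v F. admissible v F \<longrightarrow> energy u G \<le> energy v F"
    and w: "admissible w H"
  shows "form G H + (\<integral>x. potential_deriv p lam m (u x) * w x \<partial>\<mu>) = 0"
proof -
  have n: "admissible (\<lambda>x. - w x) (\<lambda>x. - H x)"
    using admissible_lincomb[OF w w, of "-1" 0] by simp
  have "form G (\<lambda>x. - H x) = - form G H" by (simp add: form_def)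
  then have "0 \<le> - form G H - (\<integral>x. potential_deriv p lam m (u x) * w x \<partial>\<mu>)"
    using energy_variation_nonneg[OF u min n] by simp
  then show ?thesis using energy_variation_nonneg[OF u min w] by linarith
qed

text \<open>Lets the integral of the derivative of the potential split into the two nonlinear terms
  of (P_m).\<close>

lemma power_term_integrable:
  assumes u: "admissible u G" and w: "admissible w H" and r: "1 < r" "r \<le> m"
  shows "integrable \<mu> (\<lambda>x. \<bar>u x\<bar> powr (r - 2) * u x * w x)"
proof (rule Bochner_Integration.integrable_bound)
  note [measurable] = admissibleD(5)[OF u] admissibleD(5)[OF w]
  show "integrable \<mu> (\<lambda>x. 1 + (2 * (\<bar>u x\<bar> + \<bar>w x\<bar>)) powr m)"
    using abs_sum_powr_integrable[OF u w] const_integrable by auto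
  show "AE x in \<mu>. norm (\<bar>u x\<bar> powr (r - 2) * u x * w x) \<le> norm (1 + (2 * (\<bar>u x\<bar> + \<bar>w x\<bar>)) powr m)"
  proof (rule AE_I2)
    fix x
    define z where "z = \<bar>u x\<bar> + \<bar>w x\<bar>"
    have z: "0 \<le> z" "\<bar>u x\<bar> \<le> z" "\<bar>w x\<bar> \<le> z" by (auto simp: z_def)
    have "\<bar>\<bar>u x\<bar> powr (r - 2) * u x * w x\<bar> = \<bar>u x\<bar> powr (r - 1) * \<bar>w x\<bar>"
      using powr_mult_base[of "\<bar>u x\<bar>" "r - 2"] by (simp add: abs_mult mult.commute)
    also have "\<dots> \<le> z powr (r - 1) * z"
      using z r by (intro mult_mono powr_mono2) auto
    also have "\<dots> = z powr r" using z(1) by (cases "z = 0") (auto simp: powr_diff)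
    also have "\<dots> \<le> 1 + z powr m" using z r by (intro powr_le_one_plus) auto
    also have "\<dots> \<le> 1 + (2 * z) powr m"
      using z p_gt m_gt by (intro add_left_mono powr_mono2) auto
    finally show "norm (\<bar>u x\<bar> powr (r - 2) * u x * w x) \<le> norm (1 + (2 * (\<bar>u x\<bar> + \<bar>w x\<bar>)) powr m)"
      unfolding real_norm_def z_def by (rule order_trans) (rule abs_ge_self)
  qed
  show "(\<lambda>x. \<bar>u x\<bar> powr (r - 2) * u x * w x) \<in> borel_measurable \<mu>" by measurable
qed

text \<open>On a nonnegative function the truncated nonlinearity of the energy coincides with that
  of (P_m), and every element of X_m is an admissible direction with its chosen gradient.\<close>

lemma nonneg_minimizer_solution:
  assumes u: "admissible u G" and min: "\<forall>v F. admissible v F \<longrightarrow> energy u G \<le> energy v F"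
    and pos: "\<forall>x. 0 \<le> u x"
  shows "is_solution_Pm \<Omega> M p lam m u"
  unfolding is_solution_Pm_def
proof (intro conjI ballI)
  show "u \<in> Xm \<Omega> m" by (rule admissible_Xm[OF u])
  fix v assume "v \<in> Xm \<Omega> m"
  then have v: "admissible v (wgrad \<Omega> v)" by (rule Xm_admissible)
  have wu: "admissible u (wgrad \<Omega> u)" by (rule Xm_admissible[OF admissible_Xm[OF u]])
  have "form (wgrad \<Omega> u) (wgrad \<Omega> v) = form G (wgrad \<Omega> v)"
    by (rule form_cong_AE) (use admissibleD(4) u v wu wgrad_AE[OF u] in auto)
  moreover have "(\<integral>x. potential_deriv p lam m (u x) * v x \<partial>\<mu>)
      = (\<integral>x. \<bar>u x\<bar> powr (m - 2) * u x * v x - lam * (\<bar>u x\<bar> powr (p - 2) * u x * v x) \<partial>\<mu>)"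
  proof (rule Bochner_Integration.integral_cong)
    fix x
    \<comment> \<open>Valid also where \<open>u x = 0\<close>, as \<open>0 powr r = 0\<close> for
      every exponent.\<close>
    have e: "\<bar>u x\<bar> powr (r - 2) * u x = u x powr (r - 1)" for r
      using powr_mult_base[of "u x" "r - 2"] pos by (simp add: mult.commute)
    show "potential_deriv p lam m (u x) * v x
        = \<bar>u x\<bar> powr (m - 2) * u x * v x - lam * (\<bar>u x\<bar> powr (p - 2) * u x * v x)"
      using pos unfolding e by (simp add: potential_deriv_def pospow_pos pospow_neg algebra_simps)
  qed simp
  moreover have "\<dots> = (\<integral>x. \<bar>u x\<bar> powr (m - 2) * u x * v x \<partial>\<mu>) - lam * (\<integral>x. \<bar>u x\<bar> powr (p - 2) * u x * v x \<partial>\<mu>)"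
    using power_term_integrable[OF u v, of m] power_term_integrable[OF u v, of p] p_gt m_gt by simp
  ultimately show "(LINT x:\<Omega>|lebesgue. (M x *v wgrad \<Omega> u x) \<bullet> wgrad \<Omega> v x)
        + (LINT x:\<Omega>|lebesgue. \<bar>u x\<bar> powr (m - 2) * u x * v x)
        - lam * (LINT x:\<Omega>|lebesgue. \<bar>u x\<bar> powr (p - 2) * u x * v x) = 0"
    using euler_lagrange[OF u min v] by (simp add: set_integral_lebesgue_on form_def)
qed

lemma Jm_minimizer_exists:
  obtains u where "u \<in> Xm \<Omega> m" "\<forall>v\<in>Xm \<Omega> m. Jm \<Omega> M p lam m u \<le> Jm \<Omega> M p lam m v" "\<forall>x. 0 \<le> u x"
    "is_solution_Pm \<Omega> M p lam m u"
proof -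
  obtain u H where u: "admissible u H" "\<forall>v G. admissible v G \<longrightarrow> energy u H \<le> energy v G" "\<forall>x. 0 \<le> u x"
    by (rule nonneg_minimizer_exists)
  show ?thesis
  proof (rule that[OF admissible_Xm[OF u(1)] _ u(3) nonneg_minimizer_solution[OF u]], intro ballI)
    fix v assume "v \<in> Xm \<Omega> m"
    then have v: "admissible v (wgrad \<Omega> v)" by (rule Xm_admissible)
    show "Jm \<Omega> M p lam m u \<le> Jm \<Omega> M p lam m v"
      using u(2) v by (simp add: Jm_eq_energy[OF u(1)] Jm_eq_energy[OF v])
  qed
qed

text \<open>Used in contraposition: a minimizer of negative energy does not vanish a.e.\<close>

lemma Jm_nonneg_of_AE_zero:
  assumes u: "u \<in> Xm \<Omega> m" and z: "AE x in \<mu>. u x = 0"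
  shows "0 \<le> Jm \<Omega> M p lam m u"
proof -
  note a = Xm_admissible[OF u]
  have "(\<integral>x. potential p lam m (u x) \<partial>\<mu>) = (\<integral>x. 0 \<partial>\<mu>)"
    by (rule integral_cong_AE) (use z potential_integrable[OF a] in auto)
  then show ?thesis
    using form_nonneg[OF admissibleD(4)[OF a]] by (simp add: Jm_eq_energy[OF a] energy_def)
qed

end

section \<open>The threshold\<close>

lemma bump_exists:
  fixes a :: "('n::finite) pt"
  assumes "open \<Omega>" "a \<in> \<Omega>"
  obtains \<phi> g r where "Cc1_grad \<Omega> \<phi> g" "0 < r" "ball a r \<subseteq> \<Omega>" "\<forall>x\<in>ball a r. \<phi> x \<noteq> 0"
proof -
  obtain r where r: "0 < r" "cball a r \<subseteq> \<Omega>"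
    using open_contains_cball assms by blast
  define P where "P x = r\<^sup>2 - (x - a) \<bullet> (x - a)" for x
  \<comment> \<open>The square of the positive part of r^2 - |x - a|^2; the exponent 2 makes it
    continuously differentiable across the sphere.\<close>
  define \<phi> where "\<phi> x = pospow 2 (P x)" for x
  define g where "g x = (- 4 * pospow 1 (P x)) *\<^sub>R (x - a)" for x
  have P: "(P has_derivative (\<lambda>h. - 2 * ((x - a) \<bullet> h))) (at x)" for x
    unfolding P_def by (auto intro!: derivative_eq_intros simp: inner_commute)
  have "Cc1_grad \<Omega> \<phi> g"
  proof (rule Cc1_gradI[of "cball a r"])
    show "\<forall>x. x \<notin> cball a r \<longrightarrow> \<phi> x = 0"
    proof (intro allI impI)
      fix x assume "x \<notin> cball a r"
      then have "r\<^sup>2 \<le> (norm (x - a))\<^sup>2"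
        using r(1) by (intro power_mono) (auto simp: dist_norm norm_minus_commute)
      then show "\<phi> x = 0" by (simp add: \<phi>_def P_def pospow_neg dot_square_norm)
    qed
    show "\<forall>x. (\<phi> has_derivative (\<lambda>h. g x \<bullet> h)) (at x)"
    proof
      fix x
      have "(pospow 2 has_derivative (\<lambda>h. h * (2 * pospow 1 (P x)))) (at (P x))"
        using pospow_has_derivative[of 2 "P x"] by (simp add: has_field_derivative_def mult_commute_abs)
      from has_derivative_compose[OF P this]
      show "(\<phi> has_derivative (\<lambda>h. g x \<bullet> h)) (at x)"
        unfolding \<phi>_def g_def by (rule has_derivative_eq_rhs) (auto simp: algebra_simps)
    qed
    show "continuous_on UNIV g"
      unfolding g_def P_def
      by (intro continuous_intros continuous_on_compose2[OF continuous_on_pospow]) auto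
  qed (use r in auto)
  moreover have "\<forall>x\<in>ball a r. \<phi> x \<noteq> 0"
  proof
    fix x assume "x \<in> ball a r"
    then have "(norm (x - a))\<^sup>2 < r\<^sup>2"
      by (intro power_strict_mono) (auto simp: dist_norm norm_minus_commute)
    then show "\<phi> x \<noteq> 0" by (simp add: \<phi>_def P_def pospow_def dot_square_norm)
  qed
  moreover have "ball a r \<subseteq> \<Omega>" using r(2) ball_subset_cball by blast
  ultimately show ?thesis using r(1) by (intro that) auto
qed

text \<open>\<open>real_of_ereal\<close> is faithful only on finite values: the essential supremum
  is below infinity by membership in \<open>Linf_space\<close>, and positive because \<psi> does not
  vanish a.e.\<close>

lemma Linf_norm_bound:
  fixes \<psi> :: "('n::finite) pt \<Rightarrow> real"
  assumes \<Omega>: "\<Omega> \<in> sets lebesgue" and \<psi>: "\<psi> \<in> Linf_space \<Omega>"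
    and nz: "\<not> (AE x in lebesgue. x \<in> \<Omega> \<longrightarrow> \<psi> x = 0)"
  shows "0 < Linf_norm \<Omega> \<psi>" "AE x in lebesgue_on \<Omega>. \<bar>\<psi> x\<bar> \<le> Linf_norm \<Omega> \<psi>"
proof -
  define S where "S = Linf_enorm \<Omega> \<psi>"
  have ae: "AE x in lebesgue_on \<Omega>. ereal \<bar>\<psi> x\<bar> \<le> S"
    unfolding S_def Linf_enorm_def by (rule esssup_AE)
  have "0 < S"
  proof (rule ccontr)
    assume "\<not> 0 < S"
    then have le: "S \<le> 0" by simp
    from ae have "AE x in lebesgue_on \<Omega>. \<psi> x = 0"
    proof eventually_elim
      case (elim x)
      then have "ereal \<bar>\<psi> x\<bar> \<le> 0" using le by (rule order_trans)
      then show ?case by simp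
    qed
    then show False using nz \<Omega> by (simp add: AE_restrict_space_iff)
  qed
  moreover have "S < \<infinity>" using \<psi> by (simp add: Linf_space_def S_def)
  ultimately obtain s where s: "S = ereal s" "0 < s" by (cases S) auto
  have n: "Linf_norm \<Omega> \<psi> = s" using s by (simp add: Linf_norm_def S_def[symmetric])
  show "0 < Linf_norm \<Omega> \<psi>" "AE x in lebesgue_on \<Omega>. \<bar>\<psi> x\<bar> \<le> Linf_norm \<Omega> \<psi>"
    using ae s by (auto simp: n)
qed

section \<open>The quotients that define the threshold\<close>

lemma Lnorm_powr:
  assumes "\<Omega> \<in> sets lebesgue" "0 < r"
  shows "Lnorm \<Omega> r v powr r = (\<integral>x. \<bar>v x\<bar> powr r \<partial>lebesgue_on \<Omega>)"
  using assms by (simp add: Lnorm_def set_integral_lebesgue_on powr_powr)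

lemma H10_norm_eq_n2: "\<Omega> \<in> sets lebesgue \<Longrightarrow> H10_norm \<Omega> v = n2 (lebesgue_on \<Omega>) (wgrad \<Omega> v)"
  by (simp add: H10_norm_def n2_def set_integral_lebesgue_on)

text \<open>Write |\<psi>|^r as |\<psi>|^(r-2) |\<psi>|^2. The integrability puts bounded elements
  of \<open>H10\<close> into X_m; the estimate, with Poincare's inequality, bounds the quotients
  below.\<close>

lemma bounded_powr_integral:
  fixes \<psi> :: "'a \<Rightarrow> real"
  assumes \<psi>: "l2 M \<psi>" and s: "0 < s" "AE x in M. \<bar>\<psi> x\<bar> \<le> s" and r: "2 \<le> r"
  shows "integrable M (\<lambda>x. \<bar>\<psi> x\<bar> powr r)" "(\<integral>x. \<bar>\<psi> x\<bar> powr r \<partial>M) \<le> s powr (r - 2) * (n2 M \<psi>)\<^sup>2"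
proof -
  have b: "AE x in M. \<bar>\<psi> x\<bar> powr r \<le> s powr (r - 2) * (norm (\<psi> x))\<^sup>2"
    using s(2)
  proof eventually_elim
    case (elim x)
    have "\<bar>\<psi> x\<bar> powr r = \<bar>\<psi> x\<bar> powr (r - 2) * (norm (\<psi> x))\<^sup>2"
      by (cases "\<psi> x = 0") (auto simp: powr_diff)
    also have "\<dots> \<le> s powr (r - 2) * (norm (\<psi> x))\<^sup>2"
      using elim r by (intro mult_right_mono powr_mono2) auto
    finally show ?case .
  qed
  have i: "integrable M (\<lambda>x. s powr (r - 2) * (norm (\<psi> x))\<^sup>2)"
    using l2_integrable_sq[OF \<psi>] by simp
  note [measurable] = l2_measurable[OF \<psi>]
  show I: "integrable M (\<lambda>x. \<bar>\<psi> x\<bar> powr r)"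
  proof (rule Bochner_Integration.integrable_bound[OF i])
    show "AE x in M. norm (\<bar>\<psi> x\<bar> powr r) \<le> norm (s powr (r - 2) * (norm (\<psi> x))\<^sup>2)"
      using b by eventually_elim (simp add: abs_mult)
  qed measurable
  have "(\<integral>x. \<bar>\<psi> x\<bar> powr r \<partial>M) \<le> (\<integral>x. s powr (r - 2) * (norm (\<psi> x))\<^sup>2 \<partial>M)"
    by (rule integral_mono_AE[OF I i b])
  then show "(\<integral>x. \<bar>\<psi> x\<bar> powr r \<partial>M) \<le> s powr (r - 2) * (n2 M \<psi>)\<^sup>2" by (simp add: n2_sq)
qed

lemma powr_integral_pos:
  fixes \<psi> :: "('n::finite) pt \<Rightarrow> real"
  assumes \<Omega>: "\<Omega> \<in> sets lebesgue" and i: "integrable (lebesgue_on \<Omega>) (\<lambda>x. \<bar>\<psi> x\<bar> powr r)"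
    and nz: "\<not> (AE x in lebesgue. x \<in> \<Omega> \<longrightarrow> \<psi> x = 0)"
  shows "0 < (\<integral>x. \<bar>\<psi> x\<bar> powr r \<partial>lebesgue_on \<Omega>)"
proof (rule ccontr)
  assume "\<not> ?thesis"
  moreover have "0 \<le> (\<integral>x. \<bar>\<psi> x\<bar> powr r \<partial>lebesgue_on \<Omega>)" by simp
  ultimately have "(\<integral>x. \<bar>\<psi> x\<bar> powr r \<partial>lebesgue_on \<Omega>) = 0" by linarith
  then have "AE x in lebesgue_on \<Omega>. \<bar>\<psi> x\<bar> powr r = 0"
    by (subst (asm) integral_nonneg_eq_0_iff_AE[OF i]) auto
  then have "AE x in lebesgue_on \<Omega>. \<psi> x = 0" by eventually_elim simp
  with nz \<Omega> show False by (simp add: AE_restrict_space_iff)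
qed

text \<open>The infimum of an empty set of reals carries no information; a bump supported in
  \<Omega> supplies a competitor.\<close>

lemma lambda1_quotients_nonempty:
  fixes \<Omega> :: "('n::finite) pt set"
  assumes \<Omega>: "open \<Omega>" "\<Omega> \<noteq> {}"
  shows "\<exists>\<psi>. \<psi> \<in> H10 \<Omega> \<inter> Linf_space \<Omega> \<and> \<not> (AE x in lebesgue. x \<in> \<Omega> \<longrightarrow> \<psi> x = 0)"
proof -
  have s: "\<Omega> \<in> sets lebesgue" using \<Omega> by auto
  obtain a where "a \<in> \<Omega>" using \<Omega> by blast
  then obtain \<phi> g r where \<phi>: "Cc1_grad \<Omega> \<phi> g" "0 < r" "ball a r \<subseteq> \<Omega>" "\<forall>x\<in>ball a r. \<phi> x \<noteq> 0"
    using bump_exists[OF \<Omega>(1)] by metis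
  obtain B R where B: "\<forall>x. \<bar>\<phi> x\<bar> \<le> B" by (rule Cc1_grad_bounded[OF \<phi>(1)])
  have h: "H10_grad \<Omega> \<phi> g" by (rule Cc1_grad_H10_grad[OF s \<phi>(1)])
  have m: "\<phi> \<in> borel_measurable lebesgue" by (rule H10_gradD(1)[OF s h])
  have "Linf_enorm \<Omega> \<phi> \<le> ereal B"
    unfolding Linf_enorm_def
  proof (rule esssup_I)
    note [measurable] = measurable_restrict_space1[OF m, of \<Omega>]
    show "(\<lambda>x. ereal \<bar>\<phi> x\<bar>) \<in> borel_measurable (lebesgue_on \<Omega>)" by measurable
  qed (use B in auto)
  then have "Linf_enorm \<Omega> \<phi> < \<infinity>" by (rule le_less_trans) simp
  moreover have "\<not> (AE x in lebesgue. x \<in> \<Omega> \<longrightarrow> \<phi> x = 0)"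
  proof
    assume "AE x in lebesgue. x \<in> \<Omega> \<longrightarrow> \<phi> x = 0"
    then have "AE x in lebesgue. x \<notin> ball a r"
      by eventually_elim (use \<phi> in blast)
    then have "ball a r \<in> null_sets lebesgue"
      by (subst AE_iff_null_sets) auto
    then have "negligible (ball a r)" by (simp add: negligible_iff_null_sets)
    then show False using open_not_negligible[of "ball a r"] \<phi>(2) by auto
  qed
  ultimately show ?thesis
    using h m by (intro exI[of _ \<phi>]) (auto simp: H10_def Linf_space_def)
qed

text \<open>The denominator is at most sup^(p-2) times the squared L^2 norm, hence at most sup^(p-2)
  (2 R)^2 times the squared gradient norm. Dividing p \<beta> / 2 by 4 R^2 gives the
  constant.\<close>

lemma lambda1_quotient_bound:
  fixes \<Omega> :: "('n::finite) pt set"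
  assumes \<Omega>: "\<Omega> \<in> sets lebesgue" and R: "0 < R" "\<forall>x\<in>\<Omega>. norm x \<le> R" and p: "2 < p" and \<beta>: "0 < \<beta>"
    and \<psi>: "\<psi> \<in> H10 \<Omega> \<inter> Linf_space \<Omega>" "\<not> (AE x in lebesgue. x \<in> \<Omega> \<longrightarrow> \<psi> x = 0)"
  shows "p * \<beta> / (8 * R\<^sup>2) \<le> p * \<beta> / 2 * (H10_norm \<Omega> \<psi>)\<^sup>2 * (Linf_norm \<Omega> \<psi>) powr (p - 2) / (Lnorm \<Omega> p \<psi>) powr p"
proof -
  have h: "H10_grad \<Omega> \<psi> (wgrad \<Omega> \<psi>)" using \<psi> by (intro H10_wgrad) simp
  define s where "s = Linf_norm \<Omega> \<psi>"
  define N where "N = n2 (lebesgue_on \<Omega>) (wgrad \<Omega> \<psi>)"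
  define J where "J = (\<integral>x. \<bar>\<psi> x\<bar> powr p \<partial>lebesgue_on \<Omega>)"
  have s: "0 < s" "AE x in lebesgue_on \<Omega>. \<bar>\<psi> x\<bar> \<le> s"
    using Linf_norm_bound[OF \<Omega> _ \<psi>(2)] \<psi>(1) by (auto simp: s_def)
  note b = bounded_powr_integral[OF H10_gradD(3)[OF \<Omega> h] s, of p]
  have J: "0 < J" unfolding J_def by (rule powr_integral_pos[OF \<Omega> b(1) \<psi>(2)]) (use p in simp)
  have "(n2 (lebesgue_on \<Omega>) \<psi>)\<^sup>2 \<le> (2 * R * N)\<^sup>2"
    unfolding N_def by (intro power_mono H10_poincare[OF \<Omega> h _ R(2)]) (use R in auto)
  then have "s powr (p - 2) * (n2 (lebesgue_on \<Omega>) \<psi>)\<^sup>2 \<le> s powr (p - 2) * (2 * R * N)\<^sup>2"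
    by (rule mult_left_mono) simp
  then have "J \<le> s powr (p - 2) * (4 * R\<^sup>2 * N\<^sup>2)"
    using b(2) p by (simp add: J_def power_mult_distrib)
  then have "p * \<beta> / (8 * R\<^sup>2) * J \<le> p * \<beta> / (8 * R\<^sup>2) * (s powr (p - 2) * (4 * R\<^sup>2 * N\<^sup>2))"
    using p \<beta> R by (intro mult_left_mono) auto
  also have "\<dots> = p * \<beta> / 2 * N\<^sup>2 * s powr (p - 2)" using R(1) by (simp add: field_simps)
  finally have "p * \<beta> / (8 * R\<^sup>2) \<le> p * \<beta> / 2 * N\<^sup>2 * s powr (p - 2) / J"
    using J by (simp add: pos_le_divide_eq)
  then show ?thesis
    using p by (simp add: H10_norm_eq_n2[OF \<Omega>] Lnorm_powr[OF \<Omega>] N_def s_def J_def)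
qed

lemma lambda1_low_pos:
  fixes \<Omega> :: "('n::finite) pt set"
  assumes \<Omega>: "open \<Omega>" "bounded \<Omega>" "\<Omega> \<noteq> {}" and p: "2 < p" and \<beta>: "0 < \<beta>"
  shows "0 < lambda1_low \<Omega> p \<beta>"
proof -
  have s: "\<Omega> \<in> sets lebesgue" using \<Omega> by auto
  obtain R where R: "0 < R" "\<forall>x\<in>\<Omega>. norm x \<le> R" using \<Omega>(2) by (auto simp: bounded_pos)
  have "0 < p * \<beta> / (8 * R\<^sup>2)" using p \<beta> R by simp
  also have "\<dots> \<le> lambda1_low \<Omega> p \<beta>"
    unfolding lambda1_low_def
  proof (rule cInf_greatest)
    fix z assume "z \<in> {p * \<beta> / 2 * (H10_norm \<Omega> \<psi>)\<^sup>2 * (Linf_norm \<Omega> \<psi>) powr (p - 2) / (Lnorm \<Omega> p \<psi>) powr p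
                          | \<psi>. \<psi> \<in> H10 \<Omega> \<inter> Linf_space \<Omega> \<and> \<not> (AE x in lebesgue. x \<in> \<Omega> \<longrightarrow> \<psi> x = 0)}"
    then show "p * \<beta> / (8 * R\<^sup>2) \<le> z" using lambda1_quotient_bound[OF s R p \<beta>] by blast
  qed (use lambda1_quotients_nonempty[OF \<Omega>(1,3)] in blast)
  finally show ?thesis .
qed

text \<open>The test function |\<psi>| / s has values in [0, 1] a.e., so its m-th power integrates
  to at most the measure of \<Omega>, and \<open>m\<close> enters the bound only through a term of
  order 1 / m. Taking |\<psi>| makes the positive part in \<open>Jm\<close> the whole
  function.\<close>

lemma (in elliptic_problem) Jm_test_function:
  assumes \<psi>: "\<psi> \<in> H10 \<Omega>" and s: "0 < s" "AE x in \<mu>. \<bar>\<psi> x\<bar> \<le> s" and \<beta>: "0 \<le> \<beta>"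
  shows "\<exists>v\<in>Xm \<Omega> m. Jm \<Omega> M p lam m v \<le> \<beta> / 2 * (H10_norm \<Omega> \<psi>)\<^sup>2 / s\<^sup>2 + (\<integral>x. 1 \<partial>\<mu>) / m
      - lam / p * (\<integral>x. \<bar>\<psi> x\<bar> powr p \<partial>\<mu>) / s powr p"
proof -
  define G where "G = wgrad \<Omega> \<psi>"
  have h: "H10_grad \<Omega> \<psi> G" unfolding G_def by (rule H10_wgrad[OF \<psi>])
  note d = H10_gradD[OF domain_sets h]
  have a: "admissible \<psi> G"
    unfolding admissible_def
    using h bounded_powr_integral(1)[OF d(3) s, of m] p_gt m_gt by simp
  note aa = admissible_abs[OF a]
  \<comment> \<open>The vanishing second summand brings the multiple into the shape of
    \<open>admissible_lincomb\<close>.\<close>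
  define v where "v x = 1 / s * \<bar>\<psi> x\<bar> + 0 * \<bar>\<psi> x\<bar>" for x
  define H where "H x = (1 / s) *\<^sub>R (sgn (\<psi> x) *\<^sub>R G x) + 0 *\<^sub>R (sgn (\<psi> x) *\<^sub>R G x)" for x
  have v: "admissible v H"
    unfolding v_def H_def by (rule admissible_lincomb[OF aa aa])
  have "form H H = (1 / s)\<^sup>2 * form (\<lambda>x. sgn (\<psi> x) *\<^sub>R G x) (\<lambda>x. sgn (\<psi> x) *\<^sub>R G x)"
    unfolding H_def form_lincomb[OF admissibleD(4)[OF aa] admissibleD(4)[OF aa]] by simp
  also have "\<dots> \<le> (1 / s)\<^sup>2 * (\<beta> * (n2 \<mu> G)\<^sup>2)"
    using form_sgn_le[OF d(4) admissibleD(4)[OF aa]] form_bounds(2)[OF d(4)]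
    by (intro mult_left_mono) auto
  finally have f: "form H H / 2 \<le> \<beta> / 2 * (H10_norm \<Omega> \<psi>)\<^sup>2 / s\<^sup>2"
    by (simp add: H10_norm_eq_n2 G_def field_simps power_divide)
  note bp = bounded_powr_integral(1)[OF d(3) s, of p]
  have "(\<integral>x. potential p lam m (v x) \<partial>\<mu>) \<le> (\<integral>x. 1 / m - lam / p * (\<bar>\<psi> x\<bar> powr p / s powr p) \<partial>\<mu>)"
  proof (rule integral_mono_AE[OF potential_integrable[OF v]])
    show "integrable \<mu> (\<lambda>x. 1 / m - lam / p * (\<bar>\<psi> x\<bar> powr p / s powr p))"
      using bp p_gt const_integrable by auto
    show "AE x in \<mu>. potential p lam m (v x) \<le> 1 / m - lam / p * (\<bar>\<psi> x\<bar> powr p / s powr p)"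
      using s(2)
    proof eventually_elim
      case (elim x)
      have "(\<bar>\<psi> x\<bar> / s) powr m \<le> 1 powr m"
        using elim s(1) p_gt m_gt by (intro powr_mono2) auto
      then have "(\<bar>\<psi> x\<bar> / s) powr m / m \<le> 1 / m"
        using p_gt m_gt by (intro divide_right_mono) auto
      then show ?case
        using s(1) by (simp add: potential_def v_def pospow_pos powr_divide)
    qed
  qed
  also have "\<dots> = (\<integral>x. 1 \<partial>\<mu>) / m - lam / p * (\<integral>x. \<bar>\<psi> x\<bar> powr p \<partial>\<mu>) / s powr p"
    using bp p_gt const_integrable by simp
  finally have "Jm \<Omega> M p lam m v \<le> \<beta> / 2 * (H10_norm \<Omega> \<psi>)\<^sup>2 / s\<^sup>2 + (\<integral>x. 1 \<partial>\<mu>) / m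
      - lam / p * (\<integral>x. \<bar>\<psi> x\<bar> powr p \<partial>\<mu>) / s powr p"
    using f by (simp add: Jm_eq_energy[OF v] energy_def)
  then show ?thesis using admissible_Xm[OF v] by blast
qed

theorem theorem2p1:
  fixes \<Omega> :: "(real ^ 'n) set"
    and M :: "real ^ 'n \<Rightarrow> real ^ 'n ^ 'n"
    and \<alpha> \<beta> p :: real
  assumes dom: "open \<Omega>" "connected \<Omega>" "bounded \<Omega>" "\<Omega> \<noteq> {}"
    and meas: "\<And>i j. (\<lambda>x. M x $ i $ j) \<in> borel_measurable lebesgue"
    and bdd: "\<exists>C. AE x in lebesgue. x \<in> \<Omega> \<longrightarrow> (\<forall>i j. \<bar>M x $ i $ j\<bar> \<le> C)"
    and sym: "AE x in lebesgue. x \<in> \<Omega> \<longrightarrow> transpose (M x) = M x"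
    and ell: "AE x in lebesgue. x \<in> \<Omega> \<longrightarrow>
               (\<forall>\<xi>. \<alpha> * (norm \<xi>)\<^sup>2 \<le> (M x *v \<xi>) \<bullet> \<xi> \<and> (M x *v \<xi>) \<bullet> \<xi> \<le> \<beta> * (norm \<xi>)\<^sup>2)"
    and \<alpha>: "0 < \<alpha>" "\<alpha> < \<beta>"
    and p: "2 < p"
  shows "lambda1_low \<Omega> p \<beta> > 0 \<and>
    (\<forall>lam. lam > lambda1_low \<Omega> p \<beta> \<longrightarrow>
      (\<exists>m0 \<delta>. m0 > p \<and> (CARD('n) > 2 \<longrightarrow> m0 > 2 * CARD('n) / (CARD('n) - 2)) \<and> \<delta> > 0 \<and>
        (\<forall>m. m \<ge> m0 \<longrightarrow>
          (\<exists>u. u \<in> Xm \<Omega> m \<and> (\<forall>v \<in> Xm \<Omega> m. Jm \<Omega> M p lam m u \<le> Jm \<Omega> M p lam m v) \<and>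
               (AE x in lebesgue. x \<in> \<Omega> \<longrightarrow> u x \<ge> 0) \<and>
               \<not> (AE x in lebesgue. x \<in> \<Omega> \<longrightarrow> u x = 0) \<and>
               is_solution_Pm \<Omega> M p lam m u \<and>
               Jm \<Omega> M p lam m u \<le> - \<delta>))))"
proof (intro conjI allI impI)
  have \<beta>: "0 < \<beta>" using \<alpha> by simp
  have sets: "\<Omega> \<in> sets lebesgue" using dom by auto
  show pos: "0 < lambda1_low \<Omega> p \<beta>" by (rule lambda1_low_pos[OF dom(1,3,4) p \<beta>])
  fix lam assume lam: "lambda1_low \<Omega> p \<beta> < lam"
  obtain \<psi> where \<psi>: "\<psi> \<in> H10 \<Omega> \<inter> Linf_space \<Omega>" "\<not> (AE x in lebesgue. x \<in> \<Omega> \<longrightarrow> \<psi> x = 0)"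
    and less: "p * \<beta> / 2 * (H10_norm \<Omega> \<psi>)\<^sup>2 * (Linf_norm \<Omega> \<psi>) powr (p - 2) / (Lnorm \<Omega> p \<psi>) powr p < lam"
    using cInf_lessD[OF _ lam[unfolded lambda1_low_def]] lambda1_quotients_nonempty[OF dom(1,4)] by blast
  define s where "s = Linf_norm \<Omega> \<psi>"
  define N where "N = H10_norm \<Omega> \<psi>"
  define J where "J = (\<integral>x. \<bar>\<psi> x\<bar> powr p \<partial>lebesgue_on \<Omega>)"
  define V where "V = (\<integral>x. 1 \<partial>lebesgue_on \<Omega> :: real)"
  have s: "0 < s" "AE x in lebesgue_on \<Omega>. \<bar>\<psi> x\<bar> \<le> s"
    using Linf_norm_bound[OF sets _ \<psi>(2)] \<psi>(1) by (auto simp: s_def)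
  have h: "H10_grad \<Omega> \<psi> (wgrad \<Omega> \<psi>)" using \<psi> by (intro H10_wgrad) simp
  have J: "0 < J"
    unfolding J_def using p
    by (intro powr_integral_pos[OF sets _ \<psi>(2)] bounded_powr_integral(1)[OF H10_gradD(3)[OF sets h] s]) simp
  \<comment> \<open>Minus the limit of the bound in \<open>Jm_test_function\<close> as
    \<open>m\<close> grows. Cleared of denominators, its positivity says that \<open>lam\<close>
    exceeds the quotient of \<psi>.\<close>
  define \<eta> where "\<eta> = lam / p * J / s powr p - \<beta> / 2 * N\<^sup>2 / s\<^sup>2"
  have "p * \<beta> / 2 * N\<^sup>2 * s powr (p - 2) / J < lam"
    using less p by (simp add: N_def s_def J_def Lnorm_powr[OF sets])
  then have "p * \<beta> / 2 * N\<^sup>2 * s powr (p - 2) < lam * J"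
    using J by (simp add: pos_divide_less_eq)
  also have "s powr (p - 2) = s powr p / s\<^sup>2" using s(1) by (simp add: powr_diff)
  finally have \<eta>: "0 < \<eta>" using p s(1) by (simp add: \<eta>_def field_simps)
  \<comment> \<open>The entries ensure in turn p < m, V / m <= \<eta> / 2 and, in dimension above 2,
    m0 > 2*. Half of \<eta> is thus left as the uniform gap \<delta>.\<close>
  define m0 where "m0 = max (max (p + 1) (2 * V / \<eta>)) (2 * CARD('n) / (CARD('n) - 2) + 1)"
  have main: "\<exists>u. u \<in> Xm \<Omega> m \<and> (\<forall>v \<in> Xm \<Omega> m. Jm \<Omega> M p lam m u \<le> Jm \<Omega> M p lam m v) \<and>
               (AE x in lebesgue. x \<in> \<Omega> \<longrightarrow> u x \<ge> 0) \<and>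
               \<not> (AE x in lebesgue. x \<in> \<Omega> \<longrightarrow> u x = 0) \<and>
               is_solution_Pm \<Omega> M p lam m u \<and>
               Jm \<Omega> M p lam m u \<le> - (\<eta> / 2)" if m: "m0 \<le> m" for m
  proof -
    have mp: "p < m" "2 * V / \<eta> \<le> m" using m by (auto simp: m0_def)
    \<comment> \<open>Positivity of \<open>lam\<close> follows from that of the threshold below
      it.\<close>
    interpret elliptic_problem \<Omega> M \<alpha> \<beta> p lam m
      using dom meas bdd sym ell \<alpha> p mp pos lam by unfold_locales auto
    obtain u where u: "u \<in> Xm \<Omega> m" "\<forall>v\<in>Xm \<Omega> m. Jm \<Omega> M p lam m u \<le> Jm \<Omega> M p lam m v"
      "\<forall>x. 0 \<le> u x" "is_solution_Pm \<Omega> M p lam m u"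
      by (rule Jm_minimizer_exists)
    obtain v where v: "v \<in> Xm \<Omega> m" "Jm \<Omega> M p lam m v \<le> \<beta> / 2 * N\<^sup>2 / s\<^sup>2 + V / m - lam / p * J / s powr p"
      using Jm_test_function[of \<psi> s] \<psi>(1) s \<beta> unfolding N_def J_def V_def by auto
    have "V / m \<le> \<eta> / 2" using mp p \<eta> by (simp add: field_simps)
    moreover have "Jm \<Omega> M p lam m u \<le> Jm \<Omega> M p lam m v" using u(2) v(1) by blast
    ultimately have neg: "Jm \<Omega> M p lam m u \<le> - (\<eta> / 2)"
      using v(2) \<eta>_def by linarith
    have "\<not> (AE x in lebesgue. x \<in> \<Omega> \<longrightarrow> u x = 0)"
      using Jm_nonneg_of_AE_zero[OF u(1)] neg \<eta> by (auto simp: AE_domain_iff)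
    then show ?thesis using u neg by blast
  qed
  show "\<exists>m0 \<delta>. m0 > p \<and> (CARD('n) > 2 \<longrightarrow> m0 > 2 * CARD('n) / (CARD('n) - 2)) \<and> \<delta> > 0 \<and>
        (\<forall>m. m \<ge> m0 \<longrightarrow>
          (\<exists>u. u \<in> Xm \<Omega> m \<and> (\<forall>v \<in> Xm \<Omega> m. Jm \<Omega> M p lam m u \<le> Jm \<Omega> M p lam m v) \<and>
               (AE x in lebesgue. x \<in> \<Omega> \<longrightarrow> u x \<ge> 0) \<and>
               \<not> (AE x in lebesgue. x \<in> \<Omega> \<longrightarrow> u x = 0) \<and>
               is_solution_Pm \<Omega> M p lam m u \<and>
               Jm \<Omega> M p lam m u \<le> - \<delta>))"
  proof (rule exI[of _ m0], rule exI[of _ "\<eta> / 2"], intro conjI)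
    show "p < m0" by (simp add: m0_def less_max_iff_disj)
    show "CARD('n) > 2 \<longrightarrow> m0 > 2 * CARD('n) / (CARD('n) - 2)" by (simp add: m0_def less_max_iff_disj)
  qed (use \<eta> main in auto)
qed

end
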